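(* Let $\mathbf{C}$ be a stiff category. The subunits in $\widehat{\mathbf{C}}_{\mathrm{fin}}$, $\widehat{\mathbf{C}}_{\mathrm{dir}}$, and $\widehat{\mathbf{C}}_{\mathrm{brd}}$ are the free completion of the semilattice $\mathrm{ISub}(\mathbf{C})$ to a distributive lattice, preframe, and frame, respectively.
   Context: An object name also denotes its identity morphism, and coherence isomorphisms are suppressed, so $s \otimes X$ also denotes the map $S \otimes X \to X$. Let $\mathbf{C}$ be braided monoidal with tensor unit $I$. A subunit is a subobject $s \colon S \rightarrowtail I$ such that $s \otimes S \colon S \otimes S \to I \otimes S$ is an isomorphism; $\mathrm{ISub}(\mathbf{C})$ is the collection of subunits, ordered as subobjects (size issues are disregarded). $\mathbf{C}$ is stiff when for all objects $X$ and subunits $s,t$ the square with top $s \otimes T \otimes X \colon S \otimes T \otimes X \to T \otimes X$, left $S \otimes t \otimes X \colon S \otimes T \otimes X \to S \otimes X$, right $t \otimes X \colon T \otimes X \to X$ and bottom $s \otimes X \colon S \otimes X \to X$ is a pullback of monomorphisms. Then $\mathrm{ISub}(\mathbf{C})$ is a meet-semilattice with top $I$ and $s \wedge t = \lambda_I \circ (s \otimes t)$. A morphism $f \colon A \to X$ restricts to a subunit $s$ when it factors through $s \otimes X \colon S \otimes X \to X$. A subset $U$ of a poset is directed when for any $a,b \in U$ there is $c \in U$ with $a \le c \ge b$; finitely bounded when it has a finite set of maximal elements, in the sense that each element of $U$ lies below one of finitely many maximal elements of $U$. A preframe is a semilattice (finite meets) in which every directed subset has a supremum and finite meets distribute over directed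 suprema. For $U \subseteq \mathrm{ISub}(\mathbf{C})$ and an object $X$, let $\langle U,X\rangle$ be the presheaf on $\mathbf{C}$ given by $A \mapsto \{ f \colon A \to X \mid f \text{ restricts to some } s \in U\}$. A presheaf on $\mathbf{C}$ is broad (finitely broad, directedly broad) when it is naturally isomorphic to some $\langle U,X\rangle$ with $U$ arbitrary (finitely bounded, directed). $\widehat{\mathbf{C}}_{\mathrm{brd}}$, $\widehat{\mathbf{C}}_{\mathrm{fin}}$, $\widehat{\mathbf{C}}_{\mathrm{dir}}$ denote the full subcategories of $[\mathbf{C}^{\mathrm{op}},\mathbf{Set}]$ of broad, finitely broad, directedly broad presheaves. For stiff $\mathbf{C}$ they are closed under Day convolution and contain its unit $\mathbf{C}(-,I)$, and so are braided monoidal. The map from $\mathrm{ISub}(\mathbf{C})$ to the subunits of each of these categories sends $s$ to the subunit $\langle \{s\}, I\rangle \rightarrowtail \mathbf{C}(-,I)$. *)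

theory Defs
  imports "HOL-Algebra.Complete_Lattice"
begin

section \<open>Categories and braided monoidal categories\<close>

record ('o, 'a) cat =
  Obj :: "'o set"
  Arr :: "'a set"
  Dom :: "'a \<Rightarrow> 'o"
  Cod :: "'a \<Rightarrow> 'o"
  Id :: "'o \<Rightarrow> 'a"
  Comp :: "'a \<Rightarrow> 'a \<Rightarrow> 'a" (infixr \<open>\<cdot>\<index>\<close> 70)

record ('o, 'a) tensor_cat = "('o, 'a) cat" +
  TObj :: "'o \<Rightarrow> 'o \<Rightarrow> 'o" (infixr \<open>\<otimes>\<index>\<close> 75)
  TArr :: "'a \<Rightarrow> 'a \<Rightarrow> 'a" (infixr \<open>\<boxtimes>\<index>\<close> 75)
  TUnit :: 'o

record ('o, 'a) braided_cat = "('o, 'a) tensor_cat" +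
  Assoc :: "'o \<Rightarrow> 'o \<Rightarrow> 'o \<Rightarrow> 'a"
  Lunit :: "'o \<Rightarrow> 'a"
  Runit :: "'o \<Rightarrow> 'a"
  Braid :: "'o \<Rightarrow> 'o \<Rightarrow> 'a"

definition Hom :: "('o, 'a, 'm) cat_scheme \<Rightarrow> 'o \<Rightarrow> 'o \<Rightarrow> 'a set" where
  "Hom C X Y = {f \<in> Arr C. Dom C f = X \<and> Cod C f = Y}"

definition is_iso :: "('o, 'a, 'm) cat_scheme \<Rightarrow> 'a \<Rightarrow> bool" where
  "is_iso C f \<longleftrightarrow> f \<in> Arr C \<and>
     (\<exists>g \<in> Hom C (Cod C f) (Dom C f). g \<cdot>\<^bsub>C\<^esub> f = Id C (Dom C f) \<and> f \<cdot>\<^bsub>C\<^esub> g = Id C (Cod C f))"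

definition inv_arr :: "('o, 'a, 'm) cat_scheme \<Rightarrow> 'a \<Rightarrow> 'a" where
  "inv_arr C f = (THE g. g \<in> Hom C (Cod C f) (Dom C f) \<and>
     g \<cdot>\<^bsub>C\<^esub> f = Id C (Dom C f) \<and> f \<cdot>\<^bsub>C\<^esub> g = Id C (Cod C f))"

definition isomorphic :: "('o, 'a, 'm) cat_scheme \<Rightarrow> 'o \<Rightarrow> 'o \<Rightarrow> bool" where
  "isomorphic C X Y \<longleftrightarrow> (\<exists>f \<in> Hom C X Y. is_iso C f)"

definition is_mono :: "('o, 'a, 'm) cat_scheme \<Rightarrow> 'a \<Rightarrow> bool" where
  "is_mono C f \<longleftrightarrow> f \<in> Arr C \<and>
     (\<forall>g \<in> Arr C. \<forall>h \<in> Arr C. Cod C g = Dom C f \<and> Cod C h = Dom C f \<and> Dom C g = Dom C h \<and>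
        f \<cdot>\<^bsub>C\<^esub> g = f \<cdot>\<^bsub>C\<^esub> h \<longrightarrow> g = h)"

text \<open>In \<open>is_pullback C p q g f\<close> the arrows are, in order, the top, left, right and bottom
  sides of the square, so that commutativity reads \<open>g \<cdot> p = f \<cdot> q\<close>.\<close>

definition is_pullback :: "('o, 'a, 'm) cat_scheme \<Rightarrow> 'a \<Rightarrow> 'a \<Rightarrow> 'a \<Rightarrow> 'a \<Rightarrow> bool" where
  "is_pullback C p q g f \<longleftrightarrow>
     {p, q, g, f} \<subseteq> Arr C \<and> Dom C p = Dom C q \<and> Cod C p = Dom C g \<and> Cod C q = Dom C f \<and>
     Cod C g = Cod C f \<and> g \<cdot>\<^bsub>C\<^esub> p = f \<cdot>\<^bsub>C\<^esub> q \<and>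
     (\<forall>W \<in> Obj C. \<forall>u \<in> Hom C W (Dom C g). \<forall>v \<in> Hom C W (Dom C f). g \<cdot>\<^bsub>C\<^esub> u = f \<cdot>\<^bsub>C\<^esub> v \<longrightarrow>
        (\<exists>!w. w \<in> Hom C W (Dom C p) \<and> p \<cdot>\<^bsub>C\<^esub> w = u \<and> q \<cdot>\<^bsub>C\<^esub> w = v))"

locale category =
  fixes C :: "('o, 'a, 'm) cat_scheme" (structure)
  assumes dom_obj: "f \<in> Arr C \<Longrightarrow> Dom C f \<in> Obj C"
    and cod_obj: "f \<in> Arr C \<Longrightarrow> Cod C f \<in> Obj C"
    and id_hom: "X \<in> Obj C \<Longrightarrow> Id C X \<in> Hom C X X"
    and comp_hom: "\<lbrakk>f \<in> Hom C X Y; g \<in> Hom C Y Z\<rbrakk> \<Longrightarrow> g \<cdot> f \<in> Hom C X Z"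
    and id_left: "f \<in> Hom C X Y \<Longrightarrow> Id C Y \<cdot> f = f"
    and id_right: "f \<in> Hom C X Y \<Longrightarrow> f \<cdot> Id C X = f"
    and comp_assoc: "\<lbrakk>f \<in> Hom C W X; g \<in> Hom C X Y; h \<in> Hom C Y Z\<rbrakk>
      \<Longrightarrow> (h \<cdot> g) \<cdot> f = h \<cdot> (g \<cdot> f)"

locale tensor_category = category C for C :: "('o, 'a, 'm) tensor_cat_scheme" (structure) +
  assumes unit_obj: "TUnit C \<in> Obj C"
    and tensor_obj: "\<lbrakk>X \<in> Obj C; Y \<in> Obj C\<rbrakk> \<Longrightarrow> X \<otimes> Y \<in> Obj C"
    and tensor_hom: "\<lbrakk>f \<in> Hom C X Y; g \<in> Hom C X' Y'\<rbrakk> \<Longrightarrow> f \<boxtimes> g \<in> Hom C (X \<otimes> X') (Y \<otimes> Y')"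
    and tensor_id: "\<lbrakk>X \<in> Obj C; Y \<in> Obj C\<rbrakk> \<Longrightarrow> Id C X \<boxtimes> Id C Y = Id C (X \<otimes> Y)"
    and tensor_comp: "\<lbrakk>f \<in> Hom C X Y; g \<in> Hom C Y Z; f' \<in> Hom C X' Y'; g' \<in> Hom C Y' Z'\<rbrakk>
      \<Longrightarrow> (g \<cdot> f) \<boxtimes> (g' \<cdot> f') = (g \<boxtimes> g') \<cdot> (f \<boxtimes> f')"

locale braided_monoidal_category = tensor_category C
  for C :: "('o, 'a, 'm) braided_cat_scheme" (structure) +
  assumes assoc_hom: "\<lbrakk>X \<in> Obj C; Y \<in> Obj C; Z \<in> Obj C\<rbrakk>
      \<Longrightarrow> Assoc C X Y Z \<in> Hom C ((X \<otimes> Y) \<otimes> Z) (X \<otimes> (Y \<otimes> Z))"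
    and assoc_iso: "\<lbrakk>X \<in> Obj C; Y \<in> Obj C; Z \<in> Obj C\<rbrakk> \<Longrightarrow> is_iso C (Assoc C X Y Z)"
    and assoc_nat: "\<lbrakk>f \<in> Hom C X X'; g \<in> Hom C Y Y'; h \<in> Hom C Z Z'\<rbrakk>
      \<Longrightarrow> Assoc C X' Y' Z' \<cdot> ((f \<boxtimes> g) \<boxtimes> h) = (f \<boxtimes> (g \<boxtimes> h)) \<cdot> Assoc C X Y Z"
    and lunit_hom: "X \<in> Obj C \<Longrightarrow> Lunit C X \<in> Hom C (TUnit C \<otimes> X) X"
    and lunit_iso: "X \<in> Obj C \<Longrightarrow> is_iso C (Lunit C X)"
    and lunit_nat: "f \<in> Hom C X Y \<Longrightarrow> Lunit C Y \<cdot> (Id C (TUnit C) \<boxtimes> f) = f \<cdot> Lunit C X"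
    and runit_hom: "X \<in> Obj C \<Longrightarrow> Runit C X \<in> Hom C (X \<otimes> TUnit C) X"
    and runit_iso: "X \<in> Obj C \<Longrightarrow> is_iso C (Runit C X)"
    and runit_nat: "f \<in> Hom C X Y \<Longrightarrow> Runit C Y \<cdot> (f \<boxtimes> Id C (TUnit C)) = f \<cdot> Runit C X"
    and pentagon: "\<lbrakk>W \<in> Obj C; X \<in> Obj C; Y \<in> Obj C; Z \<in> Obj C\<rbrakk>
      \<Longrightarrow> (Id C W \<boxtimes> Assoc C X Y Z) \<cdot> Assoc C W (X \<otimes> Y) Z \<cdot> (Assoc C W X Y \<boxtimes> Id C Z)
          = Assoc C W X (Y \<otimes> Z) \<cdot> Assoc C (W \<otimes> X) Y Z"
    and triangle: "\<lbrakk>X \<in> Obj C; Y \<in> Obj C\<rbrakk>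
      \<Longrightarrow> (Id C X \<boxtimes> Lunit C Y) \<cdot> Assoc C X (TUnit C) Y = Runit C X \<boxtimes> Id C Y"
    and braid_hom: "\<lbrakk>X \<in> Obj C; Y \<in> Obj C\<rbrakk> \<Longrightarrow> Braid C X Y \<in> Hom C (X \<otimes> Y) (Y \<otimes> X)"
    and braid_iso: "\<lbrakk>X \<in> Obj C; Y \<in> Obj C\<rbrakk> \<Longrightarrow> is_iso C (Braid C X Y)"
    and braid_nat: "\<lbrakk>f \<in> Hom C X X'; g \<in> Hom C Y Y'\<rbrakk>
      \<Longrightarrow> Braid C X' Y' \<cdot> (f \<boxtimes> g) = (g \<boxtimes> f) \<cdot> Braid C X Y"
    and hexagon1: "\<lbrakk>X \<in> Obj C; Y \<in> Obj C; Z \<in> Obj C\<rbrakk>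
      \<Longrightarrow> Assoc C Y Z X \<cdot> Braid C X (Y \<otimes> Z) \<cdot> Assoc C X Y Z
          = (Id C Y \<boxtimes> Braid C X Z) \<cdot> Assoc C Y X Z \<cdot> (Braid C X Y \<boxtimes> Id C Z)"
    and hexagon2: "\<lbrakk>X \<in> Obj C; Y \<in> Obj C; Z \<in> Obj C\<rbrakk>
      \<Longrightarrow> Braid C (X \<otimes> Y) Z
          = Assoc C Z X Y \<cdot> (Braid C X Z \<boxtimes> Id C Y) \<cdot> inv_arr C (Assoc C X Z Y) \<cdot>
              (Id C X \<boxtimes> Braid C Y Z) \<cdot> Assoc C X Y Z"

definition full_sub :: "('o, 'a, 'm) cat_scheme \<Rightarrow> ('o \<Rightarrow> bool) \<Rightarrow> ('o, 'a, 'm) cat_scheme" where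
  "full_sub C P = C\<lparr>Obj := {X \<in> Obj C. P X}, Arr := {f \<in> Arr C. P (Dom C f) \<and> P (Cod C f)}\<rparr>"

section \<open>Subunits\<close>

definition sub_le :: "('o, 'a, 'm) cat_scheme \<Rightarrow> 'a \<Rightarrow> 'a \<Rightarrow> bool" where
  "sub_le C s t \<longleftrightarrow> Cod C s = Cod C t \<and> (\<exists>g \<in> Hom C (Dom C s) (Dom C t). s = t \<cdot>\<^bsub>C\<^esub> g)"

text \<open>A subobject is an equivalence class of monomorphisms; \<open>subobj C s\<close> is the class of \<open>s\<close>.\<close>

definition subobj :: "('o, 'a, 'm) cat_scheme \<Rightarrow> 'a \<Rightarrow> 'a set" where
  "subobj C s = {t. is_mono C t \<and> sub_le C s t \<and> sub_le C t s}"

definition subunit :: "('o, 'a, 'm) tensor_cat_scheme \<Rightarrow> 'a \<Rightarrow> bool" where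
  "subunit C s \<longleftrightarrow> is_mono C s \<and> Cod C s = TUnit C \<and> is_iso C (s \<boxtimes>\<^bsub>C\<^esub> Id C (Dom C s))"

definition ISub :: "('o, 'a, 'm) tensor_cat_scheme \<Rightarrow> 'a set gorder" where
  "ISub C = \<lparr>carrier = {subobj C s | s. subunit C s}, eq = (=),
     le = (\<lambda>p q. \<exists>s \<in> p. \<exists>t \<in> q. sub_le C s t)\<rparr>"

text \<open>\<open>act C s X\<close> is the map \<open>S \<otimes> X \<rightarrow> X\<close> which is written \<open>s \<otimes> X\<close> when coherence
  isomorphisms are suppressed.\<close>

definition act :: "('o, 'a, 'm) braided_cat_scheme \<Rightarrow> 'a \<Rightarrow> 'o \<Rightarrow> 'a" where
  "act C s X = Lunit C X \<cdot>\<^bsub>C\<^esub> (s \<boxtimes>\<^bsub>C\<^esub> Id C X)"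

locale stiff_category = braided_monoidal_category C
  for C :: "('o, 'a, 'm) braided_cat_scheme" (structure) +
  assumes stiff_mono: "\<lbrakk>X \<in> Obj C; subunit C s; subunit C t\<rbrakk>
      \<Longrightarrow> is_mono C (act C s (Dom C t \<otimes> X)) \<and> is_mono C (Id C (Dom C s) \<boxtimes> act C t X) \<and>
          is_mono C (act C t X) \<and> is_mono C (act C s X)"
    and stiff_pullback: "\<lbrakk>X \<in> Obj C; subunit C s; subunit C t\<rbrakk>
      \<Longrightarrow> is_pullback C (act C s (Dom C t \<otimes> X)) (Id C (Dom C s) \<boxtimes> act C t X)
            (act C t X) (act C s X)"

definition restricts :: "('o, 'a, 'm) braided_cat_scheme \<Rightarrow> 'a \<Rightarrow> 'a set \<Rightarrow> bool" where
  "restricts C f p \<longleftrightarrow> (\<exists>s \<in> p. \<exists>g \<in> Hom C (Dom C f) (Dom C s \<otimes>\<^bsub>C\<^esub> Cod C f).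
     f = act C s (Cod C f) \<cdot>\<^bsub>C\<^esub> g)"

section \<open>Presheaves and Day convolution\<close>

text \<open>The role of the category of sets is played by the subsets of the following type. Besides
  arbitrary atoms it contains the arrows of the given category, from which the representable
  presheaves are built, and it is closed under forming the elements \<open>[B, B', f, x, y]\<close> of the
  coend defining Day convolution, so that Day convolution never leaves this universe.\<close>

datatype ('x, 'o, 'a) elt =
    AtomE 'x
  | ArrE (un_arr: 'a)
  | DayE (un_day: "'o \<times> 'o \<times> 'a \<times> ('x, 'o, 'a) elt \<times> ('x, 'o, 'a) elt")

record ('o, 'a, 'e) presheaf =
  PObj :: "'o \<Rightarrow> 'e set"
  PMap :: "'a \<Rightarrow> 'e \<Rightarrow> 'e"

record ('o, 'a, 'e) nat_trans =
  NDom :: "('o, 'a, 'e) presheaf"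
  NCod :: "('o, 'a, 'e) presheaf"
  NMap :: "'o \<Rightarrow> 'e \<Rightarrow> 'e"

text \<open>All functions involved are taken to be extensional, so that equality of presheaves and of
  natural transformations is equality in HOL.\<close>

definition is_presheaf :: "('o, 'a, 'm) cat_scheme \<Rightarrow> ('o, 'a, 'e) presheaf \<Rightarrow> bool" where
  "is_presheaf C F \<longleftrightarrow>
     PObj F \<in> extensional (Obj C) \<and>
     PMap F \<in> (\<Pi>\<^sub>E f \<in> Arr C. PObj F (Cod C f) \<rightarrow>\<^sub>E PObj F (Dom C f)) \<and>
     (\<forall>X \<in> Obj C. \<forall>x \<in> PObj F X. PMap F (Id C X) x = x) \<and>
     (\<forall>f \<in> Arr C. \<forall>g \<in> Arr C. Cod C f = Dom C g \<longrightarrow>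
        (\<forall>x \<in> PObj F (Cod C g). PMap F (g \<cdot>\<^bsub>C\<^esub> f) x = PMap F f (PMap F g x)))"

definition is_nat_trans :: "('o, 'a, 'm) cat_scheme \<Rightarrow> ('o, 'a, 'e) nat_trans \<Rightarrow> bool" where
  "is_nat_trans C n \<longleftrightarrow> is_presheaf C (NDom n) \<and> is_presheaf C (NCod n) \<and>
     NMap n \<in> (\<Pi>\<^sub>E X \<in> Obj C. PObj (NDom n) X \<rightarrow>\<^sub>E PObj (NCod n) X) \<and>
     (\<forall>f \<in> Arr C. \<forall>x \<in> PObj (NDom n) (Cod C f).
        NMap n (Dom C f) (PMap (NDom n) f x) = PMap (NCod n) f (NMap n (Cod C f) x))"

definition nat_id :: "('o, 'a, 'm) cat_scheme \<Rightarrow> ('o, 'a, 'e) presheaf \<Rightarrow> ('o, 'a, 'e) nat_trans" where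
  "nat_id C F = \<lparr>NDom = F, NCod = F, NMap = (\<lambda>X \<in> Obj C. \<lambda>x \<in> PObj F X. x)\<rparr>"

definition nat_comp :: "('o, 'a, 'm) cat_scheme \<Rightarrow> ('o, 'a, 'e) nat_trans \<Rightarrow> ('o, 'a, 'e) nat_trans
    \<Rightarrow> ('o, 'a, 'e) nat_trans" where
  "nat_comp C n m = \<lparr>NDom = NDom m, NCod = NCod n,
     NMap = (\<lambda>X \<in> Obj C. \<lambda>x \<in> PObj (NDom m) X. NMap n X (NMap m X x))\<rparr>"

definition representable :: "('o, 'a, 'm) cat_scheme \<Rightarrow> 'o \<Rightarrow> ('o, 'a, ('x, 'o, 'a) elt) presheaf" where
  "representable C X =
     \<lparr>PObj = (\<lambda>A \<in> Obj C. ArrE ` Hom C A X),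
      PMap = (\<lambda>f \<in> Arr C. \<lambda>e \<in> ArrE ` Hom C (Cod C f) X. ArrE (un_arr e \<cdot>\<^bsub>C\<^esub> f))\<rparr>"

text \<open>The Day convolution of \<open>F\<close> and \<open>G\<close> at \<open>A\<close> is the coend
  \<open>\<integral>\<^bsup>B,B'\<^esup> C(A, B \<otimes> B') \<times> F B \<times> G B'\<close>: the quotient of the set \<open>day_pre\<close> of tuples by the
  equivalence relation \<open>day_eq\<close> generated by \<open>day_step\<close>. An equivalence class is encoded as
  an element of the universe through a chosen representative.\<close>

definition day_pre :: "('o, 'a, 'm) tensor_cat_scheme \<Rightarrow> ('o, 'a, 'e) presheaf \<Rightarrow> ('o, 'a, 'e) presheaf
    \<Rightarrow> 'o \<Rightarrow> ('o \<times> 'o \<times> 'a \<times> 'e \<times> 'e) set" where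
  "day_pre C F G A = {(B, B', f, x, y) | B B' f x y. B \<in> Obj C \<and> B' \<in> Obj C \<and>
     f \<in> Hom C A (B \<otimes>\<^bsub>C\<^esub> B') \<and> x \<in> PObj F B \<and> y \<in> PObj G B'}"

definition day_step :: "('o, 'a, 'm) tensor_cat_scheme \<Rightarrow> ('o, 'a, 'e) presheaf \<Rightarrow> ('o, 'a, 'e) presheaf
    \<Rightarrow> 'o \<Rightarrow> ('o \<times> 'o \<times> 'a \<times> 'e \<times> 'e) rel" where
  "day_step C F G A =
     {((Dom C b, Dom C b', f, PMap F b x, PMap G b' y),
       (Cod C b, Cod C b', (b \<boxtimes>\<^bsub>C\<^esub> b') \<cdot>\<^bsub>C\<^esub> f, x, y)) | b b' f x y.
      b \<in> Arr C \<and> b' \<in> Arr C \<and> f \<in> Hom C A (Dom C b \<otimes>\<^bsub>C\<^esub> Dom C b') \<and>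
      x \<in> PObj F (Cod C b) \<and> y \<in> PObj G (Cod C b')}"

definition day_eq :: "('o, 'a, 'm) tensor_cat_scheme \<Rightarrow> ('o, 'a, 'e) presheaf \<Rightarrow> ('o, 'a, 'e) presheaf
    \<Rightarrow> 'o \<Rightarrow> ('o \<times> 'o \<times> 'a \<times> 'e \<times> 'e) rel" where
  "day_eq C F G A = (day_step C F G A \<union> (day_step C F G A)\<inverse>)\<^sup>*"

definition day_elt :: "('o, 'a, 'm) tensor_cat_scheme
    \<Rightarrow> ('o, 'a, ('x, 'o, 'a) elt) presheaf \<Rightarrow> ('o, 'a, ('x, 'o, 'a) elt) presheaf \<Rightarrow> 'o
    \<Rightarrow> 'o \<times> 'o \<times> 'a \<times> ('x, 'o, 'a) elt \<times> ('x, 'o, 'a) elt \<Rightarrow> ('x, 'o, 'a) elt" where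
  "day_elt C F G A z = DayE (SOME w. w \<in> day_eq C F G A `` {z})"

definition day :: "('o, 'a, 'm) tensor_cat_scheme
    \<Rightarrow> ('o, 'a, ('x, 'o, 'a) elt) presheaf \<Rightarrow> ('o, 'a, ('x, 'o, 'a) elt) presheaf
    \<Rightarrow> ('o, 'a, ('x, 'o, 'a) elt) presheaf" where
  "day C F G =
     \<lparr>PObj = (\<lambda>A \<in> Obj C. day_elt C F G A ` day_pre C F G A),
      PMap = (\<lambda>h \<in> Arr C. \<lambda>e \<in> day_elt C F G (Cod C h) ` day_pre C F G (Cod C h).
        case un_day e of (B, B', f, x, y) \<Rightarrow> day_elt C F G (Dom C h) (B, B', f \<cdot>\<^bsub>C\<^esub> h, x, y))\<rparr>"

definition day_map :: "('o, 'a, 'm) tensor_cat_scheme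
    \<Rightarrow> ('o, 'a, ('x, 'o, 'a) elt) nat_trans \<Rightarrow> ('o, 'a, ('x, 'o, 'a) elt) nat_trans
    \<Rightarrow> ('o, 'a, ('x, 'o, 'a) elt) nat_trans" where
  "day_map C m n =
     \<lparr>NDom = day C (NDom m) (NDom n), NCod = day C (NCod m) (NCod n),
      NMap = (\<lambda>A \<in> Obj C. \<lambda>e \<in> PObj (day C (NDom m) (NDom n)) A.
        case un_day e of (B, B', f, x, y) \<Rightarrow>
          day_elt C (NCod m) (NCod n) A (B, B', f, NMap m B x, NMap n B' y))\<rparr>"

type_synonym ('x, 'o, 'a) psh_cat =
  "(('o, 'a, ('x, 'o, 'a) elt) presheaf, ('o, 'a, ('x, 'o, 'a) elt) nat_trans) tensor_cat"

text \<open>Only the tensor product and unit of the braided monoidal structure of a presheaf category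
  are recorded: its subunits do not depend on the coherence isomorphisms.\<close>

definition PSh :: "('o, 'a, 'm) tensor_cat_scheme
    \<Rightarrow> ('x, 'o, 'a) psh_cat" where
  "PSh C =
     \<lparr>Obj = {F. is_presheaf C F}, Arr = {n. is_nat_trans C n}, Dom = NDom, Cod = NCod,
      Id = nat_id C, Comp = nat_comp C,
      TObj = day C, TArr = day_map C, TUnit = representable C (TUnit C)\<rparr>"

section \<open>Broad presheaves\<close>

definition directed :: "'l gorder \<Rightarrow> 'l set \<Rightarrow> bool" where
  "directed L U \<longleftrightarrow> U \<subseteq> carrier L \<and>
     (\<forall>a \<in> U. \<forall>b \<in> U. \<exists>c \<in> U. a \<sqsubseteq>\<^bsub>L\<^esub> c \<and> b \<sqsubseteq>\<^bsub>L\<^esub> c)"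

definition finitely_bounded :: "'l gorder \<Rightarrow> 'l set \<Rightarrow> bool" where
  "finitely_bounded L U \<longleftrightarrow> U \<subseteq> carrier L \<and>
     (\<exists>M. finite M \<and> M \<subseteq> {m \<in> U. \<forall>u \<in> U. m \<sqsubseteq>\<^bsub>L\<^esub> u \<longrightarrow> u = m} \<and> (\<forall>u \<in> U. \<exists>m \<in> M. u \<sqsubseteq>\<^bsub>L\<^esub> m))"

definition bracket :: "('o, 'a, 'm) braided_cat_scheme \<Rightarrow> 'a set set \<Rightarrow> 'o
    \<Rightarrow> ('o, 'a, ('x, 'o, 'a) elt) presheaf" where
  "bracket C U X =
     \<lparr>PObj = (\<lambda>A \<in> Obj C. ArrE ` {f \<in> Hom C A X. \<exists>p \<in> U. restricts C f p}),
      PMap = (\<lambda>h \<in> Arr C. \<lambda>e \<in> ArrE ` {f \<in> Hom C (Cod C h) X. \<exists>p \<in> U. restricts C f p}.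
        ArrE (un_arr e \<cdot>\<^bsub>C\<^esub> h))\<rparr>"

definition broad_wrt :: "('o, 'a, 'm) braided_cat_scheme \<Rightarrow> ('a set set \<Rightarrow> bool)
    \<Rightarrow> ('o, 'a, ('x, 'o, 'a) elt) presheaf \<Rightarrow> bool" where
  "broad_wrt C P F \<longleftrightarrow>
     (\<exists>U X. U \<subseteq> carrier (ISub C) \<and> P U \<and> X \<in> Obj C \<and> isomorphic (PSh C) F (bracket C U X))"

definition PSh_brd :: "('o, 'a, 'm) braided_cat_scheme
    \<Rightarrow> ('x, 'o, 'a) psh_cat" where
  "PSh_brd C = full_sub (PSh C) (broad_wrt C (\<lambda>U. True))"

definition PSh_fin :: "('o, 'a, 'm) braided_cat_scheme
    \<Rightarrow> ('x, 'o, 'a) psh_cat" where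
  "PSh_fin C = full_sub (PSh C) (broad_wrt C (finitely_bounded (ISub C)))"

definition PSh_dir :: "('o, 'a, 'm) braided_cat_scheme
    \<Rightarrow> ('x, 'o, 'a) psh_cat" where
  "PSh_dir C = full_sub (PSh C) (broad_wrt C (directed (ISub C)))"

definition bracket_incl :: "('o, 'a, 'm) braided_cat_scheme \<Rightarrow> 'a set set
    \<Rightarrow> ('o, 'a, ('x, 'o, 'a) elt) nat_trans" where
  "bracket_incl C U = \<lparr>NDom = bracket C U (TUnit C), NCod = representable C (TUnit C),
     NMap = (\<lambda>A \<in> Obj C. \<lambda>e \<in> PObj (bracket C U (TUnit C)) A. e)\<rparr>"

definition subunit_embedding :: "('o, 'a, 'm) braided_cat_scheme
    \<Rightarrow> ('x, 'o, 'a) psh_cat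
    \<Rightarrow> 'a set \<Rightarrow> ('o, 'a, ('x, 'o, 'a) elt) nat_trans set" where
  "subunit_embedding C D p = subobj D (bracket_incl C {p})"

section \<open>Semilattices, distributive lattices, preframes and frames\<close>

text \<open>All finite meets and joins are meant to include the empty ones; likewise the empty subset
  is directed.\<close>

locale meet_semilattice = lower_semilattice L + weak_partial_order_top L for L :: "'l gorder" (structure)

locale distributive_lattice = bounded_lattice L for L :: "'l gorder" (structure) +
  assumes meet_join_distrib: "\<lbrakk>x \<in> carrier L; y \<in> carrier L; z \<in> carrier L\<rbrakk>
      \<Longrightarrow> x \<sqinter> (y \<squnion> z) = (x \<sqinter> y) \<squnion> (x \<sqinter> z)"

locale preframe = meet_semilattice L for L :: "'l gorder" (structure) +
  assumes directed_sup_exists: "directed L U \<Longrightarrow> \<exists>s. least L s (Upper L U)"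
    and meet_directed_sup_distrib: "\<lbrakk>x \<in> carrier L; directed L U\<rbrakk>
      \<Longrightarrow> x \<sqinter> \<Squnion>U = \<Squnion>((\<lambda>u. x \<sqinter> u) ` U)"

locale frame = complete_lattice L for L :: "'l gorder" (structure) +
  assumes meet_sup_distrib: "\<lbrakk>x \<in> carrier L; U \<subseteq> carrier L\<rbrakk>
      \<Longrightarrow> x \<sqinter> \<Squnion>U = \<Squnion>((\<lambda>u. x \<sqinter> u) ` U)"

definition semilattice_hom :: "'k gorder \<Rightarrow> 'l gorder \<Rightarrow> ('k \<Rightarrow> 'l) set" where
  "semilattice_hom K L = {h \<in> carrier K \<rightarrow> carrier L. h \<top>\<^bsub>K\<^esub> = \<top>\<^bsub>L\<^esub> \<and>
     (\<forall>x \<in> carrier K. \<forall>y \<in> carrier K. h (x \<sqinter>\<^bsub>K\<^esub> y) = h x \<sqinter>\<^bsub>L\<^esub> h y)}"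

definition lattice_hom :: "'k gorder \<Rightarrow> 'l gorder \<Rightarrow> ('k \<Rightarrow> 'l) set" where
  "lattice_hom K L = {h \<in> semilattice_hom K L. h \<bottom>\<^bsub>K\<^esub> = \<bottom>\<^bsub>L\<^esub> \<and>
     (\<forall>x \<in> carrier K. \<forall>y \<in> carrier K. h (x \<squnion>\<^bsub>K\<^esub> y) = h x \<squnion>\<^bsub>L\<^esub> h y)}"

definition preframe_hom :: "'k gorder \<Rightarrow> 'l gorder \<Rightarrow> ('k \<Rightarrow> 'l) set" where
  "preframe_hom K L = {h \<in> semilattice_hom K L. \<forall>U. directed K U \<longrightarrow> h (\<Squnion>\<^bsub>K\<^esub>U) = \<Squnion>\<^bsub>L\<^esub>(h ` U)}"

definition frame_hom :: "'k gorder \<Rightarrow> 'l gorder \<Rightarrow> ('k \<Rightarrow> 'l) set" where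
  "frame_hom K L = {h \<in> semilattice_hom K L. \<forall>U. U \<subseteq> carrier K \<longrightarrow> h (\<Squnion>\<^bsub>K\<^esub>U) = \<Squnion>\<^bsub>L\<^esub>(h ` U)}"

text \<open>\<open>free_completion T T' hom S Q \<eta>\<close> says that \<open>\<eta> : S \<rightarrow> Q\<close> is the free completion of the
  semilattice \<open>S\<close> to a structure of kind \<open>T\<close> with respect to the homomorphisms \<open>hom\<close>. As HOL
  cannot quantify over types inside a formula, the predicate \<open>T\<close> is also passed as \<open>T'\<close> at the
  type \<open>'l\<close> of the test structures, and the notion is to be stated for a type variable \<open>'l\<close>.\<close>

definition free_completion :: "('q gorder \<Rightarrow> bool) \<Rightarrow> ('l gorder \<Rightarrow> bool)
    \<Rightarrow> ('q gorder \<Rightarrow> 'l gorder \<Rightarrow> ('q \<Rightarrow> 'l) set) \<Rightarrow> 's gorder \<Rightarrow> 'q gorder \<Rightarrow> ('s \<Rightarrow> 'q) \<Rightarrow> bool" where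
  "free_completion T T' hom S Q \<eta> \<longleftrightarrow>
     meet_semilattice S \<and> T Q \<and> \<eta> \<in> semilattice_hom S Q \<and>
     (\<forall>L. T' L \<longrightarrow> (\<forall>f \<in> semilattice_hom S L.
        \<exists>!h. h \<in> hom Q L \<and> h \<in> extensional (carrier Q) \<and> (\<forall>x \<in> carrier S. h (\<eta> x) = f x)))"

end

theory Submission
  imports Defs
begin

text \<open>The free completion of a meet-semilattice \<open>S\<close> under suprema of a given kind (finite, directed,
  or arbitrary) that meets distribute over consists of the lower sets of \<open>S\<close> that are finitely
  bounded, directed, or arbitrary, respectively, ordered by inclusion:
  a lower set \<open>W\<close> is the supremum of the principal lower sets of its elements, so a
  homomorphism extending \<open>f\<close> must send \<open>W\<close> to \<open>\<Squnion> f[W]\<close>, and distributivity makes this map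
  preserve finite meets (\<open>extension_unique\<close>, \<open>extension_exists\<close>). It remains to see that the
  subunits of a category of broad presheaves are exactly these lower sets of \<open>ISub C\<close>
  (\<open>ISub_D_lower_set_order\<close>). This has two halves.

  A family \<open>U\<close> of subunits defines the sieve \<open>\<langle>U, I\<rangle>\<close> of all arrows into \<open>I\<close> that factor through a
  member of \<open>U\<close>. Multiplication \<open>(f, g) \<mapsto> \<lambda> \<circ> (f \<otimes> g)\<close> identifies the Day convolution of two such
  sieves with their intersection, because in a stiff category the tensor product of subunits is
  their intersection (\<open>day_mult_eq_iff\<close>, \<open>day_mult_image\<close>). Hence \<open>\<langle>U, I\<rangle>\<close> is idempotent and its
  inclusion into \<open>C(-, I)\<close> is a subunit (\<open>bracket_incl_subunit\<close>). The sieve depends only on the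
  lower set generated by \<open>U\<close>, and it determines that lower set.

  Conversely, let \<open>n : F \<rightarrow> C(-, I)\<close> be a subunit with \<open>F \<cong> \<langle>U, X\<rangle>\<close>. The presheaf \<open>F\<close> is generated by
  one element at \<open>S \<otimes> X\<close> for each \<open>s\<close> in \<open>U\<close>, and \<open>n\<close> sends it to an arrow \<open>m : S \<otimes> X \<rightarrow> I\<close>. The image
  of \<open>n\<close> is the sieve generated by these arrows, so it suffices that each \<open>m\<close> is a subunit of \<open>C\<close>
  (\<open>gen_value_subunit\<close>). It is monic because \<open>n\<close> is. With \<open>Y = S \<otimes> X\<close>, surjectivity of
  \<open>n \<otimes> F : F \<otimes> F \<rightarrow> C(-, I) \<otimes> F\<close> provides a section \<open>r : Y \<rightarrow> Y \<otimes> Y\<close> of \<open>m \<otimes> Y\<close>: it gives an arrow into some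
  \<open>(T \<otimes> X) \<otimes> (T' \<otimes> X)\<close>, and an arrow out of \<open>S \<otimes> X\<close> restricts to \<open>s\<close> in both factors. Injectivity
  of \<open>n \<otimes> F\<close> shows that the section is an inverse. Passing from \<open>s\<close> to \<open>m\<close> is monotone, and images
  under monotone maps and generated lower sets inherit being finitely bounded or directed.\<close>

section \<open>Characterizing bounds in partial orders\<close>

lemma partial_orderI:
  assumes "eq L = (=)"
    and "\<And>x. x \<in> carrier L \<Longrightarrow> x \<sqsubseteq>\<^bsub>L\<^esub> x"
    and "\<And>x y. \<lbrakk>x \<sqsubseteq>\<^bsub>L\<^esub> y; y \<sqsubseteq>\<^bsub>L\<^esub> x; x \<in> carrier L; y \<in> carrier L\<rbrakk> \<Longrightarrow> x = y"
    and "\<And>x y z. \<lbrakk>x \<sqsubseteq>\<^bsub>L\<^esub> y; y \<sqsubseteq>\<^bsub>L\<^esub> z; x \<in> carrier L; y \<in> carrier L; z \<in> carrier L\<rbrakk> \<Longrightarrow> x \<sqsubseteq>\<^bsub>L\<^esub> z"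
  shows "partial_order L"
  by unfold_locales (unfold assms(1), (rule assms(2) | erule (3) assms(3) | erule (4) assms(4) | simp)+)

context partial_order
begin

lemma sup_eqI: "least L s (Upper L A) \<Longrightarrow> \<Squnion>A = s"
  unfolding sup_def by (metis least_unique someI)

lemma inf_eqI: "greatest L i (Lower L A) \<Longrightarrow> \<Sqinter>A = i"
  unfolding inf_def by (metis greatest_unique someI)

lemma top_eqI: "greatest L i (carrier L) \<Longrightarrow> \<top> = i"
  unfolding top_def by (metis greatest_unique someI)

lemma bottom_eqI: "least L s (carrier L) \<Longrightarrow> \<bottom> = s"
  unfolding bottom_def by (metis least_unique someI)

end

section \<open>Categories and coherence\<close>

text \<open>Arrows are treated as untyped terms, with domain and codomain computed by the simplifier, and
  composites are normalized to right-nested form with tensor products of arrows merged.\<close>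

context category
begin

lemma hom_iff [simp]: "f \<in> Hom C X Y \<longleftrightarrow> f \<in> Arr C \<and> Dom C f = X \<and> Cod C f = Y"
  by (auto simp: Hom_def)

lemma id_typing [simp]:
  assumes "X \<in> Obj C"
  shows "Id C X \<in> Arr C" "Dom C (Id C X) = X" "Cod C (Id C X) = X"
  using id_hom[OF assms] by auto

lemma comp_typing [simp]:
  assumes "f \<in> Arr C" "g \<in> Arr C" "Cod C f = Dom C g"
  shows "g \<cdot> f \<in> Arr C" "Dom C (g \<cdot> f) = Dom C f" "Cod C (g \<cdot> f) = Cod C g"
  using comp_hom[of f "Dom C f" "Cod C f" g "Cod C g"] assms by auto

lemma id_comp [simp]: "\<lbrakk>f \<in> Arr C; Cod C f = Y\<rbrakk> \<Longrightarrow> Id C Y \<cdot> f = f"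
  using id_left[of f "Dom C f" Y] by simp

lemma comp_id [simp]: "\<lbrakk>f \<in> Arr C; Dom C f = X\<rbrakk> \<Longrightarrow> f \<cdot> Id C X = f"
  using id_right[of f X "Cod C f"] by simp

lemma assoc_comp [simp]:
  "\<lbrakk>f \<in> Arr C; g \<in> Arr C; h \<in> Arr C; Cod C f = Dom C g; Cod C g = Dom C h\<rbrakk>
    \<Longrightarrow> (h \<cdot> g) \<cdot> f = h \<cdot> g \<cdot> f"
  using comp_assoc[of f "Dom C f" "Dom C g" g "Dom C h" h "Cod C h"] by simp

lemmas objs [simp] = dom_obj cod_obj

lemma mono_cancel:
  assumes "is_mono C f" "f \<cdot> g = f \<cdot> h" "g \<in> Arr C" "h \<in> Arr C"
    "Cod C g = Dom C f" "Cod C h = Dom C f" "Dom C g = Dom C h"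
  shows "g = h"
  using assms unfolding is_mono_def by blast

lemma monoI:
  assumes "f \<in> Arr C"
    "\<And>g h. \<lbrakk>g \<in> Arr C; h \<in> Arr C; Cod C g = Dom C f; Cod C h = Dom C f; Dom C g = Dom C h;
       f \<cdot> g = f \<cdot> h\<rbrakk> \<Longrightarrow> g = h"
  shows "is_mono C f"
  using assms unfolding is_mono_def by blast

lemma mono_arr: "is_mono C f \<Longrightarrow> f \<in> Arr C"
  by (simp add: is_mono_def)

lemma isoE:
  assumes "is_iso C f"
  obtains g where "g \<in> Arr C" "Dom C g = Cod C f" "Cod C g = Dom C f"
    "g \<cdot> f = Id C (Dom C f)" "f \<cdot> g = Id C (Cod C f)"
  using assms unfolding is_iso_def by auto

lemma isoI:
  assumes "f \<in> Arr C" "g \<in> Arr C" "Dom C g = Cod C f" "Cod C g = Dom C f"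
    "g \<cdot> f = Id C (Dom C f)" "f \<cdot> g = Id C (Cod C f)"
  shows "is_iso C f"
  using assms unfolding is_iso_def by auto

lemma iso_arr: "is_iso C f \<Longrightarrow> f \<in> Arr C"
  by (simp add: is_iso_def)

lemma iso_cancel_right:
  assumes "is_iso C f" "g \<cdot> f = h \<cdot> f" "g \<in> Arr C" "h \<in> Arr C"
    "Dom C g = Cod C f" "Dom C h = Cod C f"
  shows "g = h"
proof -
  note [simp] = iso_arr[OF assms(1)] assms(3-6)
  obtain k where [simp]: "k \<in> Arr C" "Dom C k = Cod C f" "Cod C k = Dom C f"
    and k: "f \<cdot> k = Id C (Cod C f)"
    using assms(1) by (rule isoE)
  have "g = (g \<cdot> f) \<cdot> k" by (simp add: k)
  also have "\<dots> = (h \<cdot> f) \<cdot> k" by (simp only: assms(2))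
  also have "\<dots> = h" by (simp add: k)
  finally show ?thesis .
qed

lemma iso_mono:
  assumes "is_iso C f"
  shows "is_mono C f"
proof (rule monoI)
  note [simp] = iso_arr[OF assms(1)]
  show "f \<in> Arr C" by simp
  obtain k where [simp]: "k \<in> Arr C" "Dom C k = Cod C f" "Cod C k = Dom C f"
    and k: "k \<cdot> f = Id C (Dom C f)"
    using assms(1) by (rule isoE)
  fix g h
  assume [simp]: "g \<in> Arr C" "h \<in> Arr C" "Cod C g = Dom C f" "Cod C h = Dom C f" "Dom C g = Dom C h"
    and eq: "f \<cdot> g = f \<cdot> h"
  have "g = (k \<cdot> f) \<cdot> g" by (simp only: k) simp
  also have "\<dots> = k \<cdot> f \<cdot> h" by (simp add: eq)
  also have "\<dots> = (k \<cdot> f) \<cdot> h" by simp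
  also have "\<dots> = h" by (simp only: k) simp
  finally show "g = h" .
qed

lemma iso_comp:
  assumes "is_iso C f" "is_iso C g" "Cod C f = Dom C g"
  shows "is_iso C (g \<cdot> f)"
proof -
  note [simp] = iso_arr[OF assms(1)] iso_arr[OF assms(2)] assms(3)
  obtain k where [simp]: "k \<in> Arr C" "Dom C k = Cod C f" "Cod C k = Dom C f"
    and k: "k \<cdot> f = Id C (Dom C f)" "f \<cdot> k = Id C (Cod C f)"
    using assms(1) by (rule isoE)
  obtain l where [simp]: "l \<in> Arr C" "Dom C l = Cod C g" "Cod C l = Dom C g"
    and l: "l \<cdot> g = Id C (Dom C g)" "g \<cdot> l = Id C (Cod C g)"
    using assms(2) by (rule isoE)
  have "(k \<cdot> l) \<cdot> g \<cdot> f = k \<cdot> (l \<cdot> g) \<cdot> f" by simp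
  also have "\<dots> = Id C (Dom C f)" by (simp only: l) (simp add: k)
  finally have 1: "(k \<cdot> l) \<cdot> g \<cdot> f = Id C (Dom C f)" .
  have "(g \<cdot> f) \<cdot> k \<cdot> l = g \<cdot> (f \<cdot> k) \<cdot> l" by simp
  also have "\<dots> = Id C (Cod C g)" by (simp only: k) (simp add: l)
  finally have 2: "(g \<cdot> f) \<cdot> k \<cdot> l = Id C (Cod C g)" .
  show ?thesis by (rule isoI[of _ "k \<cdot> l"]) (use 1 2 in simp_all)
qed

lemma iso_inverse:
  assumes "is_iso C f"
  obtains g where "is_iso C g" "Dom C g = Cod C f" "Cod C g = Dom C f"
    "g \<cdot> f = Id C (Dom C f)" "f \<cdot> g = Id C (Cod C f)"
proof -
  obtain g where g: "g \<in> Arr C" "Dom C g = Cod C f" "Cod C g = Dom C f"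
    "g \<cdot> f = Id C (Dom C f)" "f \<cdot> g = Id C (Cod C f)"
    using assms by (rule isoE)
  moreover have "is_iso C g" by (rule isoI[of _ f]) (use g iso_arr[OF assms] in simp_all)
  ultimately show ?thesis by (rule_tac that)
qed

text \<open>Invertibility is transported along a commutative square with invertible vertical sides;
  this is how naturality of the coherence isomorphisms is used.\<close>

lemma iso_conjugate:
  assumes "is_iso C u" "is_iso C v" "v \<cdot> f = f' \<cdot> u" "f \<in> Arr C" "f' \<in> Arr C"
    "Dom C f = Dom C u" "Cod C f = Dom C v" "Dom C f' = Cod C u" "Cod C f' = Cod C v"
  shows "is_iso C f \<longleftrightarrow> is_iso C f'"
proof
  note [simp] = iso_arr[OF assms(1)] iso_arr[OF assms(2)] assms(4-)
  assume f: "is_iso C f"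
  obtain k where k: "is_iso C k" "Dom C k = Cod C u" "Cod C k = Dom C u" "u \<cdot> k = Id C (Cod C u)"
    using assms(1) by (rule iso_inverse) metis
  have "is_iso C ((v \<cdot> f) \<cdot> k)"
    by (intro iso_comp) (use f k assms(2) in simp_all)
  also have "(v \<cdot> f) \<cdot> k = f' \<cdot> u \<cdot> k" using k iso_arr[OF k(1)] by (simp only: assms(3)) simp
  also have "\<dots> = f'" using k by simp
  finally show "is_iso C f'" .
next
  note [simp] = iso_arr[OF assms(1)] iso_arr[OF assms(2)] assms(4-)
  assume f': "is_iso C f'"
  obtain l where l: "is_iso C l" "Dom C l = Cod C v" "Cod C l = Dom C v" "l \<cdot> v = Id C (Dom C v)"
    using assms(2) by (rule iso_inverse) metis
  have "is_iso C (l \<cdot> f' \<cdot> u)"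
    by (intro iso_comp) (use f' l assms(1) in simp_all)
  also have "l \<cdot> f' \<cdot> u = l \<cdot> v \<cdot> f" by (simp only: assms(3))
  also have "\<dots> = (l \<cdot> v) \<cdot> f" by (rule assoc_comp[symmetric]) (use l iso_arr[OF l(1)] in simp_all)
  also have "\<dots> = f" by (simp only: l) simp
  finally show "is_iso C f" .
qed

lemma id_iso: "X \<in> Obj C \<Longrightarrow> is_iso C (Id C X)"
  by (rule isoI[of _ "Id C X"]) simp_all

lemma mono_comp:
  assumes "is_mono C f" "is_mono C g" "Cod C f = Dom C g"
  shows "is_mono C (g \<cdot> f)"
proof (rule monoI)
  note [simp] = mono_arr[OF assms(1)] mono_arr[OF assms(2)] assms(3)
  show "g \<cdot> f \<in> Arr C" by simp
  fix h k
  assume [simp]: "h \<in> Arr C" "k \<in> Arr C" and h: "Cod C h = Dom C (g \<cdot> f)"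
    and k: "Cod C k = Dom C (g \<cdot> f)" and d: "Dom C h = Dom C k" and eq: "(g \<cdot> f) \<cdot> h = (g \<cdot> f) \<cdot> k"
  have [simp]: "Cod C h = Dom C f" "Cod C k = Dom C f" using h k by simp_all
  have "f \<cdot> h = f \<cdot> k" by (rule mono_cancel[OF assms(2)]) (use eq d in simp_all)
  then show "h = k" by (rule mono_cancel[OF assms(1)]) (use d in simp_all)
qed

end

context tensor_category
begin

lemmas tensor_objs [simp] = unit_obj tensor_obj

lemma tensor_typing [simp]:
  assumes "f \<in> Arr C" "g \<in> Arr C"
  shows "f \<boxtimes> g \<in> Arr C" "Dom C (f \<boxtimes> g) = Dom C f \<otimes> Dom C g" "Cod C (f \<boxtimes> g) = Cod C f \<otimes> Cod C g"
  using tensor_hom[of f "Dom C f" "Cod C f" g "Dom C g" "Cod C g"] assms by auto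

lemmas tensor_id' [simp] = tensor_id

lemma tensor_comp' [simp]:
  assumes "f \<in> Arr C" "g \<in> Arr C" "f' \<in> Arr C" "g' \<in> Arr C" "Cod C f = Dom C g" "Cod C f' = Dom C g'"
  shows "(g \<boxtimes> g') \<cdot> (f \<boxtimes> f') = (g \<cdot> f) \<boxtimes> (g' \<cdot> f')"
  using tensor_comp[of f "Dom C f" "Dom C g" g "Cod C g" f' "Dom C f'" "Dom C g'" g' "Cod C g'"] assms
  by simp

text \<open>The same law inside a longer right-nested composite.\<close>

lemma tensor_comp_tail [simp]:
  assumes "f \<in> Arr C" "g \<in> Arr C" "f' \<in> Arr C" "g' \<in> Arr C" "Cod C f = Dom C g" "Cod C f' = Dom C g'"
    "h \<in> Arr C" "Cod C h = Dom C f \<otimes> Dom C f'"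
  shows "(g \<boxtimes> g') \<cdot> (f \<boxtimes> f') \<cdot> h = ((g \<cdot> f) \<boxtimes> (g' \<cdot> f')) \<cdot> h"
proof -
  have "(g \<boxtimes> g') \<cdot> (f \<boxtimes> f') \<cdot> h = ((g \<boxtimes> g') \<cdot> (f \<boxtimes> f')) \<cdot> h"
    by (rule sym, rule assoc_comp) (use assms in simp_all)
  then show ?thesis using assms by simp
qed

lemma tensor_iso:
  assumes "is_iso C f" "is_iso C g"
  shows "is_iso C (f \<boxtimes> g)"
proof -
  note [simp] = iso_arr[OF assms(1)] iso_arr[OF assms(2)]
  obtain k where [simp]: "k \<in> Arr C" "Dom C k = Cod C f" "Cod C k = Dom C f"
    and k: "k \<cdot> f = Id C (Dom C f)" "f \<cdot> k = Id C (Cod C f)"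
    using assms(1) by (rule isoE)
  obtain l where [simp]: "l \<in> Arr C" "Dom C l = Cod C g" "Cod C l = Dom C g"
    and l: "l \<cdot> g = Id C (Dom C g)" "g \<cdot> l = Id C (Cod C g)"
    using assms(2) by (rule isoE)
  show ?thesis by (rule isoI[of _ "k \<boxtimes> l"]) (simp_all add: k l)
qed

end

context braided_monoidal_category
begin

lemma coherence_typing [simp]:
  "\<lbrakk>X \<in> Obj C; Y \<in> Obj C; Z \<in> Obj C\<rbrakk> \<Longrightarrow> Assoc C X Y Z \<in> Arr C"
  "\<lbrakk>X \<in> Obj C; Y \<in> Obj C; Z \<in> Obj C\<rbrakk> \<Longrightarrow> Dom C (Assoc C X Y Z) = (X \<otimes> Y) \<otimes> Z"
  "\<lbrakk>X \<in> Obj C; Y \<in> Obj C; Z \<in> Obj C\<rbrakk> \<Longrightarrow> Cod C (Assoc C X Y Z) = X \<otimes> Y \<otimes> Z"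
  "X \<in> Obj C \<Longrightarrow> Lunit C X \<in> Arr C"
  "X \<in> Obj C \<Longrightarrow> Dom C (Lunit C X) = TUnit C \<otimes> X"
  "X \<in> Obj C \<Longrightarrow> Cod C (Lunit C X) = X"
  "X \<in> Obj C \<Longrightarrow> Runit C X \<in> Arr C"
  "X \<in> Obj C \<Longrightarrow> Dom C (Runit C X) = X \<otimes> TUnit C"
  "X \<in> Obj C \<Longrightarrow> Cod C (Runit C X) = X"
  "\<lbrakk>X \<in> Obj C; Y \<in> Obj C\<rbrakk> \<Longrightarrow> Braid C X Y \<in> Arr C"
  "\<lbrakk>X \<in> Obj C; Y \<in> Obj C\<rbrakk> \<Longrightarrow> Dom C (Braid C X Y) = X \<otimes> Y"
  "\<lbrakk>X \<in> Obj C; Y \<in> Obj C\<rbrakk> \<Longrightarrow> Cod C (Braid C X Y) = Y \<otimes> X"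
  using assoc_hom lunit_hom runit_hom braid_hom by auto

lemma lunit_natural: "f \<in> Arr C \<Longrightarrow> Lunit C (Cod C f) \<cdot> (Id C (TUnit C) \<boxtimes> f) = f \<cdot> Lunit C (Dom C f)"
  using lunit_nat[of f "Dom C f" "Cod C f"] by simp

lemma runit_natural: "f \<in> Arr C \<Longrightarrow> Runit C (Cod C f) \<cdot> (f \<boxtimes> Id C (TUnit C)) = f \<cdot> Runit C (Dom C f)"
  using runit_nat[of f "Dom C f" "Cod C f"] by simp

lemma assoc_natural:
  "\<lbrakk>f \<in> Arr C; g \<in> Arr C; h \<in> Arr C\<rbrakk>
    \<Longrightarrow> Assoc C (Cod C f) (Cod C g) (Cod C h) \<cdot> ((f \<boxtimes> g) \<boxtimes> h)
      = (f \<boxtimes> g \<boxtimes> h) \<cdot> Assoc C (Dom C f) (Dom C g) (Dom C h)"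
  using assoc_nat[of f "Dom C f" "Cod C f" g "Dom C g" "Cod C g" h "Dom C h" "Cod C h"] by simp

lemma braid_natural:
  "\<lbrakk>f \<in> Arr C; g \<in> Arr C\<rbrakk>
    \<Longrightarrow> Braid C (Cod C f) (Cod C g) \<cdot> (f \<boxtimes> g) = (g \<boxtimes> f) \<cdot> Braid C (Dom C f) (Dom C g)"
  using braid_nat[of f "Dom C f" "Cod C f" g "Dom C g" "Cod C g"] by simp

text \<open>Tensoring with \<open>I\<close> is faithful, as the unitors are natural isomorphisms. Together with the
  pentagon and triangle this yields Kelly's coherence laws for the unit.\<close>

lemma unit_tensor_faithful:
  assumes "Id C (TUnit C) \<boxtimes> f = Id C (TUnit C) \<boxtimes> g" "f \<in> Arr C" "g \<in> Arr C"
    "Dom C f = Dom C g" "Cod C f = Cod C g"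
  shows "f = g"
proof (rule iso_cancel_right)
  show "is_iso C (Lunit C (Dom C f))" using assms by (simp add: lunit_iso)
  show "f \<cdot> Lunit C (Dom C f) = g \<cdot> Lunit C (Dom C f)"
    using lunit_natural[of f] lunit_natural[of g] assms by simp
qed (use assms in simp_all)

lemma tensor_unit_faithful:
  assumes "f \<boxtimes> Id C (TUnit C) = g \<boxtimes> Id C (TUnit C)" "f \<in> Arr C" "g \<in> Arr C"
    "Dom C f = Dom C g" "Cod C f = Cod C g"
  shows "f = g"
proof (rule iso_cancel_right)
  show "is_iso C (Runit C (Dom C f))" using assms by (simp add: runit_iso)
  show "f \<cdot> Runit C (Dom C f) = g \<cdot> Runit C (Dom C f)"
    using runit_natural[of f] runit_natural[of g] assms by simp
qed (use assms in simp_all)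

text \<open>Both sides become equal after tensoring with \<open>I\<close> on the left and composing with associators,
  where the pentagon and two instances of the triangle apply.\<close>

lemma lunit_tensor:
  assumes [simp]: "X \<in> Obj C" "Y \<in> Obj C"
  shows "Lunit C (X \<otimes> Y) \<cdot> Assoc C (TUnit C) X Y = Lunit C X \<boxtimes> Id C Y"
proof (rule unit_tensor_faithful)
  let ?I = "TUnit C"
  let ?k = "Assoc C ?I (?I \<otimes> X) Y \<cdot> (Assoc C ?I ?I X \<boxtimes> Id C Y)"
  have "(Id C ?I \<boxtimes> (Lunit C (X \<otimes> Y) \<cdot> Assoc C ?I X Y)) \<cdot> ?k
      = (Id C ?I \<boxtimes> Lunit C (X \<otimes> Y)) \<cdot> (Id C ?I \<boxtimes> Assoc C ?I X Y) \<cdot> ?k"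
    by simp
  also have "\<dots> = (Id C ?I \<boxtimes> Lunit C (X \<otimes> Y)) \<cdot> Assoc C ?I ?I (X \<otimes> Y) \<cdot> Assoc C (?I \<otimes> ?I) X Y"
    by (simp only: pentagon[OF unit_obj unit_obj assms])
  also have "\<dots> = ((Id C ?I \<boxtimes> Lunit C (X \<otimes> Y)) \<cdot> Assoc C ?I ?I (X \<otimes> Y)) \<cdot> Assoc C (?I \<otimes> ?I) X Y"
    by simp
  also have "\<dots> = (Runit C ?I \<boxtimes> Id C (X \<otimes> Y)) \<cdot> Assoc C (?I \<otimes> ?I) X Y"
    by (simp only: triangle[OF unit_obj tensor_obj[OF assms]])
  also have "\<dots> = Assoc C ?I X Y \<cdot> ((Runit C ?I \<boxtimes> Id C X) \<boxtimes> Id C Y)"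
    using assoc_natural[of "Runit C ?I" "Id C X" "Id C Y"] by simp
  also have "\<dots> = Assoc C ?I X Y \<cdot> (((Id C ?I \<boxtimes> Lunit C X) \<cdot> Assoc C ?I ?I X) \<boxtimes> Id C Y)"
    by (simp only: triangle[OF unit_obj assms(1)])
  also have "\<dots> = Assoc C ?I X Y \<cdot> ((Id C ?I \<boxtimes> Lunit C X) \<boxtimes> Id C Y) \<cdot> (Assoc C ?I ?I X \<boxtimes> Id C Y)"
    by simp
  also have "\<dots> = (Assoc C ?I X Y \<cdot> ((Id C ?I \<boxtimes> Lunit C X) \<boxtimes> Id C Y)) \<cdot> (Assoc C ?I ?I X \<boxtimes> Id C Y)"
    by (rule assoc_comp[symmetric]) simp_all
  also have "\<dots> = (Id C ?I \<boxtimes> Lunit C X \<boxtimes> Id C Y) \<cdot> ?k"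
    using assoc_natural[of "Id C ?I" "Lunit C X" "Id C Y"] by simp
  finally have eq: "(Id C ?I \<boxtimes> (Lunit C (X \<otimes> Y) \<cdot> Assoc C ?I X Y)) \<cdot> ?k
      = (Id C ?I \<boxtimes> Lunit C X \<boxtimes> Id C Y) \<cdot> ?k" .
  have "is_iso C ?k" by (rule iso_comp) (simp_all add: assoc_iso tensor_iso id_iso)
  from this eq show "Id C ?I \<boxtimes> (Lunit C (X \<otimes> Y) \<cdot> Assoc C ?I X Y) = Id C ?I \<boxtimes> Lunit C X \<boxtimes> Id C Y"
    by (rule iso_cancel_right) simp_all
qed simp_all

text \<open>At \<open>X = Y = I\<close> the previous law and the triangle express \<open>\<lambda> \<otimes> I\<close> and \<open>\<rho> \<otimes> I\<close> by the same
  composite, since naturality gives \<open>I \<otimes> \<lambda>\<^sub>I = \<lambda>\<close> at \<open>I \<otimes> I\<close>.\<close>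

lemma lunit_unit_eq_runit: "Lunit C (TUnit C) = Runit C (TUnit C)"
proof (rule tensor_unit_faithful)
  let ?I = "TUnit C"
  have "Lunit C ?I \<cdot> (Id C ?I \<boxtimes> Lunit C ?I) = Lunit C ?I \<cdot> Lunit C (?I \<otimes> ?I)"
    using lunit_natural[of "Lunit C ?I"] by simp
  then have "Id C ?I \<boxtimes> Lunit C ?I = Lunit C (?I \<otimes> ?I)"
    by (rule mono_cancel[OF iso_mono[OF lunit_iso[OF unit_obj]]]) simp_all
  then show "Lunit C ?I \<boxtimes> Id C ?I = Runit C ?I \<boxtimes> Id C ?I"
    using lunit_tensor[of ?I ?I] triangle[of ?I ?I] by simp
qed simp_all

end

section \<open>Subunits and their intersections\<close>

context category
begin

text \<open>For an arbitrary arrow \<open>f\<close>, the relation \<open>sub_le C f s\<close> says that \<open>f\<close> factors through \<open>s\<close>. It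
  is used in this generality below, so that order on subobjects and restriction of arrows are
  instances of one transitive relation.\<close>

lemma sub_leI: "\<lbrakk>f = s \<cdot> g; g \<in> Arr C; s \<in> Arr C; Cod C g = Dom C s\<rbrakk> \<Longrightarrow> sub_le C f s"
  by (auto simp: sub_le_def)

lemma sub_leE:
  assumes "sub_le C f s" "s \<in> Arr C"
  obtains g where "g \<in> Arr C" "Dom C g = Dom C f" "Cod C g = Dom C s" "s \<cdot> g = f"
proof -
  obtain g where "g \<in> Hom C (Dom C f) (Dom C s)" "f = s \<cdot> g"
    using assms(1) unfolding sub_le_def by blast
  then show ?thesis using that[of g] unfolding hom_iff by blast
qed

lemma sub_le_refl: "f \<in> Arr C \<Longrightarrow> sub_le C f f"
  by (rule sub_leI[of _ _ "Id C (Dom C f)"]) simp_all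

lemma sub_le_trans:
  assumes "sub_le C f s" "sub_le C s t" "t \<in> Arr C"
  shows "sub_le C f t"
proof -
  obtain h where h: "h \<in> Arr C" "Dom C h = Dom C s" "Cod C h = Dom C t" "t \<cdot> h = s"
    using assms(2,3) by (rule sub_leE)
  have "t \<cdot> h \<in> Arr C" by (rule comp_typing) (use h(1-3) assms(3) in simp_all)
  then have "s \<in> Arr C" unfolding h(4) .
  then obtain g where g: "g \<in> Arr C" "Dom C g = Dom C f" "Cod C g = Dom C s" "s \<cdot> g = f"
    using sub_leE[OF assms(1)] by blast
  have "f = (t \<cdot> h) \<cdot> g" unfolding h(4) by (rule g(4)[symmetric])
  also have "\<dots> = t \<cdot> h \<cdot> g" by (rule assoc_comp) (use assms(3) h(1-3) g(1-3) in simp_all)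
  finally show ?thesis by (rule sub_leI) (use assms(3) h(1-3) g(1-3) in simp_all)
qed

lemma sub_le_precomp:
  assumes "h \<in> Arr C" "s \<in> Arr C" "Cod C h = Dom C s"
  shows "sub_le C (s \<cdot> h) s"
  by (rule sub_leI[OF refl]) (use assms in simp_all)

end

context tensor_category
begin

lemma subunitD:
  assumes "subunit C s"
  shows "is_mono C s" "s \<in> Arr C" "Cod C s = TUnit C" "is_iso C (s \<boxtimes> Id C (Dom C s))"
  using assms by (auto simp: subunit_def is_mono_def)

text \<open>If \<open>s = t \<cdot> k\<close> and \<open>t = s \<cdot> l\<close> then \<open>k\<close> and \<open>l\<close> are mutually inverse, and \<open>s \<otimes> S\<close> is a composite of
  \<open>t \<otimes> T\<close> with isomorphisms. So every member of a class in \<open>ISub C\<close> is a subunit, and any of them can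
  serve as its representative.\<close>

lemma subunit_equivalent:
  assumes t: "subunit C t" and s: "is_mono C s" and le: "sub_le C s t" "sub_le C t s"
  shows "subunit C s"
proof -
  note [simp] = subunitD(2,3)[OF t] mono_arr[OF s]
  obtain k where [simp]: "k \<in> Arr C" "Dom C k = Dom C s" "Cod C k = Dom C t" and k: "t \<cdot> k = s"
    using le(1) by (rule sub_leE) simp_all
  obtain l where [simp]: "l \<in> Arr C" "Dom C l = Dom C t" "Cod C l = Dom C s" and l: "s \<cdot> l = t"
    using le(2) by (rule sub_leE) simp_all
  have cod: "Cod C s = TUnit C" using le(1) by (simp add: sub_le_def)
  have "t \<cdot> k \<cdot> l = (t \<cdot> k) \<cdot> l" by (rule assoc_comp[symmetric]) simp_all
  also have "\<dots> = t \<cdot> Id C (Dom C t)" by (simp only: k l) simp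
  finally have kl: "k \<cdot> l = Id C (Dom C t)"
    by (rule mono_cancel[OF subunitD(1)[OF t]]) simp_all
  have "s \<cdot> l \<cdot> k = (s \<cdot> l) \<cdot> k" by (rule assoc_comp[symmetric]) simp_all
  also have "\<dots> = s \<cdot> Id C (Dom C s)" by (simp only: k l) simp
  finally have lk: "l \<cdot> k = Id C (Dom C s)"
    by (rule mono_cancel[OF s]) simp_all
  have k': "is_iso C k" by (rule isoI[of _ l]) (simp_all add: kl lk)
  have l': "is_iso C l" by (rule isoI[of _ k]) (simp_all add: kl lk)
  have "is_iso C ((Id C (TUnit C) \<boxtimes> l) \<cdot> (t \<boxtimes> Id C (Dom C t)) \<cdot> (k \<boxtimes> k))"
    by (rule iso_comp[OF iso_comp[OF tensor_iso[OF k' k'] subunitD(4)[OF t]] tensor_iso[OF id_iso l']])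
      simp_all
  also have "(Id C (TUnit C) \<boxtimes> l) \<cdot> (t \<boxtimes> Id C (Dom C t)) \<cdot> (k \<boxtimes> k) = (t \<cdot> k) \<boxtimes> (l \<cdot> k)"
    by simp
  also have "\<dots> = s \<boxtimes> Id C (Dom C s)" by (simp add: lk k)
  finally show ?thesis using s cod by (simp add: subunit_def)
qed

lemma subobj_subunit:
  assumes "subunit C s"
  shows "subobj C s \<in> carrier (ISub C)" "s \<in> subobj C s"
  using assms subunitD[OF assms] sub_le_refl by (auto simp: ISub_def subobj_def)

lemma ISub_member:
  assumes "p \<in> carrier (ISub C)" "s \<in> p"
  shows "subunit C s" "p = subobj C s"
proof -
  obtain t where t: "subunit C t" and p: "p = subobj C t"
    using assms by (auto simp: ISub_def)
  have s: "is_mono C s" "sub_le C s t" "sub_le C t s" using assms(2) p by (auto simp: subobj_def)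
  show u: "subunit C s" using t s by (rule subunit_equivalent)
  have 1: "sub_le C r t \<longleftrightarrow> sub_le C r s" for r
    by (rule iffI, erule sub_le_trans[OF _ s(3) subunitD(2)[OF u]],
        erule sub_le_trans[OF _ s(2) subunitD(2)[OF t]])
  have 2: "sub_le C t r \<longleftrightarrow> sub_le C s r" if "is_mono C r" for r
    by (rule iffI, erule sub_le_trans[OF s(2) _ mono_arr[OF that]],
        erule sub_le_trans[OF s(3) _ mono_arr[OF that]])
  show "p = subobj C s"
    unfolding p subobj_def by (rule Collect_cong) (simp only: 1 2 cong: conj_cong)
qed

lemma ISub_nonempty: "p \<in> carrier (ISub C) \<Longrightarrow> \<exists>s. s \<in> p"
  using subobj_subunit(2) unfolding ISub_def by auto

lemma ISub_member_typing:
  assumes "p \<in> carrier (ISub C)" "s \<in> p"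
  shows "s \<in> Arr C" "Cod C s = TUnit C"
  using subunitD(2,3)[OF ISub_member(1)[OF assms]] .

lemma ISub_equivalent:
  assumes "p \<in> carrier (ISub C)" "s \<in> p" "t \<in> p"
  shows "sub_le C s t"
  using ISub_member[OF assms(1,2)] assms(3) by (auto simp: subobj_def)

lemma ISub_le_iff:
  assumes "p \<in> carrier (ISub C)" "q \<in> carrier (ISub C)" "s \<in> p" "t \<in> q"
  shows "p \<sqsubseteq>\<^bsub>ISub C\<^esub> q \<longleftrightarrow> sub_le C s t"
proof
  assume "p \<sqsubseteq>\<^bsub>ISub C\<^esub> q"
  then obtain s' t' where *: "s' \<in> p" "t' \<in> q" "sub_le C s' t'" by (auto simp: ISub_def)
  have "sub_le C s s'" "sub_le C t' t" using assms * ISub_equivalent by metis+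
  then have "sub_le C s t'"
    using sub_le_trans * ISub_member_typing(1)[OF assms(1) *(1)] ISub_member_typing(1)[OF assms(2) *(2)]
    by blast
  with \<open>sub_le C t' t\<close> show "sub_le C s t"
    using sub_le_trans ISub_member_typing(1)[OF assms(2,4)] by blast
next
  assume "sub_le C s t"
  then show "p \<sqsubseteq>\<^bsub>ISub C\<^esub> q" using assms by (auto simp: ISub_def)
qed

lemma ISub_partial_order: "partial_order (ISub C)"
proof (rule partial_orderI)
  show "eq (ISub C) = (=)" by (simp add: ISub_def)
  show "p \<sqsubseteq>\<^bsub>ISub C\<^esub> p" if "p \<in> carrier (ISub C)" for p
    using that ISub_nonempty[OF that] ISub_le_iff ISub_equivalent by metis
  show "p = q"
    if "p \<sqsubseteq>\<^bsub>ISub C\<^esub> q" "q \<sqsubseteq>\<^bsub>ISub C\<^esub> p" and p: "p \<in> carrier (ISub C)" and q: "q \<in> carrier (ISub C)" for p q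
  proof -
    obtain s t where st: "s \<in> p" "t \<in> q" using p q ISub_nonempty by metis
    have "sub_le C s t" "sub_le C t s" using that ISub_le_iff st by metis+
    then have "s \<in> subobj C t" by (simp add: subobj_def subunitD(1)[OF ISub_member(1)[OF p st(1)]])
    then have "s \<in> q" using ISub_member(2)[OF q st(2)] by simp
    then show ?thesis using p q st ISub_member(2) by metis
  qed
  show "p \<sqsubseteq>\<^bsub>ISub C\<^esub> r"
    if "p \<sqsubseteq>\<^bsub>ISub C\<^esub> q" "q \<sqsubseteq>\<^bsub>ISub C\<^esub> r" and p: "p \<in> carrier (ISub C)" and q: "q \<in> carrier (ISub C)"
      and r: "r \<in> carrier (ISub C)" for p q r
  proof -
    obtain s t u where "s \<in> p" "t \<in> q" "u \<in> r" using p q r ISub_nonempty by metis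
    then show ?thesis
      using that(1,2) ISub_le_iff[OF p q] ISub_le_iff[OF q r] ISub_le_iff[OF p r]
        sub_le_trans[of s t u] ISub_member_typing(1)[OF r] by blast
  qed
qed

lemma top_subunit: "subunit C (Id C (TUnit C))"
  by (simp add: subunit_def id_iso iso_mono)

lemma ISub_top:
  "greatest (ISub C) (subobj C (Id C (TUnit C))) (carrier (ISub C))"
proof -
  interpret P: partial_order "ISub C" by (rule ISub_partial_order)
  have "p \<sqsubseteq>\<^bsub>ISub C\<^esub> subobj C (Id C (TUnit C))" if p: "p \<in> carrier (ISub C)" for p
  proof -
    obtain s where s: "s \<in> p" using p ISub_nonempty by metis
    note su = subunitD[OF ISub_member(1)[OF p s]]
    have "sub_le C s (Id C (TUnit C))"
      by (rule sub_leI[of _ _ s]) (use su in simp_all)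
    then show ?thesis
      using ISub_le_iff[OF p subobj_subunit(1)[OF top_subunit] s subobj_subunit(2)[OF top_subunit]] by simp
  qed
  then show ?thesis using subobj_subunit(1)[OF top_subunit] by (simp add: greatest_def)
qed

end

context braided_monoidal_category
begin

lemma act_typing [simp]:
  assumes "s \<in> Arr C" "Cod C s = TUnit C" "X \<in> Obj C"
  shows "act C s X \<in> Arr C" "Dom C (act C s X) = Dom C s \<otimes> X" "Cod C (act C s X) = X"
  using assms by (simp_all add: act_def)

lemma act_unit:
  assumes "s \<in> Arr C" "Cod C s = TUnit C"
  shows "act C s (TUnit C) = s \<cdot> Runit C (Dom C s)"
  using runit_natural[of s] assms by (simp add: act_def lunit_unit_eq_runit)

lemma act_natural:
  assumes "s \<in> Arr C" "Cod C s = TUnit C" "f \<in> Arr C"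
  shows "act C s (Cod C f) \<cdot> (Id C (Dom C s) \<boxtimes> f) = f \<cdot> act C s (Dom C f)"
proof -
  have "act C s (Cod C f) \<cdot> (Id C (Dom C s) \<boxtimes> f) = Lunit C (Cod C f) \<cdot> (s \<boxtimes> f)"
    using assms by (simp add: act_def)
  also have "\<dots> = (Lunit C (Cod C f) \<cdot> (Id C (TUnit C) \<boxtimes> f)) \<cdot> (s \<boxtimes> Id C (Dom C f))"
    using assms by simp
  also have "\<dots> = f \<cdot> act C s (Dom C f)" using assms by (simp add: lunit_natural act_def)
  finally show ?thesis .
qed

lemma restricts_iff_sub_le:
  assumes "p \<in> carrier (ISub C)" "f \<in> Arr C"
  shows "restricts C f p \<longleftrightarrow> (\<exists>s \<in> p. sub_le C f (act C s (Cod C f)))"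
proof -
  have "(\<exists>g \<in> Hom C (Dom C f) (Dom C s \<otimes> Cod C f). f = act C s (Cod C f) \<cdot> g)
      \<longleftrightarrow> sub_le C f (act C s (Cod C f))" if "s \<in> p" for s
    using subunitD(2,3)[OF ISub_member(1)[OF assms(1) that]] assms(2) by (simp add: sub_le_def)
  then show ?thesis unfolding restricts_def by blast
qed

text \<open>Restriction of an arrow into the tensor unit needs no tensor product: the right unitor
  identifies \<open>s \<otimes> I\<close> with \<open>s\<close>. Here it matters that both unitors of \<open>I\<close> agree.\<close>

lemma sub_le_act_unit_iff:
  assumes [simp]: "s \<in> Arr C" "Cod C s = TUnit C" "f \<in> Arr C"
  shows "sub_le C f (act C s (TUnit C)) \<longleftrightarrow> sub_le C f s"
proof
  assume "sub_le C f (act C s (TUnit C))"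
  moreover have "sub_le C (act C s (TUnit C)) s"
    by (subst act_unit) (simp_all add: sub_le_precomp)
  ultimately show "sub_le C f s" by (rule sub_le_trans) simp
next
  assume "sub_le C f s"
  then obtain g where [simp]: "g \<in> Arr C" "Dom C g = Dom C f" "Cod C g = Dom C s" and g: "s \<cdot> g = f"
    by (rule sub_leE) simp
  obtain k where [simp]: "k \<in> Arr C" "Dom C k = Dom C s" "Cod C k = Dom C s \<otimes> TUnit C"
    and k: "Runit C (Dom C s) \<cdot> k = Id C (Dom C s)"
    using isoE[OF runit_iso[of "Dom C s"]] by auto
  have "f = s \<cdot> (Runit C (Dom C s) \<cdot> k) \<cdot> g" by (simp only: k) (simp add: g)
  also have "\<dots> = act C s (TUnit C) \<cdot> k \<cdot> g" by (simp add: act_unit)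
  finally show "sub_le C f (act C s (TUnit C))" by (rule sub_leI) simp_all
qed

lemma restricts_unit_iff:
  assumes p: "p \<in> carrier (ISub C)" "s \<in> p" and f: "f \<in> Arr C" "Cod C f = TUnit C"
  shows "restricts C f p \<longleftrightarrow> sub_le C f s"
proof -
  have "restricts C f p \<longleftrightarrow> (\<exists>t \<in> p. sub_le C f t)"
    using restricts_iff_sub_le[OF p(1) f(1)] sub_le_act_unit_iff ISub_member_typing[OF p(1)] f by simp
  also have "\<dots> \<longleftrightarrow> sub_le C f s"
    using ISub_equivalent[OF p(1)] sub_le_trans[of f _ s] ISub_member_typing(1)[OF p] p(2) by blast
  finally show ?thesis .
qed

lemma iso_tensor_conjugate:
  assumes "is_iso C u" "is_iso C v" "v \<cdot> f = f' \<cdot> u" "f \<in> Arr C" "f' \<in> Arr C" "s \<in> Arr C"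
    "Dom C f = Dom C u" "Cod C f = Dom C v" "Dom C f' = Cod C u" "Cod C f' = Cod C v"
  shows "is_iso C (s \<boxtimes> f) \<longleftrightarrow> is_iso C (s \<boxtimes> f')"
proof -
  note [simp] = iso_arr[OF assms(1)] iso_arr[OF assms(2)] assms(3-)
  show ?thesis
    by (rule iso_conjugate[of "Id C (Dom C s) \<boxtimes> u" "Id C (Cod C s) \<boxtimes> v"])
      (simp_all add: assms(1,2) tensor_iso id_iso)
qed

text \<open>Up to the interchange of the two middle factors, \<open>(s \<otimes> t) \<otimes> (A \<otimes> B)\<close> is
  \<open>(s \<otimes> A) \<otimes> (t \<otimes> B)\<close>, so that idempotence of \<open>s\<close> and \<open>t\<close> passes to \<open>s \<otimes> t\<close>.\<close>

lemma iso_interchange: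
  assumes "is_iso C (s \<boxtimes> Id C A)" "is_iso C (t \<boxtimes> Id C B)"
    and [simp]: "s \<in> Arr C" "t \<in> Arr C" "A \<in> Obj C" "B \<in> Obj C"
  shows "is_iso C ((s \<boxtimes> t) \<boxtimes> Id C (A \<otimes> B))"
proof -
  let ?S = "Dom C s" and ?S' = "Cod C s" and ?T = "Dom C t" and ?T' = "Cod C t"
  have "is_iso C ((s \<boxtimes> Id C A) \<boxtimes> (t \<boxtimes> Id C B))"
    using assms(1,2) by (rule tensor_iso)
  also have "?this \<longleftrightarrow> is_iso C (s \<boxtimes> (Id C A \<boxtimes> (t \<boxtimes> Id C B)))"
    using assoc_natural[of s "Id C A" "t \<boxtimes> Id C B"]
    by (rule_tac iso_conjugate[of "Assoc C ?S A (?T \<otimes> B)" "Assoc C ?S' A (?T' \<otimes> B)"])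
      (simp_all add: assoc_iso)
  also have "\<dots> \<longleftrightarrow> is_iso C (s \<boxtimes> ((Id C A \<boxtimes> t) \<boxtimes> Id C B))"
    using assoc_natural[of "Id C A" t "Id C B"]
    by (rule_tac iso_tensor_conjugate[symmetric, of "Assoc C A ?T B" "Assoc C A ?T' B"])
      (simp_all add: assoc_iso)
  also have "\<dots> \<longleftrightarrow> is_iso C (s \<boxtimes> ((t \<boxtimes> Id C A) \<boxtimes> Id C B))"
    using braid_natural[of "t" "Id C A"]
    by (rule_tac iso_tensor_conjugate[symmetric, of "Braid C ?T A \<boxtimes> Id C B" "Braid C ?T' A \<boxtimes> Id C B"])
      (simp_all add: braid_iso tensor_iso id_iso)
  also have "\<dots> \<longleftrightarrow> is_iso C (s \<boxtimes> (t \<boxtimes> (Id C A \<boxtimes> Id C B)))"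
    using assoc_natural[of t "Id C A" "Id C B"]
    by (rule_tac iso_tensor_conjugate[of "Assoc C ?T A B" "Assoc C ?T' A B"])
      (simp_all add: assoc_iso del: tensor_id')
  also have "\<dots> \<longleftrightarrow> is_iso C ((s \<boxtimes> t) \<boxtimes> (Id C A \<boxtimes> Id C B))"
    using assoc_natural[of s t "Id C A \<boxtimes> Id C B"]
    by (rule_tac iso_conjugate[symmetric, of "Assoc C ?S ?T (A \<otimes> B)" "Assoc C ?S' ?T' (A \<otimes> B)"])
      (simp_all add: assoc_iso)
  finally show ?thesis by simp
qed

end

context stiff_category
begin

lemma act_mono: "\<lbrakk>X \<in> Obj C; subunit C s\<rbrakk> \<Longrightarrow> is_mono C (act C s X)"
  using stiff_mono by blast

text \<open>The second expression of \<open>s \<otimes> t\<close> exhibits it as a composite of monomorphisms.\<close>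

lemma tensor_subunit:
  assumes s: "subunit C s" and t: "subunit C t"
  shows "subunit C (Lunit C (TUnit C) \<cdot> (s \<boxtimes> t))"
    and "Lunit C (TUnit C) \<cdot> (s \<boxtimes> t) = t \<cdot> act C s (Dom C t)"
proof -
  note [simp] = subunitD(2,3)[OF s] subunitD(2,3)[OF t]
  have "Lunit C (TUnit C) \<cdot> (s \<boxtimes> t)
      = (Lunit C (Cod C t) \<cdot> (Id C (TUnit C) \<boxtimes> t)) \<cdot> (s \<boxtimes> Id C (Dom C t))" by simp
  also have "\<dots> = t \<cdot> act C s (Dom C t)" by (simp only: lunit_natural subunitD(2)[OF t]) (simp add: act_def)
  finally show eq: "Lunit C (TUnit C) \<cdot> (s \<boxtimes> t) = t \<cdot> act C s (Dom C t)" .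
  have "is_mono C (t \<cdot> act C s (Dom C t))"
    by (rule mono_comp) (simp_all add: act_mono s subunitD(1)[OF t])
  then have mono: "is_mono C (Lunit C (TUnit C) \<cdot> (s \<boxtimes> t))" by (simp only: eq)
  have "is_iso C ((Lunit C (TUnit C) \<boxtimes> Id C (Dom C s \<otimes> Dom C t)) \<cdot> ((s \<boxtimes> t) \<boxtimes> Id C (Dom C s \<otimes> Dom C t)))"
  proof (rule iso_comp)
    show "is_iso C ((s \<boxtimes> t) \<boxtimes> Id C (Dom C s \<otimes> Dom C t))"
      by (rule iso_interchange) (simp_all add: subunitD(4)[OF s] subunitD(4)[OF t])
    show "is_iso C (Lunit C (TUnit C) \<boxtimes> Id C (Dom C s \<otimes> Dom C t))"
      by (intro tensor_iso lunit_iso id_iso) simp_all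
  qed simp
  with mono show "subunit C (Lunit C (TUnit C) \<cdot> (s \<boxtimes> t))" by (simp add: subunit_def)
qed

text \<open>At \<open>X = I\<close> the pullback square of stiffness exhibits \<open>s \<otimes> t\<close> as the intersection of
  \<open>s\<close> and \<open>t\<close>.\<close>

lemma sub_le_tensor_iff:
  assumes s: "subunit C s" and t: "subunit C t" and [simp]: "f \<in> Arr C"
  shows "sub_le C f (Lunit C (TUnit C) \<cdot> (s \<boxtimes> t)) \<longleftrightarrow> sub_le C f s \<and> sub_le C f t"
proof
  note [simp] = subunitD(2,3)[OF s] subunitD(2,3)[OF t]
  let ?I = "TUnit C"
  let ?m = "Lunit C ?I \<cdot> (s \<boxtimes> t)"
  assume f: "sub_le C f ?m"
  have "?m = (Runit C ?I \<cdot> (s \<boxtimes> Id C ?I)) \<cdot> (Id C (Dom C s) \<boxtimes> t)"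
    by (simp add: lunit_unit_eq_runit)
  also have "\<dots> = s \<cdot> Runit C (Dom C s) \<cdot> (Id C (Dom C s) \<boxtimes> t)"
    using runit_natural[of s] by simp
  finally have "sub_le C ?m s" by (rule sub_leI) simp_all
  moreover have "sub_le C ?m t"
    unfolding tensor_subunit(2)[OF s t] by (rule sub_le_precomp) simp_all
  ultimately show "sub_le C f s \<and> sub_le C f t"
    using sub_le_trans[OF f] by simp
next
  note [simp] = subunitD(2,3)[OF s] subunitD(2,3)[OF t]
  let ?I = "TUnit C" and ?S = "Dom C s" and ?T = "Dom C t"
  assume f: "sub_le C f s \<and> sub_le C f t"
  then have "sub_le C f (act C s ?I)" "sub_le C f (act C t ?I)"
    by (simp_all add: sub_le_act_unit_iff)
  then obtain u v where [simp]: "u \<in> Arr C" "Dom C u = Dom C f" "Cod C u = ?T \<otimes> ?I"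
      "v \<in> Arr C" "Dom C v = Dom C f" "Cod C v = ?S \<otimes> ?I"
    and u: "act C t ?I \<cdot> u = f" and v: "act C s ?I \<cdot> v = f"
    by (elim sub_leE) simp_all
  have "\<exists>!w. w \<in> Hom C (Dom C f) (Dom C (act C s (?T \<otimes> ?I)))
      \<and> act C s (?T \<otimes> ?I) \<cdot> w = u \<and> (Id C ?S \<boxtimes> act C t ?I) \<cdot> w = v"
    using stiff_pullback[OF unit_obj s t] u v unfolding is_pullback_def by simp
  then obtain w where [simp]: "w \<in> Arr C" "Dom C w = Dom C f" "Cod C w = ?S \<otimes> ?T \<otimes> ?I"
    and w: "act C s (?T \<otimes> ?I) \<cdot> w = u" by auto
  have "f = t \<cdot> Runit C ?T \<cdot> act C s (?T \<otimes> ?I) \<cdot> w"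
    by (simp only: w) (use u act_unit[of t] in simp)
  also have "\<dots> = t \<cdot> (Runit C ?T \<cdot> act C s (?T \<otimes> ?I)) \<cdot> w" by simp
  also have "Runit C ?T \<cdot> act C s (?T \<otimes> ?I) = act C s ?T \<cdot> (Id C ?S \<boxtimes> Runit C ?T)"
    using act_natural[of s "Runit C ?T"] by simp
  also have "t \<cdot> (act C s ?T \<cdot> (Id C ?S \<boxtimes> Runit C ?T)) \<cdot> w
      = (t \<cdot> act C s ?T) \<cdot> (Id C ?S \<boxtimes> Runit C ?T) \<cdot> w" by simp
  finally show "sub_le C f (Lunit C ?I \<cdot> (s \<boxtimes> t))"
    unfolding tensor_subunit(2)[OF s t] by (rule sub_leI) simp_all
qed

lemma ISub_meet:
  assumes "p \<in> carrier (ISub C)" "q \<in> carrier (ISub C)" "s \<in> p" "t \<in> q"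
  shows "greatest (ISub C) (subobj C (Lunit C (TUnit C) \<cdot> (s \<boxtimes> t))) (Lower (ISub C) {p, q})"
proof -
  interpret P: partial_order "ISub C" by (rule ISub_partial_order)
  let ?m = "Lunit C (TUnit C) \<cdot> (s \<boxtimes> t)"
  have s: "subunit C s" and t: "subunit C t" using assms ISub_member by metis+
  have m: "subobj C ?m \<in> carrier (ISub C)" "?m \<in> subobj C ?m"
    using subobj_subunit tensor_subunit(1)[OF s t] by metis+
  have le: "r \<sqsubseteq>\<^bsub>ISub C\<^esub> subobj C ?m \<longleftrightarrow> r \<sqsubseteq>\<^bsub>ISub C\<^esub> p \<and> r \<sqsubseteq>\<^bsub>ISub C\<^esub> q" if r: "r \<in> carrier (ISub C)" for r
  proof -
    obtain u where u: "u \<in> r" using r ISub_nonempty by metis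
    then show ?thesis
      using ISub_le_iff[OF r _ u] m assms
        sub_le_tensor_iff[OF s t subunitD(2)[OF ISub_member(1)[OF r u]]] by simp
  qed
  show ?thesis
    using le[OF m(1)] le m(1) P.le_refl[OF m(1)] assms(1,2) by (auto simp: greatest_def Lower_def)
qed

lemma ISub_meet_semilattice: "meet_semilattice (ISub C)"
proof -
  interpret P: partial_order "ISub C" by (rule ISub_partial_order)
  show ?thesis
  proof unfold_locales
    fix p q assume "p \<in> carrier (ISub C)" "q \<in> carrier (ISub C)"
    then show "\<exists>s. greatest (ISub C) s (Lower (ISub C) {p, q})"
      using ISub_meet ISub_nonempty by metis
  next
    show "\<exists>x. greatest (ISub C) x (carrier (ISub C))" using ISub_top by blast
  qed
qed

end

section \<open>Restriction along tensor products\<close>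

context braided_monoidal_category
begin

text \<open>The first hexagon at \<open>(A, I, I)\<close>, followed by the left unitor of \<open>I \<otimes> A\<close>, becomes this
  identity tensored with \<open>I\<close>.\<close>

lemma lunit_braid:
  assumes [simp]: "A \<in> Obj C"
  shows "Lunit C A \<cdot> Braid C A (TUnit C) = Runit C A"
proof (rule tensor_unit_faithful)
  let ?I = "TUnit C" and ?c = "Braid C A (TUnit C)"
  have "?c \<cdot> (Runit C A \<boxtimes> Id C ?I) = ?c \<cdot> (Id C A \<boxtimes> Lunit C ?I) \<cdot> Assoc C A ?I ?I"
    by (simp only: triangle[OF assms unit_obj])
  also have "\<dots> = (?c \<cdot> (Id C A \<boxtimes> Lunit C ?I)) \<cdot> Assoc C A ?I ?I"
    by (rule assoc_comp[symmetric]) simp_all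
  also have "?c \<cdot> (Id C A \<boxtimes> Lunit C ?I) = (Lunit C ?I \<boxtimes> Id C A) \<cdot> Braid C A (?I \<otimes> ?I)"
    using braid_natural[of "Id C A" "Lunit C ?I"] by simp
  also have "Lunit C ?I \<boxtimes> Id C A = Lunit C (?I \<otimes> A) \<cdot> Assoc C ?I ?I A"
    by (rule lunit_tensor[symmetric]) simp_all
  also have "((Lunit C (?I \<otimes> A) \<cdot> Assoc C ?I ?I A) \<cdot> Braid C A (?I \<otimes> ?I)) \<cdot> Assoc C A ?I ?I
      = Lunit C (?I \<otimes> A) \<cdot> Assoc C ?I ?I A \<cdot> Braid C A (?I \<otimes> ?I) \<cdot> Assoc C A ?I ?I"
    by simp
  also have "\<dots> = Lunit C (?I \<otimes> A) \<cdot> (Id C ?I \<boxtimes> ?c) \<cdot> Assoc C ?I A ?I \<cdot> (?c \<boxtimes> Id C ?I)"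
    by (simp only: hexagon1[OF assms unit_obj unit_obj])
  also have "\<dots> = (Lunit C (?I \<otimes> A) \<cdot> (Id C ?I \<boxtimes> ?c)) \<cdot> Assoc C ?I A ?I \<cdot> (?c \<boxtimes> Id C ?I)"
    by (rule assoc_comp[symmetric]) simp_all
  also have "Lunit C (?I \<otimes> A) \<cdot> (Id C ?I \<boxtimes> ?c) = ?c \<cdot> Lunit C (A \<otimes> ?I)"
    using lunit_natural[of ?c] by simp
  also have "(?c \<cdot> Lunit C (A \<otimes> ?I)) \<cdot> Assoc C ?I A ?I \<cdot> (?c \<boxtimes> Id C ?I)
      = ?c \<cdot> (Lunit C (A \<otimes> ?I) \<cdot> Assoc C ?I A ?I) \<cdot> (?c \<boxtimes> Id C ?I)" by simp
  also have "Lunit C (A \<otimes> ?I) \<cdot> Assoc C ?I A ?I = Lunit C A \<boxtimes> Id C ?I"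
    by (rule lunit_tensor) simp_all
  also have "(Lunit C A \<boxtimes> Id C ?I) \<cdot> (?c \<boxtimes> Id C ?I) = (Lunit C A \<cdot> ?c) \<boxtimes> Id C ?I" by simp
  finally have "?c \<cdot> (Runit C A \<boxtimes> Id C ?I) = ?c \<cdot> ((Lunit C A \<cdot> ?c) \<boxtimes> Id C ?I)" .
  then show "(Lunit C A \<cdot> ?c) \<boxtimes> Id C ?I = Runit C A \<boxtimes> Id C ?I"
    by (rule mono_cancel[OF iso_mono[OF braid_iso[OF assms unit_obj]], symmetric]) simp_all
qed simp_all

text \<open>Restricting \<open>A \<otimes> B\<close> to \<open>s\<close> can be done in either factor. The left factor needs the unit
  coherence of the associator, the right factor that of the braiding.\<close>

lemma act_tensor:
  assumes [simp]: "s \<in> Arr C" "Cod C s = TUnit C" "A \<in> Obj C" "B \<in> Obj C"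
  shows "act C s (A \<otimes> B) \<cdot> Assoc C (Dom C s) A B = act C s A \<boxtimes> Id C B"
proof -
  have "act C s (A \<otimes> B) \<cdot> Assoc C (Dom C s) A B
      = Lunit C (A \<otimes> B) \<cdot> (s \<boxtimes> (Id C A \<boxtimes> Id C B)) \<cdot> Assoc C (Dom C s) A B"
    by (simp add: act_def)
  also have "\<dots> = Lunit C (A \<otimes> B) \<cdot> Assoc C (TUnit C) A B \<cdot> ((s \<boxtimes> Id C A) \<boxtimes> Id C B)"
    using assoc_natural[of s "Id C A" "Id C B"] by (simp del: tensor_id')
  also have "\<dots> = (Lunit C (A \<otimes> B) \<cdot> Assoc C (TUnit C) A B) \<cdot> ((s \<boxtimes> Id C A) \<boxtimes> Id C B)"
    by (rule assoc_comp[symmetric]) simp_all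
  also have "\<dots> = act C s A \<boxtimes> Id C B"
    by (simp only: lunit_tensor[OF assms(3,4)]) (simp add: act_def)
  finally show ?thesis .
qed

lemma tensor_act:
  assumes [simp]: "s \<in> Arr C" "Cod C s = TUnit C" "A \<in> Obj C" "B \<in> Obj C"
  shows "(Id C A \<boxtimes> act C s B) \<cdot> Assoc C A (Dom C s) B
    = (act C s A \<boxtimes> Id C B) \<cdot> (Braid C A (Dom C s) \<boxtimes> Id C B)"
proof -
  have "(Id C A \<boxtimes> act C s B) \<cdot> Assoc C A (Dom C s) B
      = (Id C A \<boxtimes> Lunit C B) \<cdot> (Id C A \<boxtimes> (s \<boxtimes> Id C B)) \<cdot> Assoc C A (Dom C s) B"
    by (simp add: act_def)
  also have "\<dots> = (Id C A \<boxtimes> Lunit C B) \<cdot> Assoc C A (TUnit C) B \<cdot> ((Id C A \<boxtimes> s) \<boxtimes> Id C B)"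
    using assoc_natural[of "Id C A" s "Id C B"] by (simp del: tensor_comp_tail)
  also have "\<dots> = ((Id C A \<boxtimes> Lunit C B) \<cdot> Assoc C A (TUnit C) B) \<cdot> ((Id C A \<boxtimes> s) \<boxtimes> Id C B)"
    by (rule assoc_comp[symmetric]) simp_all
  also have "\<dots> = (Runit C A \<cdot> (Id C A \<boxtimes> s)) \<boxtimes> Id C B"
    by (simp only: triangle[OF assms(3,4)]) simp
  also have "Runit C A \<cdot> (Id C A \<boxtimes> s) = Lunit C A \<cdot> Braid C A (TUnit C) \<cdot> (Id C A \<boxtimes> s)"
    unfolding lunit_braid[OF assms(3), symmetric] by simp
  also have "Braid C A (TUnit C) \<cdot> (Id C A \<boxtimes> s) = (s \<boxtimes> Id C A) \<cdot> Braid C A (Dom C s)"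
    using braid_natural[of "Id C A" s] by simp
  also have "(Lunit C A \<cdot> (s \<boxtimes> Id C A) \<cdot> Braid C A (Dom C s)) \<boxtimes> Id C B
      = (act C s A \<boxtimes> Id C B) \<cdot> (Braid C A (Dom C s) \<boxtimes> Id C B)"
    by (simp add: act_def)
  finally show ?thesis .
qed

end

context category
begin

text \<open>A commutative square with an invertible side compares two restriction conditions; the coherence
  squares below are used in this way.\<close>

lemma sub_le_of_iso:
  assumes "s \<cdot> u = t \<cdot> v" "is_iso C u" "Cod C u = Dom C s" "Cod C v = Dom C t"
    "s \<in> Arr C" "t \<in> Arr C" "v \<in> Arr C" "Dom C u = Dom C v"
  shows "sub_le C s t"
proof -
  note [simp] = iso_arr[OF assms(2)] assms(3-)
  obtain k where [simp]: "k \<in> Arr C" "Dom C k = Cod C u" "Cod C k = Dom C u"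
    and k: "u \<cdot> k = Id C (Cod C u)"
    using assms(2) by (rule isoE)
  have "s = (s \<cdot> u) \<cdot> k" by (simp add: k)
  also have "\<dots> = t \<cdot> v \<cdot> k" by (simp only: assms(1)) simp
  finally show ?thesis by (rule sub_leI) simp_all
qed

end

context stiff_category
begin

text \<open>Tensoring \<open>s \<otimes> A\<close> with a further object on either side keeps it monic, as by the two preceding
  coherence squares the result is, up to isomorphism, \<open>s\<close> tensored with a larger object.\<close>

lemma act_tensor_mono:
  assumes s: "subunit C s" and [simp]: "A \<in> Obj C" "B \<in> Obj C"
  shows "is_mono C (act C s A \<boxtimes> act C s B)"
proof -
  note [simp] = subunitD(2,3)[OF s]
  have left: "is_mono C (act C s A' \<boxtimes> Id C B)" if [simp]: "A' \<in> Obj C" for A'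
    unfolding act_tensor[OF subunitD(2,3)[OF s] that assms(3), symmetric]
    by (rule mono_comp[OF iso_mono[OF assoc_iso]]) (simp_all add: act_mono s)
  let ?A = "Dom C s \<otimes> A"
  obtain k where k: "is_iso C k" "Dom C k = ?A \<otimes> Dom C s \<otimes> B" "Cod C k = (?A \<otimes> Dom C s) \<otimes> B"
    and ak: "Assoc C ?A (Dom C s) B \<cdot> k = Id C (?A \<otimes> Dom C s \<otimes> B)"
    using iso_inverse[OF assoc_iso[of ?A "Dom C s" B]] by auto
  note [simp] = k(2,3) iso_arr[OF k(1)]
  have "Id C ?A \<boxtimes> act C s B = ((Id C ?A \<boxtimes> act C s B) \<cdot> Assoc C ?A (Dom C s) B) \<cdot> k"
    by (simp add: ak)
  also have "\<dots> = ((act C s ?A \<boxtimes> Id C B) \<cdot> (Braid C ?A (Dom C s) \<boxtimes> Id C B)) \<cdot> k"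
    by (subst tensor_act) simp_all
  finally have "Id C ?A \<boxtimes> act C s B = ((act C s ?A \<boxtimes> Id C B) \<cdot> (Braid C ?A (Dom C s) \<boxtimes> Id C B)) \<cdot> k" .
  moreover have "is_mono C (((act C s ?A \<boxtimes> Id C B) \<cdot> (Braid C ?A (Dom C s) \<boxtimes> Id C B)) \<cdot> k)"
    by (intro mono_comp left iso_mono k(1) tensor_iso braid_iso id_iso) simp_all
  ultimately have right: "is_mono C (Id C ?A \<boxtimes> act C s B)" by simp
  have "is_mono C ((act C s A \<boxtimes> Id C B) \<cdot> (Id C ?A \<boxtimes> act C s B))"
    by (rule mono_comp[OF right left]) simp_all
  then show ?thesis by simp
qed

text \<open>An arrow out of \<open>S \<otimes> X\<close> restricts to \<open>s\<close>, because \<open>s \<otimes> S \<otimes> X\<close> is invertible.\<close>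

lemma sub_le_act_of_dom:
  assumes s: "subunit C s" and [simp]: "f \<in> Arr C" "X \<in> Obj C" "Dom C f = Dom C s \<otimes> X"
  shows "sub_le C f (act C s (Cod C f))"
proof -
  note [simp] = subunitD(2,3)[OF s]
  let ?S = "Dom C s"
  have "is_iso C (act C s ?S)"
    unfolding act_def by (rule iso_comp[OF subunitD(4)[OF s] lunit_iso]) simp_all
  then have "is_iso C (act C s ?S \<boxtimes> Id C X)" by (rule tensor_iso[OF _ id_iso]) simp
  also have "?this \<longleftrightarrow> is_iso C (act C s (?S \<otimes> X))"
    using act_tensor[of s ?S X]
    by (rule_tac iso_conjugate[of "Assoc C ?S ?S X" "Id C (?S \<otimes> X)"]) (simp_all add: assoc_iso id_iso)
  finally have iso: "is_iso C (act C s (?S \<otimes> X))" .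
  have "f \<cdot> act C s (?S \<otimes> X) = act C s (Cod C f) \<cdot> (Id C ?S \<boxtimes> f)"
    using act_natural[of s f] by simp
  then show ?thesis by (rule sub_le_of_iso[OF _ iso]) simp_all
qed

text \<open>Restricting first in the left factor leaves an arrow that still has domain \<open>S \<otimes> X\<close>, so it can be
  restricted again in the right factor.\<close>

lemma sub_le_act_tensor:
  assumes s: "subunit C s" and [simp]: "f \<in> Arr C" "X \<in> Obj C" "Dom C f = Dom C s \<otimes> X"
    and cod: "Cod C f = A \<otimes> B" and [simp]: "A \<in> Obj C" "B \<in> Obj C"
  shows "sub_le C f (act C s A \<boxtimes> act C s B)"
proof -
  note [simp] = subunitD(2,3)[OF s]
  let ?S = "Dom C s"
  have left: "sub_le C (act C s (A' \<otimes> B)) (act C s A' \<boxtimes> Id C B)" if [simp]: "A' \<in> Obj C" for A'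
    by (rule sub_le_of_iso[of _ "Assoc C ?S A' B" _ "Id C ((?S \<otimes> A') \<otimes> B)"])
      (simp_all add: act_tensor assoc_iso)
  have right: "sub_le C (act C s A' \<boxtimes> Id C B) (Id C A' \<boxtimes> act C s B)" if [simp]: "A' \<in> Obj C" for A'
    by (rule sub_le_of_iso[of _ "Braid C A' ?S \<boxtimes> Id C B" _ "Assoc C A' ?S B"])
      (simp_all add: tensor_act braid_iso tensor_iso id_iso)
  have "sub_le C f (act C s (A \<otimes> B))" using sub_le_act_of_dom[OF s, of f X] cod by simp
  then have "sub_le C f (act C s A \<boxtimes> Id C B)" by (rule sub_le_trans[OF _ left]) simp_all
  then obtain g where [simp]: "g \<in> Arr C" "Dom C g = ?S \<otimes> X" "Cod C g = (?S \<otimes> A) \<otimes> B"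
    and g: "(act C s A \<boxtimes> Id C B) \<cdot> g = f"
    by (rule sub_leE) simp_all
  have "sub_le C g (act C s ((?S \<otimes> A) \<otimes> B))" using sub_le_act_of_dom[OF s, of g X] by simp
  then have "sub_le C g (act C s (?S \<otimes> A) \<boxtimes> Id C B)" by (rule sub_le_trans[OF _ left]) simp_all
  then have "sub_le C g (Id C (?S \<otimes> A) \<boxtimes> act C s B)" by (rule sub_le_trans[OF _ right]) simp_all
  then obtain h where [simp]: "h \<in> Arr C" "Dom C h = ?S \<otimes> X" "Cod C h = (?S \<otimes> A) \<otimes> (?S \<otimes> B)"
    and h: "(Id C (?S \<otimes> A) \<boxtimes> act C s B) \<cdot> h = g"
    by (rule sub_leE) simp_all
  have "f = (act C s A \<boxtimes> act C s B) \<cdot> h" by (simp add: g[symmetric] h[symmetric])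
  then show ?thesis by (rule sub_leI) simp_all
qed

end

section \<open>Presheaves and natural transformations\<close>

definition nat_of :: "('o, 'a, 'm) cat_scheme \<Rightarrow> ('o, 'a, 'e) presheaf \<Rightarrow> ('o, 'a, 'e) presheaf
    \<Rightarrow> ('o \<Rightarrow> 'e \<Rightarrow> 'e) \<Rightarrow> ('o, 'a, 'e) nat_trans" where
  "nat_of C F G \<phi> = \<lparr>NDom = F, NCod = G, NMap = (\<lambda>A \<in> Obj C. \<lambda>x \<in> PObj F A. \<phi> A x)\<rparr>"

lemma nat_of_simps [simp]:
  "NDom (nat_of C F G \<phi>) = F" "NCod (nat_of C F G \<phi>) = G"
  "\<lbrakk>A \<in> Obj C; x \<in> PObj F A\<rbrakk> \<Longrightarrow> NMap (nat_of C F G \<phi>) A x = \<phi> A x"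
  by (simp_all add: nat_of_def)

lemma PSh_simps [simp]:
  "Obj (PSh C) = {F. is_presheaf C F}" "Arr (PSh C) = {n. is_nat_trans C n}"
  "Dom (PSh C) = NDom" "Cod (PSh C) = NCod" "Id (PSh C) = nat_id C" "Comp (PSh C) = nat_comp C"
  "TObj (PSh C) = day C" "TArr (PSh C) = day_map C" "TUnit (PSh C) = representable C (TUnit C)"
  by (simp_all add: PSh_def)

lemma full_sub_simps [simp]:
  "Obj (full_sub C P) = {X \<in> Obj C. P X}"
  "Arr (full_sub C P) = {f \<in> Arr C. P (Dom C f) \<and> P (Cod C f)}"
  "Dom (full_sub C P) = Dom C" "Cod (full_sub C P) = Cod C"
  "Id (full_sub C P) = Id C" "Comp (full_sub C P) = Comp C"
  by (simp_all add: full_sub_def)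

lemma full_sub_tensor_simps [simp]:
  "TObj (full_sub C P) = TObj C" "TArr (full_sub C P) = TArr C" "TUnit (full_sub C P) = TUnit C"
  by (simp_all add: full_sub_def)

lemma full_sub_True: "full_sub C (\<lambda>_. True) = C"
  by (simp add: full_sub_def)

lemma nat_comp_simps [simp]:
  "NDom (nat_comp C n m) = NDom m" "NCod (nat_comp C n m) = NCod n"
  "\<lbrakk>A \<in> Obj C; x \<in> PObj (NDom m) A\<rbrakk> \<Longrightarrow> NMap (nat_comp C n m) A x = NMap n A (NMap m A x)"
  by (simp_all add: nat_comp_def)

lemma nat_id_simps [simp]:
  "NDom (nat_id C F) = F" "NCod (nat_id C F) = F"
  "\<lbrakk>A \<in> Obj C; x \<in> PObj F A\<rbrakk> \<Longrightarrow> NMap (nat_id C F) A x = x"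
  by (simp_all add: nat_id_def)

context category
begin

lemma presheafD:
  assumes "is_presheaf C F"
  shows "\<lbrakk>f \<in> Arr C; x \<in> PObj F (Cod C f)\<rbrakk> \<Longrightarrow> PMap F f x \<in> PObj F (Dom C f)"
    and "\<lbrakk>A \<in> Obj C; x \<in> PObj F A\<rbrakk> \<Longrightarrow> PMap F (Id C A) x = x"
    and "\<lbrakk>f \<in> Arr C; g \<in> Arr C; Cod C f = Dom C g; x \<in> PObj F (Cod C g)\<rbrakk>
      \<Longrightarrow> PMap F (g \<cdot> f) x = PMap F f (PMap F g x)"
proof -
  have M: "PMap F \<in> (\<Pi>\<^sub>E f \<in> Arr C. PObj F (Cod C f) \<rightarrow>\<^sub>E PObj F (Dom C f))"
    using assms by (simp add: is_presheaf_def)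
  show "\<lbrakk>f \<in> Arr C; x \<in> PObj F (Cod C f)\<rbrakk> \<Longrightarrow> PMap F f x \<in> PObj F (Dom C f)"
    using PiE_mem[OF PiE_mem[OF M]] .
qed (use assms in \<open>simp_all add: is_presheaf_def\<close>)

lemma presheafI:
  assumes "\<And>f x. \<lbrakk>f \<in> Arr C; x \<in> P (Cod C f)\<rbrakk> \<Longrightarrow> M f x \<in> P (Dom C f)"
    and "\<And>A x. \<lbrakk>A \<in> Obj C; x \<in> P A\<rbrakk> \<Longrightarrow> M (Id C A) x = x"
    and "\<And>f g x. \<lbrakk>f \<in> Arr C; g \<in> Arr C; Cod C f = Dom C g; x \<in> P (Cod C g)\<rbrakk>
      \<Longrightarrow> M (g \<cdot> f) x = M f (M g x)"
  shows "is_presheaf C \<lparr>PObj = (\<lambda>A \<in> Obj C. P A), PMap = (\<lambda>f \<in> Arr C. \<lambda>x \<in> P (Cod C f). M f x)\<rparr>"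
proof -
  have "M f x \<in> P (Dom C f)" if "f \<in> Arr C" "x \<in> P (Cod C f)" for f x using assms(1) that .
  moreover have "M f x \<in> P A" if "f \<in> Arr C" "x \<in> P (Cod C f)" "Dom C f = A" for f x A
    using assms(1) that by blast
  ultimately show ?thesis
    unfolding is_presheaf_def using assms(2,3) by auto
qed

lemma nat_transD:
  assumes "is_nat_trans C n"
  shows "is_presheaf C (NDom n)" "is_presheaf C (NCod n)"
    and "\<lbrakk>A \<in> Obj C; x \<in> PObj (NDom n) A\<rbrakk> \<Longrightarrow> NMap n A x \<in> PObj (NCod n) A"
    and "\<lbrakk>f \<in> Arr C; x \<in> PObj (NDom n) (Cod C f)\<rbrakk>
      \<Longrightarrow> NMap n (Dom C f) (PMap (NDom n) f x) = PMap (NCod n) f (NMap n (Cod C f) x)"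
proof -
  have M: "NMap n \<in> (\<Pi>\<^sub>E A \<in> Obj C. PObj (NDom n) A \<rightarrow>\<^sub>E PObj (NCod n) A)"
    using assms by (simp add: is_nat_trans_def)
  show "\<lbrakk>A \<in> Obj C; x \<in> PObj (NDom n) A\<rbrakk> \<Longrightarrow> NMap n A x \<in> PObj (NCod n) A"
    using PiE_mem[OF PiE_mem[OF M]] .
qed (use assms in \<open>simp_all add: is_nat_trans_def\<close>)

lemma nat_ofI:
  assumes "is_presheaf C F" "is_presheaf C G"
    and "\<And>A x. \<lbrakk>A \<in> Obj C; x \<in> PObj F A\<rbrakk> \<Longrightarrow> \<phi> A x \<in> PObj G A"
    and "\<And>f x. \<lbrakk>f \<in> Arr C; x \<in> PObj F (Cod C f)\<rbrakk>
      \<Longrightarrow> \<phi> (Dom C f) (PMap F f x) = PMap G f (\<phi> (Cod C f) x)"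
  shows "is_nat_trans C (nat_of C F G \<phi>)"
  using assms presheafD(1)[OF assms(1)] unfolding is_nat_trans_def nat_of_def by auto

lemma nat_trans_eqI:
  assumes "is_nat_trans C n" "is_nat_trans C m" "NDom n = NDom m" "NCod n = NCod m"
    and "\<And>A x. \<lbrakk>A \<in> Obj C; x \<in> PObj (NDom n) A\<rbrakk> \<Longrightarrow> NMap n A x = NMap m A x"
  shows "n = m"
proof -
  have n: "NMap n \<in> (\<Pi>\<^sub>E A \<in> Obj C. PObj (NDom n) A \<rightarrow>\<^sub>E PObj (NCod n) A)"
    using assms(1) by (simp add: is_nat_trans_def)
  have m: "NMap m \<in> (\<Pi>\<^sub>E A \<in> Obj C. PObj (NDom n) A \<rightarrow>\<^sub>E PObj (NCod n) A)"
    using assms(2) by (simp add: is_nat_trans_def assms(3,4))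
  have "NMap n A = NMap m A" if "A \<in> Obj C" for A
    by (rule PiE_ext[OF PiE_mem[OF n that] PiE_mem[OF m that] assms(5)[OF that]])
  then have "NMap n = NMap m" by (rule PiE_ext[OF n m])
  with assms(3,4) show ?thesis by simp
qed

lemma nat_comp_trans:
  assumes "is_nat_trans C n" "is_nat_trans C m" "NCod m = NDom n"
  shows "is_nat_trans C (nat_comp C n m)"
proof -
  have "nat_comp C n m = nat_of C (NDom m) (NCod n) (\<lambda>A x. NMap n A (NMap m A x))"
    by (simp add: nat_comp_def nat_of_def)
  moreover have "is_nat_trans C (nat_of C (NDom m) (NCod n) (\<lambda>A x. NMap n A (NMap m A x)))"
    by (rule nat_ofI)
      (use nat_transD[OF assms(1)] nat_transD[OF assms(2)] assms(3) in simp_all)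
  ultimately show ?thesis by simp
qed

lemma nat_id_trans: "is_presheaf C F \<Longrightarrow> is_nat_trans C (nat_id C F)"
proof -
  assume F: "is_presheaf C F"
  have "nat_id C F = nat_of C F F (\<lambda>A x. x)" by (simp add: nat_id_def nat_of_def)
  moreover have "is_nat_trans C (nat_of C F F (\<lambda>A x. x))" by (rule nat_ofI) (use F in simp_all)
  ultimately show ?thesis by simp
qed

text \<open>A factorization through a pointwise injective transformation may be chosen pointwise;
  naturality is automatic.\<close>

lemma nat_factor:
  assumes n: "is_nat_trans C n" and m: "is_nat_trans C m" and cod: "NCod n = NCod m"
    and inj: "\<And>A. A \<in> Obj C \<Longrightarrow> inj_on (NMap m A) (PObj (NDom m) A)"
    and img: "\<And>A. A \<in> Obj C \<Longrightarrow> NMap n A ` PObj (NDom n) A \<subseteq> NMap m A ` PObj (NDom m) A"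
  obtains g where "is_nat_trans C g" "NDom g = NDom n" "NCod g = NDom m" "n = nat_comp C m g"
proof -
  define \<phi> where "\<phi> A x = inv_into (PObj (NDom m) A) (NMap m A) (NMap n A x)" for A x
  let ?g = "nat_of C (NDom n) (NDom m) \<phi>"
  have \<phi>: "\<phi> A x \<in> PObj (NDom m) A" "NMap m A (\<phi> A x) = NMap n A x"
    if "A \<in> Obj C" "x \<in> PObj (NDom n) A" for A x
  proof -
    have "NMap n A x \<in> NMap m A ` PObj (NDom m) A" using img that by blast
    then show "\<phi> A x \<in> PObj (NDom m) A" "NMap m A (\<phi> A x) = NMap n A x"
      unfolding \<phi>_def by (rule inv_into_into, rule f_inv_into_f)
  qed
  have g: "is_nat_trans C ?g"
  proof (rule nat_ofI)
    fix f x assume f: "f \<in> Arr C" and x: "x \<in> PObj (NDom n) (Cod C f)"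
    note fx = presheafD(1)[OF nat_transD(1)[OF n] f x]
    have "NMap m (Dom C f) (\<phi> (Dom C f) (PMap (NDom n) f x)) = NMap n (Dom C f) (PMap (NDom n) f x)"
      using \<phi>(2) fx f by simp
    also have "\<dots> = PMap (NCod m) f (NMap m (Cod C f) (\<phi> (Cod C f) x))"
      using nat_transD(4)[OF n f x] \<phi>(2)[OF _ x] f cod by simp
    also have "\<dots> = NMap m (Dom C f) (PMap (NDom m) f (\<phi> (Cod C f) x))"
      using nat_transD(4)[OF m f] \<phi>(1)[OF _ x] f by simp
    finally show "\<phi> (Dom C f) (PMap (NDom n) f x) = PMap (NDom m) f (\<phi> (Cod C f) x)"
      by (rule inj_onD[OF inj[OF dom_obj[OF f]]]) (use f x fx \<phi>(1) presheafD(1)[OF nat_transD(1)[OF m]] in simp_all)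
  qed (use nat_transD(1) n m \<phi>(1) in simp_all)
  have "n = nat_comp C m ?g"
    by (rule nat_trans_eqI[OF n nat_comp_trans[OF m g]]) (use cod \<phi>(2) in simp_all)
  then show ?thesis by (rule that[OF g nat_of_simps(1,2)])
qed

end

context tensor_category
begin

lemma sub_le_PSh_iff:
  assumes n: "is_nat_trans C n" and m: "is_nat_trans C m" and cod: "NCod n = NCod m"
    and P: "P (NDom n)" "P (NDom m)"
    and inj: "\<And>A. A \<in> Obj C \<Longrightarrow> inj_on (NMap m A) (PObj (NDom m) A)"
  shows "sub_le (full_sub (PSh C) P) n m
    \<longleftrightarrow> (\<forall>A \<in> Obj C. NMap n A ` PObj (NDom n) A \<subseteq> NMap m A ` PObj (NDom m) A)"
proof
  assume "sub_le (full_sub (PSh C) P) n m"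
  then obtain g where "g \<in> Hom (full_sub (PSh C) P) (NDom n) (NDom m)" and eq: "n = nat_comp C m g"
    unfolding sub_le_def full_sub_simps PSh_simps by blast
  then have g: "is_nat_trans C g" "NDom g = NDom n" "NCod g = NDom m" by (simp_all add: Hom_def)
  have "NMap n A x = NMap m A (NMap g A x)" if "A \<in> Obj C" "x \<in> PObj (NDom n) A" for A x
    unfolding eq using that g(2) by simp
  then show "\<forall>A \<in> Obj C. NMap n A ` PObj (NDom n) A \<subseteq> NMap m A ` PObj (NDom m) A"
    using nat_transD(3)[OF g(1)] g(2,3) by (auto intro!: imageI)
next
  assume "\<forall>A \<in> Obj C. NMap n A ` PObj (NDom n) A \<subseteq> NMap m A ` PObj (NDom m) A"
  with nat_factor[OF n m cod inj]
  obtain g where g: "is_nat_trans C g" "NDom g = NDom n" "NCod g = NDom m" and eq: "n = nat_comp C m g"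
    by metis
  have "g \<in> Hom (full_sub (PSh C) P) (NDom n) (NDom m)" using g P by (simp add: Hom_def)
  with eq cod show "sub_le (full_sub (PSh C) P) n m"
    unfolding sub_le_def full_sub_simps PSh_simps by blast
qed

text \<open>Invertibility in a full subcategory of presheaves is checked pointwise; the inverse is the
  factorization of the identity.\<close>

lemma iso_PSh_iff:
  assumes n: "is_nat_trans C n" and P: "P (NDom n)" "P (NCod n)"
  shows "is_iso (full_sub (PSh C) P) n
    \<longleftrightarrow> (\<forall>A \<in> Obj C. bij_betw (NMap n A) (PObj (NDom n) A) (PObj (NCod n) A))"
proof
  assume "is_iso (full_sub (PSh C) P) n"
  then obtain g where g: "is_nat_trans C g" "NDom g = NCod n" "NCod g = NDom n"
    and eqs: "nat_comp C g n = nat_id C (NDom n)" "nat_comp C n g = nat_id C (NCod n)"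
    by (auto simp: is_iso_def Hom_def)
  show "\<forall>A \<in> Obj C. bij_betw (NMap n A) (PObj (NDom n) A) (PObj (NCod n) A)"
  proof
    fix A assume A: "A \<in> Obj C"
    have 1: "NMap g A (NMap n A x) = x" if "x \<in> PObj (NDom n) A" for x
      using that A nat_comp_simps(3)[OF A, of x n g] eqs(1) by simp
    have 2: "NMap n A (NMap g A x) = x" if "x \<in> PObj (NCod n) A" for x
      using that A nat_comp_simps(3)[OF A, of x g n] eqs(2) g(2) by simp
    show "bij_betw (NMap n A) (PObj (NDom n) A) (PObj (NCod n) A)"
      by (rule bij_betw_byWitness[of _ "NMap g A"])
        (use A 1 2 nat_transD(3)[OF n A] nat_transD(3)[OF g(1) A] g(2,3) in auto)
  qed
next
  assume bij: "\<forall>A \<in> Obj C. bij_betw (NMap n A) (PObj (NDom n) A) (PObj (NCod n) A)"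
  then have inj: "inj_on (NMap n A) (PObj (NDom n) A)" if "A \<in> Obj C" for A
    using that by (simp add: bij_betw_def)
  let ?id = "nat_id C (NCod n)"
  have id: "is_nat_trans C ?id" using nat_id_trans nat_transD(2)[OF n] .
  have img: "NMap ?id A ` PObj (NDom ?id) A \<subseteq> NMap n A ` PObj (NDom n) A" if "A \<in> Obj C" for A
    using bij that by (auto simp: bij_betw_def)
  obtain g where g: "is_nat_trans C g" "NDom g = NCod n" "NCod g = NDom n" and eq: "?id = nat_comp C n g"
    using nat_factor[OF id n _ inj img] unfolding nat_id_simps by blast
  have ng: "NMap n A (NMap g A y) = y" if "A \<in> Obj C" "y \<in> PObj (NCod n) A" for A y
    using that nat_comp_simps(3)[of A C y g n] eq[symmetric] g(2) by simp
  have "nat_comp C g n = nat_id C (NDom n)"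
  proof (rule nat_trans_eqI[OF nat_comp_trans[OF g(1) n] nat_id_trans[OF nat_transD(1)[OF n]]])
    fix A x assume A: "A \<in> Obj C" and "x \<in> PObj (NDom (nat_comp C g n)) A"
    then have x: "x \<in> PObj (NDom n) A" by simp
    have "NMap n A (NMap g A (NMap n A x)) = NMap n A x"
      using ng A nat_transD(3)[OF n A x] by simp
    then have "NMap g A (NMap n A x) = x"
      by (rule inj_onD[OF inj[OF A]])
        (use x nat_transD(3)[OF g(1) A] nat_transD(3)[OF n A x] g(2,3) in simp_all)
    then show "NMap (nat_comp C g n) A x = NMap (nat_id C (NDom n)) A x" using A x by simp
  qed (use g in simp_all)
  with eq g n P show "is_iso (full_sub (PSh C) P) n" by (auto simp: is_iso_def Hom_def)
qed

lemma representable_presheaf: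
  assumes "X \<in> Obj C" shows "is_presheaf C (representable C X)"
  unfolding representable_def by (rule presheafI) auto

lemma representable_simps [simp]:
  "A \<in> Obj C \<Longrightarrow> PObj (representable C X) A = ArrE ` Hom C A X"
  "\<lbrakk>f \<in> Arr C; g \<in> Arr C; Dom C g = Cod C f; Cod C g = X\<rbrakk>
    \<Longrightarrow> PMap (representable C X) f (ArrE g) = ArrE (g \<cdot> f)"
  by (simp_all add: representable_def)

text \<open>By the Yoneda lemma, monomorphisms are pointwise injective in every full subcategory that
  contains the representable presheaves.\<close>

lemma mono_PSh_iff:
  fixes n :: "('o, 'a, ('x, 'o, 'a) elt) nat_trans"
  assumes n: "is_nat_trans C n" and P: "P (NDom n)" "P (NCod n)"
    and rep: "\<And>X. X \<in> Obj C \<Longrightarrow> P (representable C X)"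
  shows "is_mono (full_sub (PSh C) P) n
    \<longleftrightarrow> (\<forall>A \<in> Obj C. inj_on (NMap n A) (PObj (NDom n) A))"
proof
  assume mono: "is_mono (full_sub (PSh C) P) n"
  show "\<forall>A \<in> Obj C. inj_on (NMap n A) (PObj (NDom n) A)"
  proof (intro ballI inj_onI)
    fix A x y
    assume A [simp]: "A \<in> Obj C" and x: "x \<in> PObj (NDom n) A" and y: "y \<in> PObj (NDom n) A"
      and eq: "NMap n A x = NMap n A y"
    note F = nat_transD(1)[OF n]
    define k where "k z = nat_of C (representable C A) (NDom n) (\<lambda>B e. PMap (NDom n) (un_arr e) z)" for z
    have k: "is_nat_trans C (k z)" if "z \<in> PObj (NDom n) A" for z
      unfolding k_def
      by (rule nat_ofI[OF representable_presheaf F])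
        (use that presheafD(1,3)[OF F] in auto)
    have [simp]: "NDom (k z) = representable C A" "NCod (k z) = NDom n" for z
      by (simp_all add: k_def)
    have "nat_comp C n (k x) = nat_comp C n (k y)"
    proof (rule nat_trans_eqI)
      show "is_nat_trans C (nat_comp C n (k x))" "is_nat_trans C (nat_comp C n (k y))"
        using nat_comp_trans[OF n] k[OF x] k[OF y] by simp_all
      fix B e assume B: "B \<in> Obj C" and "e \<in> PObj (NDom (nat_comp C n (k x))) B"
      then obtain f where f [simp]: "f \<in> Arr C" "Dom C f = B" "Cod C f = A" and e: "e = ArrE f"
        by auto
      have "NMap n B (PMap (NDom n) f x) = NMap n B (PMap (NDom n) f y)"
        using nat_transD(4)[OF n f(1), of x] nat_transD(4)[OF n f(1), of y] x y eq by simp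
      then show "NMap (nat_comp C n (k x)) B e = NMap (nat_comp C n (k y)) B e"
        using B by (simp add: e k_def)
    qed simp_all
    then have "k x = k y"
      using mono k[OF x] k[OF y] P rep[OF A] unfolding is_mono_def by simp
    then have "NMap (k x) A (ArrE (Id C A)) = NMap (k y) A (ArrE (Id C A))" by simp
    then show "x = y" using presheafD(2)[OF F A] x y by (simp add: k_def)
  qed
next
  assume inj: "\<forall>A \<in> Obj C. inj_on (NMap n A) (PObj (NDom n) A)"
  have "g = h" if g: "is_nat_trans C g" "NCod g = NDom n" and h: "is_nat_trans C h" "NCod h = NDom n"
    and dom: "NDom g = NDom h" and eq: "nat_comp C n g = nat_comp C n h" for g h
  proof (rule nat_trans_eqI[OF g(1) h(1) dom])
    fix A x assume A: "A \<in> Obj C" and x: "x \<in> PObj (NDom g) A"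
    have "NMap n A (NMap g A x) = NMap n A (NMap h A x)"
      using nat_comp_simps(3)[OF A, of x g n] nat_comp_simps(3)[OF A, of x h n] x dom eq by simp
    then show "NMap g A x = NMap h A x"
      by (rule inj_onD[OF bspec[OF inj A]])
        (use nat_transD(3)[OF g(1) A x] nat_transD(3)[OF h(1) A x[unfolded dom]] g(2) h(2) in simp_all)
  qed (use g h in simp)
  then show "is_mono (full_sub (PSh C) P) n"
    using n P unfolding is_mono_def by simp
qed

end

section \<open>Day convolution\<close>

lemma day_eq_refl: "(z, z) \<in> day_eq C F G A"
  by (simp add: day_eq_def)

lemma day_eq_sym: "(z, w) \<in> day_eq C F G A \<Longrightarrow> (w, z) \<in> day_eq C F G A"
  unfolding day_eq_def by (rule symD[OF sym_rtrancl]) (auto simp: sym_def)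

lemma day_eq_trans:
  "\<lbrakk>(z, w) \<in> day_eq C F G A; (w, v) \<in> day_eq C F G A\<rbrakk> \<Longrightarrow> (z, v) \<in> day_eq C F G A"
  unfolding day_eq_def by (rule rtrancl_trans)

lemma day_eq_step: "(z, w) \<in> day_step C F G A \<Longrightarrow> (z, w) \<in> day_eq C F G A"
  unfolding day_eq_def by blast

text \<open>The universal property of the coend, on the level of representatives: a function that is
  constant along the generating relation is well defined on classes.\<close>

lemma day_eq_invariant:
  assumes "(z, w) \<in> day_eq C F G A" and "\<And>z w. (z, w) \<in> day_step C F G A \<Longrightarrow> g z = g w"
  shows "g z = g w"
  using assms(1) unfolding day_eq_def by (induction rule: rtrancl_induct) (auto dest: assms(2))

lemma un_day_elt: "(z, un_day (day_elt C F G A z)) \<in> day_eq C F G A"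
  unfolding day_elt_def using someI[of "\<lambda>w. w \<in> day_eq C F G A `` {z}" z] by (simp add: day_eq_refl)

lemma day_elt_eq_iff: "day_elt C F G A z = day_elt C F G A w \<longleftrightarrow> (z, w) \<in> day_eq C F G A"
proof
  assume "day_elt C F G A z = day_elt C F G A w"
  then show "(z, w) \<in> day_eq C F G A"
    using un_day_elt[of z C F G A] un_day_elt[of w C F G A] day_eq_sym day_eq_trans by metis
next
  assume "(z, w) \<in> day_eq C F G A"
  then have "day_eq C F G A `` {z} = day_eq C F G A `` {w}"
    by (auto intro: day_eq_sym day_eq_trans)
  then show "day_elt C F G A z = day_elt C F G A w" by (simp add: day_elt_def)
qed

context tensor_category
begin

lemma day_pre_iff [simp]:
  "(B, B', f, x, y) \<in> day_pre C F G A \<longleftrightarrow> B \<in> Obj C \<and> B' \<in> Obj C \<and> f \<in> Arr C \<and> Dom C f = A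
    \<and> Cod C f = B \<otimes> B' \<and> x \<in> PObj F B \<and> y \<in> PObj G B'"
  by (auto simp: day_pre_def)

lemma day_stepI:
  assumes "b \<in> Arr C" "b' \<in> Arr C" "f \<in> Arr C" "Dom C f = A" "Cod C f = Dom C b \<otimes> Dom C b'"
    "x \<in> PObj F (Cod C b)" "y \<in> PObj G (Cod C b')"
  shows "((Dom C b, Dom C b', f, PMap F b x, PMap G b' y), (Cod C b, Cod C b', (b \<boxtimes> b') \<cdot> f, x, y))
    \<in> day_step C F G A"
  unfolding day_step_def using assms by auto

lemma day_stepE:
  assumes "(z, w) \<in> day_step C F G A"
  obtains b b' f x y where "b \<in> Arr C" "b' \<in> Arr C" "f \<in> Arr C" "Dom C f = A"
    "Cod C f = Dom C b \<otimes> Dom C b'" "x \<in> PObj F (Cod C b)" "y \<in> PObj G (Cod C b')"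
    "z = (Dom C b, Dom C b', f, PMap F b x, PMap G b' y)"
    "w = (Cod C b, Cod C b', (b \<boxtimes> b') \<cdot> f, x, y)"
  using assms unfolding day_step_def by auto

lemma day_eq_pre:
  assumes F: "is_presheaf C F" and G: "is_presheaf C G" and "(z, w) \<in> day_eq C F G A"
  shows "z \<in> day_pre C F G A \<longleftrightarrow> w \<in> day_pre C F G A"
proof (rule day_eq_invariant[OF assms(3)])
  fix z w assume "(z, w) \<in> day_step C F G A"
  then show "z \<in> day_pre C F G A \<longleftrightarrow> w \<in> day_pre C F G A"
    by (rule day_stepE) (use presheafD(1)[OF F] presheafD(1)[OF G] in simp)
qed

lemma day_PObj: "A \<in> Obj C \<Longrightarrow> PObj (day C F G) A = day_elt C F G A ` day_pre C F G A"
  by (simp add: day_def)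

text \<open>Restriction and functoriality can be computed on any representative of a class, not only on the
  one that encodes it.\<close>

lemma day_PMap:
  assumes h [simp]: "h \<in> Arr C" and z: "(B, B', f, x, y) \<in> day_pre C F G (Cod C h)"
  shows "PMap (day C F G) h (day_elt C F G (Cod C h) (B, B', f, x, y))
    = day_elt C F G (Dom C h) (B, B', f \<cdot> h, x, y)"
proof -
  let ?r = "\<lambda>(B, B', f, x, y). day_elt C F G (Dom C h) (B, B', f \<cdot> h, x, y)"
  have "?r z = ?r w" if "(z, w) \<in> day_step C F G (Cod C h)" for z w
    using that
  proof (rule day_stepE)
    fix b b' f x y
    assume [simp]: "b \<in> Arr C" "b' \<in> Arr C" "f \<in> Arr C" "Dom C f = Cod C h"
      "Cod C f = Dom C b \<otimes> Dom C b'" "x \<in> PObj F (Cod C b)" "y \<in> PObj G (Cod C b')"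
      and z: "z = (Dom C b, Dom C b', f, PMap F b x, PMap G b' y)"
      and w: "w = (Cod C b, Cod C b', (b \<boxtimes> b') \<cdot> f, x, y)"
    have "((Dom C b, Dom C b', f \<cdot> h, PMap F b x, PMap G b' y),
        (Cod C b, Cod C b', (b \<boxtimes> b') \<cdot> f \<cdot> h, x, y)) \<in> day_step C F G (Dom C h)"
      by (rule day_stepI) simp_all
    then show "?r z = ?r w"
      unfolding z w by (simp add: day_elt_eq_iff day_eq_step)
  qed
  then have "?r (B, B', f, x, y) = ?r (un_day (day_elt C F G (Cod C h) (B, B', f, x, y)))"
    by (rule day_eq_invariant[OF un_day_elt])
  moreover have "PMap (day C F G) h (day_elt C F G (Cod C h) (B, B', f, x, y))
      = ?r (un_day (day_elt C F G (Cod C h) (B, B', f, x, y)))"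
    using imageI[OF z, of "day_elt C F G (Cod C h)"] by (simp add: day_def case_prod_unfold)
  ultimately show ?thesis by simp
qed

lemma day_presheaf:
  assumes F: "is_presheaf C F" and G: "is_presheaf C G"
  shows "is_presheaf C (day C F G)"
proof -
  have apply_map: "(case un_day (day_elt C F G (Cod C h) (B, B', f, x, y)) of
        (B, B', f, x, y) \<Rightarrow> day_elt C F G (Dom C h) (B, B', f \<cdot> h, x, y))
      = day_elt C F G (Dom C h) (B, B', f \<cdot> h, x, y)"
    if "h \<in> Arr C" "(B, B', f, x, y) \<in> day_pre C F G (Cod C h)" for h B B' f x y
    using day_PMap[OF that] imageI[OF that(2), of "day_elt C F G (Cod C h)"] that(1)
    by (simp add: day_def case_prod_unfold)
  show ?thesis
    unfolding day_def
  proof (rule presheafI)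
    fix h e assume h: "h \<in> Arr C" and "e \<in> day_elt C F G (Cod C h) ` day_pre C F G (Cod C h)"
    then obtain B B' f x y where z: "(B, B', f, x, y) \<in> day_pre C F G (Cod C h)"
      and e: "e = day_elt C F G (Cod C h) (B, B', f, x, y)" by auto
    show "(case un_day e of (B, B', f, x, y) \<Rightarrow> day_elt C F G (Dom C h) (B, B', f \<cdot> h, x, y))
        \<in> day_elt C F G (Dom C h) ` day_pre C F G (Dom C h)"
      unfolding e apply_map[OF h z] by (rule imageI) (use h z in simp)
  next
    fix A e assume A: "A \<in> Obj C" and "e \<in> day_elt C F G A ` day_pre C F G A"
    then obtain B B' f x y where z: "(B, B', f, x, y) \<in> day_pre C F G A"
      and e: "e = day_elt C F G A (B, B', f, x, y)" by auto
    show "(case un_day e of (B, B', f, x, y) \<Rightarrow>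
        day_elt C F G (Dom C (Id C A)) (B, B', f \<cdot> Id C A, x, y)) = e"
      using apply_map[of "Id C A" B B' f x y] A z by (simp add: e)
  next
    fix h k e assume hk: "h \<in> Arr C" "k \<in> Arr C" "Cod C h = Dom C k"
      and "e \<in> day_elt C F G (Cod C k) ` day_pre C F G (Cod C k)"
    then obtain B B' f x y where z: "(B, B', f, x, y) \<in> day_pre C F G (Cod C k)"
      and e: "e = day_elt C F G (Cod C k) (B, B', f, x, y)" by auto
    show "(case un_day e of (B, B', f, x, y) \<Rightarrow>
          day_elt C F G (Dom C (k \<cdot> h)) (B, B', f \<cdot> k \<cdot> h, x, y)) =
        (case un_day (case un_day e of (B, B', f, x, y) \<Rightarrow>
            day_elt C F G (Dom C k) (B, B', f \<cdot> k, x, y)) of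
          (B, B', f, x, y) \<Rightarrow> day_elt C F G (Dom C h) (B, B', f \<cdot> h, x, y))"
      using apply_map[of "k \<cdot> h" B B' f x y] apply_map[of k B B' f x y]
        apply_map[of h B B' "f \<cdot> k" x y] hk z by (simp add: e)
  qed
qed

lemma day_map_elt:
  assumes m: "is_nat_trans C m" and n: "is_nat_trans C n" and A: "A \<in> Obj C"
    and z: "(B, B', f, x, y) \<in> day_pre C (NDom m) (NDom n) A"
  shows "NMap (day_map C m n) A (day_elt C (NDom m) (NDom n) A (B, B', f, x, y))
    = day_elt C (NCod m) (NCod n) A (B, B', f, NMap m B x, NMap n B' y)"
proof -
  let ?r = "\<lambda>(B, B', f, x, y). day_elt C (NCod m) (NCod n) A (B, B', f, NMap m B x, NMap n B' y)"
  have "?r z = ?r w" if "(z, w) \<in> day_step C (NDom m) (NDom n) A" for z w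
    using that
  proof (rule day_stepE)
    fix b b' f x y
    assume a [simp]: "b \<in> Arr C" "b' \<in> Arr C" "f \<in> Arr C" "Dom C f = A"
      "Cod C f = Dom C b \<otimes> Dom C b'" "x \<in> PObj (NDom m) (Cod C b)" "y \<in> PObj (NDom n) (Cod C b')"
      and z: "z = (Dom C b, Dom C b', f, PMap (NDom m) b x, PMap (NDom n) b' y)"
      and w: "w = (Cod C b, Cod C b', (b \<boxtimes> b') \<cdot> f, x, y)"
    have "((Dom C b, Dom C b', f, PMap (NCod m) b (NMap m (Cod C b) x), PMap (NCod n) b' (NMap n (Cod C b') y)),
        (Cod C b, Cod C b', (b \<boxtimes> b') \<cdot> f, NMap m (Cod C b) x, NMap n (Cod C b') y))
        \<in> day_step C (NCod m) (NCod n) A"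
      by (rule day_stepI) (simp_all add: nat_transD(3)[OF m] nat_transD(3)[OF n])
    then show "?r z = ?r w"
      unfolding z w
      by (simp add: day_elt_eq_iff day_eq_step nat_transD(4)[OF m] nat_transD(4)[OF n])
  qed
  then have "?r (B, B', f, x, y) = ?r (un_day (day_elt C (NDom m) (NDom n) A (B, B', f, x, y)))"
    by (rule day_eq_invariant[OF un_day_elt])
  moreover have "NMap (day_map C m n) A (day_elt C (NDom m) (NDom n) A (B, B', f, x, y))
      = ?r (un_day (day_elt C (NDom m) (NDom n) A (B, B', f, x, y)))"
    using imageI[OF z, of "day_elt C (NDom m) (NDom n) A"] A
    by (simp add: day_map_def day_PObj case_prod_unfold)
  ultimately show ?thesis by simp
qed

lemma day_map_trans:
  assumes m: "is_nat_trans C m" and n: "is_nat_trans C n"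
  shows "is_nat_trans C (day_map C m n)"
    "NDom (day_map C m n) = day C (NDom m) (NDom n)" "NCod (day_map C m n) = day C (NCod m) (NCod n)"
proof -
  note mn = nat_transD[OF m] nat_transD[OF n]
  let ?F = "day C (NDom m) (NDom n)" and ?G = "day C (NCod m) (NCod n)"
  show dom: "NDom (day_map C m n) = ?F" "NCod (day_map C m n) = ?G"
    by (simp_all add: day_map_def)
  have eq: "day_map C m n = nat_of C ?F ?G (NMap (day_map C m n))"
    by (rule sym) (simp add: nat_of_def day_map_def cong: restrict_cong)
  have "is_nat_trans C (nat_of C ?F ?G (NMap (day_map C m n)))"
  proof (rule nat_ofI)
    show "is_presheaf C ?F" "is_presheaf C ?G" using mn by (simp_all add: day_presheaf)
    fix A e assume A: "A \<in> Obj C" and "e \<in> PObj ?F A"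
    then obtain B B' f x y where z: "(B, B', f, x, y) \<in> day_pre C (NDom m) (NDom n) A"
      and e: "e = day_elt C (NDom m) (NDom n) A (B, B', f, x, y)" by (auto simp: day_PObj)
    show "NMap (day_map C m n) A e \<in> PObj ?G A"
      unfolding e day_map_elt[OF m n A z] day_PObj[OF A] by (rule imageI) (use z mn in simp)
  next
    fix h e assume h: "h \<in> Arr C" and "e \<in> PObj ?F (Cod C h)"
    then obtain B B' f x y where z: "(B, B', f, x, y) \<in> day_pre C (NDom m) (NDom n) (Cod C h)"
      and e: "e = day_elt C (NDom m) (NDom n) (Cod C h) (B, B', f, x, y)" by (auto simp: day_PObj)
    have z': "(B, B', f \<cdot> h, x, y) \<in> day_pre C (NDom m) (NDom n) (Dom C h)" using z h by simp
    have z'': "(B, B', f, NMap m B x, NMap n B' y) \<in> day_pre C (NCod m) (NCod n) (Cod C h)"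
      using z mn by simp
    show "NMap (day_map C m n) (Dom C h) (PMap ?F h e) = PMap ?G h (NMap (day_map C m n) (Cod C h) e)"
      unfolding e day_PMap[OF h z] day_map_elt[OF m n dom_obj[OF h] z']
        day_map_elt[OF m n cod_obj[OF h] z] day_PMap[OF h z''] ..
  qed
  with eq show "is_nat_trans C (day_map C m n)" by simp
qed

end

section \<open>Convolution of sieves of subunits\<close>

text \<open>On representatives, the map from the convolution of two sieves to \<open>C(-, I)\<close> induced by the
  multiplication \<open>I \<otimes> I \<rightarrow> I\<close>.\<close>

definition day_mult :: "('o, 'a, 'm) braided_cat_scheme
    \<Rightarrow> 'o \<times> 'o \<times> 'a \<times> ('x, 'o, 'a) elt \<times> ('x, 'o, 'a) elt \<Rightarrow> 'a" where
  "day_mult C z = (case z of (B, B', f, x, y) \<Rightarrow>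
     Lunit C (TUnit C) \<cdot>\<^bsub>C\<^esub> (un_arr x \<boxtimes>\<^bsub>C\<^esub> un_arr y) \<cdot>\<^bsub>C\<^esub> f)"

context stiff_category
begin

abbreviation sieve :: "'a set set \<Rightarrow> ('o, 'a, ('x, 'o, 'a) elt) presheaf" where
  "sieve U \<equiv> bracket C U (TUnit C)"

lemma restricts_precomp:
  assumes "restricts C f p" "p \<in> carrier (ISub C)" "f \<in> Arr C" "h \<in> Arr C" "Cod C h = Dom C f"
  shows "restricts C (f \<cdot> h) p"
proof -
  obtain s g where s: "s \<in> p" and "g \<in> Hom C (Dom C f) (Dom C s \<otimes> Cod C f)"
    and f: "f = act C s (Cod C f) \<cdot> g"
    using assms(1) unfolding restricts_def by blast
  then have g: "g \<in> Arr C" "Dom C g = Dom C f" "Cod C g = Dom C s \<otimes> Cod C f" by simp_all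
  note [simp] = ISub_member_typing[OF assms(2) s] assms(3-5) g
  have "f \<cdot> h = (act C s (Cod C f) \<cdot> g) \<cdot> h" using f by (rule arg_cong)
  also have "\<dots> = act C s (Cod C f) \<cdot> g \<cdot> h" by (rule assoc_comp) simp_all
  finally have "f \<cdot> h = act C s (Cod C (f \<cdot> h)) \<cdot> g \<cdot> h" by simp
  then show ?thesis
    unfolding restricts_def by (intro bexI[OF _ s] bexI[of _ "g \<cdot> h"]) simp_all
qed

lemma bracket_simps:
  "A \<in> Obj C \<Longrightarrow> PObj (bracket C U X) A
    = ArrE ` {f. f \<in> Arr C \<and> Dom C f = A \<and> Cod C f = X \<and> (\<exists>p \<in> U. restricts C f p)}"
  "\<lbrakk>h \<in> Arr C; f \<in> Arr C; Dom C f = Cod C h; Cod C f = X; p \<in> U; restricts C f p\<rbrakk>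
    \<Longrightarrow> PMap (bracket C U X) h (ArrE f) = ArrE (f \<cdot> h)"
  by (auto simp: bracket_def)

lemma bracket_presheaf:
  assumes "U \<subseteq> carrier (ISub C)" "X \<in> Obj C"
  shows "is_presheaf C (bracket C U X)"
  unfolding bracket_def
proof (rule presheafI)
  fix h e assume h: "h \<in> Arr C" and "e \<in> ArrE ` {f \<in> Hom C (Cod C h) X. \<exists>p \<in> U. restricts C f p}"
  then obtain f p where f: "f \<in> Arr C" "Dom C f = Cod C h" "Cod C f = X" "p \<in> U" "restricts C f p"
    and e: "e = ArrE f" by auto
  have "restricts C (f \<cdot> h) p" by (rule restricts_precomp) (use f h assms in auto)
  then show "ArrE (un_arr e \<cdot> h) \<in> ArrE ` {f \<in> Hom C (Dom C h) X. \<exists>p \<in> U. restricts C f p}"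
    using f h by (auto simp: e)
qed auto

text \<open>Every arrow restricts to the top subunit, so the representable presheaves are broad.\<close>

lemma restricts_top:
  assumes [simp]: "f \<in> Arr C"
  shows "restricts C f (subobj C (Id C (TUnit C)))"
proof -
  have unit: "act C (Id C (TUnit C)) (Cod C f) = Lunit C (Cod C f)" by (simp add: act_def)
  obtain k where [simp]: "k \<in> Arr C" "Dom C k = Cod C f" "Cod C k = TUnit C \<otimes> Cod C f"
    and k: "Lunit C (Cod C f) \<cdot> k = Id C (Cod C f)"
    using isoE[OF lunit_iso[OF cod_obj[OF assms]]] by auto
  have "f = (Lunit C (Cod C f) \<cdot> k) \<cdot> f" by (simp only: k) simp
  also have "\<dots> = act C (Id C (TUnit C)) (Cod C f) \<cdot> k \<cdot> f" unfolding unit by simp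
  finally have "sub_le C f (act C (Id C (TUnit C)) (Cod C f))" by (rule sub_leI) simp_all
  then show ?thesis
    using restricts_iff_sub_le[OF subobj_subunit(1)[OF top_subunit] assms]
      subobj_subunit(2)[OF top_subunit] by blast
qed

lemma representable_eq_bracket: "representable C X = bracket C {subobj C (Id C (TUnit C))} X"
proof -
  have "{f \<in> Hom C A X. \<exists>p \<in> {subobj C (Id C (TUnit C))}. restricts C f p} = Hom C A X" for A
    using restricts_top by auto
  then show ?thesis by (simp add: representable_def bracket_def)
qed

text \<open>A class in the convolution of two sieves can be represented by a pair of subunits.\<close>

lemma sieve_day_representative:
  assumes U: "U \<subseteq> carrier (ISub C)" and V: "V \<subseteq> carrier (ISub C)"
    and z: "z \<in> day_pre C (sieve U) (sieve V) A"
  obtains s t g p q where "p \<in> U" "s \<in> p" "q \<in> V" "t \<in> q"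
    "g \<in> Arr C" "Dom C g = A" "Cod C g = Dom C s \<otimes> Dom C t"
    "(z, (Dom C s, Dom C t, g, ArrE s, ArrE t)) \<in> day_eq C (sieve U) (sieve V) A"
    "day_mult C z = (Lunit C (TUnit C) \<cdot> (s \<boxtimes> t)) \<cdot> g"
proof -
  obtain B B' f x y p q where z_eq: "z = (B, B', f, ArrE x, ArrE y)"
    and [simp]: "B \<in> Obj C" "B' \<in> Obj C" "f \<in> Arr C" "Dom C f = A" "Cod C f = B \<otimes> B'"
      "x \<in> Arr C" "Dom C x = B" "Cod C x = TUnit C" "y \<in> Arr C" "Dom C y = B'" "Cod C y = TUnit C"
    and p: "p \<in> U" "restricts C x p" and q: "q \<in> V" "restricts C y q"
    using z by (cases z) (auto simp: bracket_simps)
  have pq: "p \<in> carrier (ISub C)" "q \<in> carrier (ISub C)" using U V p q by auto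
  obtain s t where s: "s \<in> p" and t: "t \<in> q" using pq ISub_nonempty by metis
  note [simp] = ISub_member_typing[OF pq(1) s] ISub_member_typing[OF pq(2) t]
  obtain x' where [simp]: "x' \<in> Arr C" "Dom C x' = B" "Cod C x' = Dom C s" and x': "s \<cdot> x' = x"
    using p(2) restricts_unit_iff[OF pq(1) s] sub_leE[of x s] by auto
  obtain y' where [simp]: "y' \<in> Arr C" "Dom C y' = B'" "Cod C y' = Dom C t" and y': "t \<cdot> y' = y"
    using q(2) restricts_unit_iff[OF pq(2) t] sub_leE[of y t] by auto
  let ?g = "(x' \<boxtimes> y') \<cdot> f"
  have rs: "restricts C s p" "restricts C t q"
    using restricts_unit_iff[OF pq(1) s] restricts_unit_iff[OF pq(2) t] sub_le_refl by simp_all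
  have "((Dom C x', Dom C y', f, PMap (sieve U) x' (ArrE s), PMap (sieve V) y' (ArrE t)),
      (Cod C x', Cod C y', (x' \<boxtimes> y') \<cdot> f, ArrE s, ArrE t)) \<in> day_step C (sieve U) (sieve V) A"
    by (rule day_stepI) (use p(1) q(1) rs in \<open>auto simp: bracket_simps\<close>)
  then have "(z, (Dom C s, Dom C t, ?g, ArrE s, ArrE t)) \<in> day_eq C (sieve U) (sieve V) A"
    by (intro day_eq_step) (simp add: z_eq x' y' p(1) q(1) rs
      bracket_simps(2)[of x' s "TUnit C" p U] bracket_simps(2)[of y' t "TUnit C" q V])
  moreover have "day_mult C z = (Lunit C (TUnit C) \<cdot> (s \<boxtimes> t)) \<cdot> ?g"
    by (simp add: day_mult_def z_eq x' y')
  ultimately show ?thesis by (intro that[OF p(1) s q(1) t, of ?g]) simp_all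
qed

text \<open>Since \<open>s \<otimes> t\<close> is monic, a representative may be replaced by one over smaller subunits as soon
  as both have the same product.\<close>

lemma sieve_day_refine:
  assumes U: "U \<subseteq> carrier (ISub C)" and V: "V \<subseteq> carrier (ISub C)"
    and p: "p \<in> U" "s \<in> p" and q: "q \<in> V" "t \<in> q"
    and g: "g \<in> Arr C" "Dom C g = A" "Cod C g = Dom C s \<otimes> Dom C t"
    and \<sigma>: "subunit C \<sigma>" "sub_le C \<sigma> s" and \<tau>: "subunit C \<tau>" "sub_le C \<tau> t"
    and h: "h \<in> Arr C" "Dom C h = A" "Cod C h = Dom C \<sigma> \<otimes> Dom C \<tau>"
    and eq: "(Lunit C (TUnit C) \<cdot> (s \<boxtimes> t)) \<cdot> g = (Lunit C (TUnit C) \<cdot> (\<sigma> \<boxtimes> \<tau>)) \<cdot> h"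
  shows "((Dom C s, Dom C t, g, ArrE s, ArrE t), (Dom C \<sigma>, Dom C \<tau>, h, ArrE \<sigma>, ArrE \<tau>))
    \<in> day_eq C (sieve U) (sieve V) A"
proof -
  have pq: "p \<in> carrier (ISub C)" "q \<in> carrier (ISub C)" using U V p q by auto
  note st = ISub_member(1)[OF pq(1) p(2)] ISub_member(1)[OF pq(2) q(2)]
  note [simp] = subunitD(2,3)[OF st(1)] subunitD(2,3)[OF st(2)] subunitD(2,3)[OF \<sigma>(1)]
    subunitD(2,3)[OF \<tau>(1)] g h
  obtain a where [simp]: "a \<in> Arr C" "Dom C a = Dom C \<sigma>" "Cod C a = Dom C s" and a: "s \<cdot> a = \<sigma>"
    using \<sigma>(2) by (rule sub_leE) simp_all
  obtain b where [simp]: "b \<in> Arr C" "Dom C b = Dom C \<tau>" "Cod C b = Dom C t" and b: "t \<cdot> b = \<tau>"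
    using \<tau>(2) by (rule sub_leE) simp_all
  have "(Lunit C (TUnit C) \<cdot> (s \<boxtimes> t)) \<cdot> (a \<boxtimes> b) \<cdot> h = (Lunit C (TUnit C) \<cdot> (\<sigma> \<boxtimes> \<tau>)) \<cdot> h"
    by (simp add: a b)
  then have "(Lunit C (TUnit C) \<cdot> (s \<boxtimes> t)) \<cdot> (a \<boxtimes> b) \<cdot> h = (Lunit C (TUnit C) \<cdot> (s \<boxtimes> t)) \<cdot> g"
    by (simp only: eq)
  then have abh: "(a \<boxtimes> b) \<cdot> h = g"
    by (rule mono_cancel[OF subunitD(1)[OF tensor_subunit(1)[OF st]]]) simp_all
  have rs: "restricts C s p" "restricts C t q"
    using restricts_unit_iff[OF pq(1) p(2)] restricts_unit_iff[OF pq(2) q(2)] sub_le_refl by simp_all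
  have "((Dom C a, Dom C b, h, PMap (sieve U) a (ArrE s), PMap (sieve V) b (ArrE t)),
      (Cod C a, Cod C b, (a \<boxtimes> b) \<cdot> h, ArrE s, ArrE t)) \<in> day_step C (sieve U) (sieve V) A"
    by (rule day_stepI) (use p(1) q(1) rs in \<open>auto simp: bracket_simps\<close>)
  then have "((Dom C \<sigma>, Dom C \<tau>, h, ArrE \<sigma>, ArrE \<tau>), (Dom C s, Dom C t, g, ArrE s, ArrE t))
      \<in> day_eq C (sieve U) (sieve V) A"
    by (intro day_eq_step) (simp add: a b abh p(1) q(1) rs
      bracket_simps(2)[of a s "TUnit C" p U] bracket_simps(2)[of b t "TUnit C" q V])
  then show ?thesis by (rule day_eq_sym)
qed

text \<open>Multiplication embeds the convolution of two sieves into the unit. Two representatives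
  with the same product factor through the tensor product of all four subunits involved, since
  tensor products of subunits are intersections; refining both to it identifies them.\<close>

lemma day_mult_eq_iff:
  assumes U: "U \<subseteq> carrier (ISub C)" and V: "V \<subseteq> carrier (ISub C)"
    and z: "z \<in> day_pre C (sieve U) (sieve V) A" and w: "w \<in> day_pre C (sieve U) (sieve V) A"
  shows "day_mult C z = day_mult C w \<longleftrightarrow> (z, w) \<in> day_eq C (sieve U) (sieve V) A"
proof
  assume "(z, w) \<in> day_eq C (sieve U) (sieve V) A"
  then show "day_mult C z = day_mult C w"
  proof (rule day_eq_invariant)
    fix z w assume "(z, w) \<in> day_step C (sieve U) (sieve V) A"
    then show "day_mult C z = day_mult C w"
    proof (rule day_stepE)
      fix b b' f x y
      assume [simp]: "b \<in> Arr C" "b' \<in> Arr C" "f \<in> Arr C" "Dom C f = A"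
          "Cod C f = Dom C b \<otimes> Dom C b'"
        and x: "x \<in> PObj (sieve U) (Cod C b)" and y: "y \<in> PObj (sieve V) (Cod C b')"
        and zw: "z = (Dom C b, Dom C b', f, PMap (sieve U) b x, PMap (sieve V) b' y)"
          "w = (Cod C b, Cod C b', (b \<boxtimes> b') \<cdot> f, x, y)"
      obtain x' p where [simp]: "x' \<in> Arr C" "Dom C x' = Cod C b" "Cod C x' = TUnit C"
        and p: "p \<in> U" "restricts C x' p" and xx: "x = ArrE x'"
        using x by (auto simp: bracket_simps)
      obtain y' q where [simp]: "y' \<in> Arr C" "Dom C y' = Cod C b'" "Cod C y' = TUnit C"
        and q: "q \<in> V" "restricts C y' q" and yy: "y = ArrE y'"
        using y by (auto simp: bracket_simps)
      show "day_mult C z = day_mult C w"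
        by (simp add: zw xx yy day_mult_def p q
          bracket_simps(2)[of b x' "TUnit C" p U] bracket_simps(2)[of b' y' "TUnit C" q V])
    qed
  qed
next
  assume eq: "day_mult C z = day_mult C w"
  let ?I = "TUnit C"
  let ?m = "\<lambda>s t. Lunit C ?I \<cdot> (s \<boxtimes> t)"
  obtain s t g p q where st: "p \<in> U" "s \<in> p" "q \<in> V" "t \<in> q"
    and g: "g \<in> Arr C" "Dom C g = A" "Cod C g = Dom C s \<otimes> Dom C t"
    and z': "(z, (Dom C s, Dom C t, g, ArrE s, ArrE t)) \<in> day_eq C (sieve U) (sieve V) A"
    and mz: "day_mult C z = ?m s t \<cdot> g"
    using U V z by (rule sieve_day_representative)
  obtain s' t' g' p' q' where st': "p' \<in> U" "s' \<in> p'" "q' \<in> V" "t' \<in> q'"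
    and g': "g' \<in> Arr C" "Dom C g' = A" "Cod C g' = Dom C s' \<otimes> Dom C t'"
    and w': "(w, (Dom C s', Dom C t', g', ArrE s', ArrE t')) \<in> day_eq C (sieve U) (sieve V) A"
    and mw: "day_mult C w = ?m s' t' \<cdot> g'"
    using U V w by (rule sieve_day_representative)
  have su: "subunit C s" "subunit C t" "subunit C s'" "subunit C t'"
    using ISub_member(1) U V st st' by blast+
  note [simp] = subunitD(2,3)[OF su(1)] subunitD(2,3)[OF su(2)] subunitD(2,3)[OF su(3)] subunitD(2,3)[OF su(4)]
  \<comment> \<open>the intersections of the two left and of the two right subunits\<close>
  let ?\<sigma> = "?m s s'" and ?\<tau> = "?m t t'"
  have \<sigma>: "subunit C ?\<sigma>" and \<tau>: "subunit C ?\<tau>" using tensor_subunit(1) su by blast+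
  have \<sigma>_le: "sub_le C ?\<sigma> s" "sub_le C ?\<sigma> s'"
    using sub_le_tensor_iff[OF su(1,3) subunitD(2)[OF \<sigma>]] sub_le_refl[OF subunitD(2)[OF \<sigma>]] by blast+
  have \<tau>_le: "sub_le C ?\<tau> t" "sub_le C ?\<tau> t'"
    using sub_le_tensor_iff[OF su(2,4) subunitD(2)[OF \<tau>]] sub_le_refl[OF subunitD(2)[OF \<tau>]] by blast+
  define e where "e = ?m s t \<cdot> g"
  have e': "e = ?m s' t' \<cdot> g'" using eq mz mw by (simp only: e_def)
  have [simp]: "e \<in> Arr C" "Dom C e = A" using g by (simp_all add: e_def)
  have "sub_le C e (?m s t)" unfolding e_def by (rule sub_le_precomp) (use g in simp_all)
  moreover have "sub_le C e (?m s' t')" unfolding e' by (rule sub_le_precomp) (use g' in simp_all)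
  ultimately have "sub_le C e (?m ?\<sigma> ?\<tau>)"
    using sub_le_tensor_iff[OF su(1,2), of e] sub_le_tensor_iff[OF su(3,4), of e]
      sub_le_tensor_iff[OF su(1,3), of e] sub_le_tensor_iff[OF su(2,4), of e] sub_le_tensor_iff[OF \<sigma> \<tau>, of e]
    by (simp only: \<open>e \<in> Arr C\<close>)
  then obtain h where h: "h \<in> Arr C" "Dom C h = A" "Cod C h = Dom C ?\<sigma> \<otimes> Dom C ?\<tau>" and he: "?m ?\<sigma> ?\<tau> \<cdot> h = e"
    by (rule sub_leE) (simp_all add: subunitD[OF \<sigma>] subunitD[OF \<tau>])
  let ?v = "(Dom C ?\<sigma>, Dom C ?\<tau>, h, ArrE ?\<sigma>, ArrE ?\<tau>)"
  have "((Dom C s, Dom C t, g, ArrE s, ArrE t), ?v) \<in> day_eq C (sieve U) (sieve V) A"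
    by (rule sieve_day_refine[OF U V st g \<sigma> \<sigma>_le(1) \<tau> \<tau>_le(1) h]) (simp only: he e_def)
  moreover have "((Dom C s', Dom C t', g', ArrE s', ArrE t'), ?v) \<in> day_eq C (sieve U) (sieve V) A"
    by (rule sieve_day_refine[OF U V st' g' \<sigma> \<sigma>_le(2) \<tau> \<tau>_le(2) h]) (simp only: he e')
  ultimately show "(z, w) \<in> day_eq C (sieve U) (sieve V) A"
    using z' w' day_eq_sym day_eq_trans by metis
qed

text \<open>The image is an intersection because factoring through \<open>s \<otimes> t\<close> means factoring through both \<open>s\<close>
  and \<open>t\<close>.\<close>

lemma day_mult_image:
  assumes U: "U \<subseteq> carrier (ISub C)" and V: "V \<subseteq> carrier (ISub C)" and A: "A \<in> Obj C"
  shows "(\<lambda>z. ArrE (day_mult C z)) ` day_pre C (sieve U :: ('o, 'a, ('x, 'o, 'a) elt) presheaf) (sieve V) A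
    = PObj (sieve U) A \<inter> (PObj (sieve V) A :: ('x, 'o, 'a) elt set)"
proof (intro equalityI subsetI)
  fix e :: "('x, 'o, 'a) elt"
  assume "e \<in> (\<lambda>z. ArrE (day_mult C z))
    ` day_pre C (sieve U :: ('o, 'a, ('x, 'o, 'a) elt) presheaf) (sieve V) A"
  then obtain z where z: "z \<in> day_pre C (sieve U :: ('o, 'a, ('x, 'o, 'a) elt) presheaf) (sieve V) A"
    and e: "e = ArrE (day_mult C z)" by blast
  obtain s t g p q where st: "p \<in> U" "s \<in> p" "q \<in> V" "t \<in> q"
    and [simp]: "g \<in> Arr C" "Dom C g = A" "Cod C g = Dom C s \<otimes> Dom C t"
    and mz: "day_mult C z = (Lunit C (TUnit C) \<cdot> (s \<boxtimes> t)) \<cdot> g"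
    using U V z by (rule sieve_day_representative)
  have pq: "p \<in> carrier (ISub C)" "q \<in> carrier (ISub C)" using U V st by auto
  note su = ISub_member(1)[OF pq(1) st(2)] ISub_member(1)[OF pq(2) st(4)]
  note [simp] = subunitD(2,3)[OF su(1)] subunitD(2,3)[OF su(2)]
  let ?f = "(Lunit C (TUnit C) \<cdot> (s \<boxtimes> t)) \<cdot> g"
  have "sub_le C ?f (Lunit C (TUnit C) \<cdot> (s \<boxtimes> t))" by (rule sub_le_precomp) simp_all
  then have "restricts C ?f p \<and> restricts C ?f q"
    using sub_le_tensor_iff[OF su, of ?f] restricts_unit_iff[OF pq(1) st(2), of ?f]
      restricts_unit_iff[OF pq(2) st(4), of ?f] by simp
  moreover have "?f \<in> Arr C" "Dom C ?f = A" "Cod C ?f = TUnit C" by simp_all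
  ultimately show "e \<in> PObj (sieve U) A \<inter> PObj (sieve V) A"
    unfolding e mz bracket_simps(1)[OF A] using st(1,3) by blast
next
  fix e :: "('x, 'o, 'a) elt"
  assume "e \<in> PObj (sieve U) A \<inter> PObj (sieve V) A"
  then obtain f p q where [simp]: "f \<in> Arr C" "Dom C f = A" "Cod C f = TUnit C"
    and p: "p \<in> U" "restricts C f p" and q: "q \<in> V" "restricts C f q" and e: "e = ArrE f"
    using A by (auto simp: bracket_simps)
  have pq: "p \<in> carrier (ISub C)" "q \<in> carrier (ISub C)" using U V p q by auto
  obtain s t where s: "s \<in> p" and t: "t \<in> q" using pq ISub_nonempty by metis
  note su = ISub_member(1)[OF pq(1) s] ISub_member(1)[OF pq(2) t]
  note [simp] = subunitD(2,3)[OF su(1)] subunitD(2,3)[OF su(2)]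
  have "sub_le C f (Lunit C (TUnit C) \<cdot> (s \<boxtimes> t))"
    using sub_le_tensor_iff[OF su, of f] restricts_unit_iff[OF pq(1) s, of f]
      restricts_unit_iff[OF pq(2) t, of f] p(2) q(2) by simp
  then obtain g where g: "g \<in> Arr C" "Dom C g = A" "Cod C g = Dom C s \<otimes> Dom C t"
    and gf: "(Lunit C (TUnit C) \<cdot> (s \<boxtimes> t)) \<cdot> g = f"
    by (rule sub_leE) simp_all
  have rs: "restricts C s p" "restricts C t q"
    using restricts_unit_iff[OF pq(1) s] restricts_unit_iff[OF pq(2) t] sub_le_refl by simp_all
  let ?z = "(Dom C s, Dom C t, g, ArrE s, ArrE t)"
  have "?z \<in> day_pre C (sieve U) (sieve V) A" using g p(1) q(1) rs by (auto simp: bracket_simps)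
  moreover have "e = ArrE (day_mult C ?z)" using gf g by (simp add: day_mult_def e)
  ultimately show "e \<in> (\<lambda>z. ArrE (day_mult C z))
      ` day_pre C (sieve U :: ('o, 'a, ('x, 'o, 'a) elt) presheaf) (sieve V) A" by blast
qed

section \<open>Sieves of subunits are subunits\<close>

lemma isomorphic_PSh:
  fixes n :: "('o, 'a, ('x, 'o, 'a) elt) nat_trans"
  assumes "is_nat_trans C n" "NDom n = F" "NCod n = G"
    and "\<And>A. A \<in> Obj C \<Longrightarrow> bij_betw (NMap n A) (PObj F A) (PObj G A)"
  shows "isomorphic (PSh C) F G"
  unfolding isomorphic_def Hom_def
  using iso_PSh_iff[OF assms(1), of "\<lambda>_. True"] assms by (auto simp: full_sub_True)

lemma broad_bracket:
  assumes "U \<subseteq> carrier (ISub C)" "Q U" "X \<in> Obj C"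
  shows "broad_wrt C Q (bracket C U X :: ('o, 'a, ('x, 'o, 'a) elt) presheaf)"
proof -
  have "isomorphic (PSh C) (bracket C U X :: ('o, 'a, ('x, 'o, 'a) elt) presheaf) (bracket C U X)"
    by (rule isomorphic_PSh[of "nat_id C (bracket C U X)"])
      (use bracket_presheaf[OF assms(1,3)] nat_id_trans in \<open>auto simp: bij_betw_def inj_on_def\<close>)
  then show ?thesis unfolding broad_wrt_def using assms by blast
qed

lemma broad_representable:
  assumes "Q {subobj C (Id C (TUnit C))}" "X \<in> Obj C"
  shows "broad_wrt C Q (representable C X :: ('o, 'a, ('x, 'o, 'a) elt) presheaf)"
  unfolding representable_eq_bracket
  by (rule broad_bracket) (use assms subobj_subunit(1)[OF top_subunit] in simp_all)

text \<open>The case of interest is \<open>V = W = U\<close>, and \<open>C(-, I)\<close> in place of the first factor: a sieve absorbs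
  itself and the unit, so both ends of the idempotence map are broad of the same kind.\<close>

lemma broad_day:
  fixes W :: "'a set set"
  assumes U: "U \<subseteq> carrier (ISub C)" and V: "V \<subseteq> carrier (ISub C)" and W: "W \<subseteq> carrier (ISub C)" "Q W"
    and eq: "\<And>A. A \<in> Obj C \<Longrightarrow> PObj (sieve U) A \<inter> PObj (sieve V) A = (PObj (sieve W) A :: ('x, 'o, 'a) elt set)"
  shows "broad_wrt C Q (day C (sieve U) (sieve V) :: ('o, 'a, ('x, 'o, 'a) elt) presheaf)"
proof -
  let ?F = "sieve U :: ('o, 'a, ('x, 'o, 'a) elt) presheaf" and ?G = "sieve V :: ('o, 'a, ('x, 'o, 'a) elt) presheaf"
  let ?W = "sieve W :: ('o, 'a, ('x, 'o, 'a) elt) presheaf"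
  let ?\<mu> = "\<lambda>A e. ArrE (day_mult C (un_day e)) :: ('x, 'o, 'a) elt"
  have F: "is_presheaf C ?F" and G: "is_presheaf C ?G" and W': "is_presheaf C ?W"
    by (simp_all add: bracket_presheaf U V W)
  have un: "un_day (day_elt C ?F ?G A z) \<in> day_pre C ?F ?G A"
    "day_mult C (un_day (day_elt C ?F ?G A z)) = day_mult C z" if "z \<in> day_pre C ?F ?G A" for A z
  proof -
    show *: "un_day (day_elt C ?F ?G A z) \<in> day_pre C ?F ?G A"
      using day_eq_pre[OF F G un_day_elt, of z A] that by simp
    show "day_mult C (un_day (day_elt C ?F ?G A z)) = day_mult C z"
      using day_mult_eq_iff[OF U V that *] un_day_elt[of z C ?F ?G A] by simp
  qed
  have img: "?\<mu> A ` PObj (day C ?F ?G) A = PObj ?W A" if A: "A \<in> Obj C" for A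
  proof -
    have "?\<mu> A ` PObj (day C ?F ?G) A = (\<lambda>z. ArrE (day_mult C z)) ` day_pre C ?F ?G A"
      unfolding day_PObj[OF A] image_image using un(2) by (intro image_cong refl) simp
    then show ?thesis using day_mult_image[OF U V A, where 'x = 'x] eq[OF A] by simp
  qed
  have trans: "is_nat_trans C (nat_of C (day C ?F ?G) ?W ?\<mu>)"
  proof (rule nat_ofI)
    fix A e assume "A \<in> Obj C" "e \<in> PObj (day C ?F ?G) A"
    then show "?\<mu> A e \<in> PObj ?W A" using img by blast
  next
    fix h e assume h: "h \<in> Arr C" and "e \<in> PObj (day C ?F ?G) (Cod C h)"
    then obtain B B' f x y where z: "(B, B', f, x, y) \<in> day_pre C ?F ?G (Cod C h)"
      and e: "e = day_elt C ?F ?G (Cod C h) (B, B', f, x, y)" by (auto simp: day_PObj)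
    have z': "(B, B', f \<cdot> h, x, y) \<in> day_pre C ?F ?G (Dom C h)" using z h by simp
    have "ArrE (day_mult C (B, B', f, x, y)) \<in> PObj ?W (Cod C h)"
      using day_mult_image[OF U V cod_obj[OF h], where 'x = 'x] eq[OF cod_obj[OF h]] imageI[OF z] by metis
    then have "PMap ?W h (ArrE (day_mult C (B, B', f, x, y))) = ArrE (day_mult C (B, B', f, x, y) \<cdot> h)"
      using h bracket_simps(2)[OF h] by (auto simp: bracket_simps(1))
    also have "day_mult C (B, B', f, x, y) \<cdot> h = day_mult C (B, B', f \<cdot> h, x, y)"
      using z h by (auto simp: day_mult_def bracket_simps(1))
    finally show "?\<mu> (Dom C h) (PMap (day C ?F ?G) h e) = PMap ?W h (?\<mu> (Cod C h) e)"
      unfolding e day_PMap[OF h z] un(2)[OF z] un(2)[OF z'] ..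
  qed (use day_presheaf F G W' in simp_all)
  have "isomorphic (PSh C) (day C ?F ?G) ?W"
  proof (rule isomorphic_PSh[OF trans])
    fix A assume A: "A \<in> Obj C"
    have "inj_on (?\<mu> A) (PObj (day C ?F ?G) A)"
      unfolding day_PObj[OF A]
    proof (rule inj_onI, elim imageE)
      fix e e' z w
      assume z: "z \<in> day_pre C ?F ?G A" "e = day_elt C ?F ?G A z"
        and w: "w \<in> day_pre C ?F ?G A" "e' = day_elt C ?F ?G A w" and "?\<mu> A e = ?\<mu> A e'"
      then have "day_mult C z = day_mult C w" using un(2) by simp
      then show "e = e'" using day_mult_eq_iff[OF U V z(1) w(1)] by (simp add: z w day_elt_eq_iff)
    qed
    then have "bij_betw (?\<mu> A) (PObj (day C ?F ?G) A) (PObj ?W A)" using img[OF A] by (simp add: bij_betw_def)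
    then show "bij_betw (NMap (nat_of C (day C ?F ?G) ?W ?\<mu>) A) (PObj (day C ?F ?G) A) (PObj ?W A)"
      using A by (simp cong: bij_betw_cong)
  qed simp_all
  then show ?thesis unfolding broad_wrt_def using W unit_obj by blast
qed

lemma bracket_incl_trans:
  assumes U: "U \<subseteq> carrier (ISub C)"
  shows "is_nat_trans C (bracket_incl C U :: ('o, 'a, ('x, 'o, 'a) elt) nat_trans)"
    and "NDom (bracket_incl C U :: ('o, 'a, ('x, 'o, 'a) elt) nat_trans) = sieve U"
    and "NCod (bracket_incl C U :: ('o, 'a, ('x, 'o, 'a) elt) nat_trans) = representable C (TUnit C)"
    and "\<lbrakk>A \<in> Obj C; x \<in> PObj (sieve U) A\<rbrakk> \<Longrightarrow> NMap (bracket_incl C U) A x = (x :: ('x, 'o, 'a) elt)"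
proof -
  let ?F = "sieve U :: ('o, 'a, ('x, 'o, 'a) elt) presheaf"
  have eq: "bracket_incl C U = nat_of C ?F (representable C (TUnit C)) (\<lambda>A x. x)"
    by (simp add: bracket_incl_def nat_of_def)
  have "is_nat_trans C (nat_of C ?F (representable C (TUnit C)) (\<lambda>A x. x))"
  proof (rule nat_ofI)
    fix A x assume "A \<in> Obj C" "x \<in> PObj ?F A"
    then show "x \<in> PObj (representable C (TUnit C)) A" by (auto simp: bracket_simps)
  next
    fix f x assume "f \<in> Arr C" "x \<in> PObj ?F (Cod C f)"
    then show "PMap ?F f x = PMap (representable C (TUnit C)) f x"
      using bracket_simps(2)[of f] by (auto simp: bracket_simps(1))
  qed (simp_all add: bracket_presheaf[OF U] representable_presheaf)
  then show "is_nat_trans C (bracket_incl C U :: ('o, 'a, ('x, 'o, 'a) elt) nat_trans)" by (simp add: eq)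
  show "NDom (bracket_incl C U :: ('o, 'a, ('x, 'o, 'a) elt) nat_trans) = sieve U"
    "NCod (bracket_incl C U :: ('o, 'a, ('x, 'o, 'a) elt) nat_trans) = representable C (TUnit C)"
    by (simp_all add: eq)
  show "\<lbrakk>A \<in> Obj C; x \<in> PObj (sieve U) A\<rbrakk> \<Longrightarrow> NMap (bracket_incl C U) A x = (x :: ('x, 'o, 'a) elt)"
    by (simp add: eq)
qed

text \<open>Both \<open>F \<otimes> F\<close> and \<open>C(-, I) \<otimes> F\<close> embed into \<open>C(-, I)\<close> by multiplication with image \<open>F\<close>, and the
  idempotence map commutes with these embeddings.\<close>

lemma bracket_incl_subunit:
  assumes U: "U \<subseteq> carrier (ISub C)" "Q U" and top: "Q {subobj C (Id C (TUnit C))}"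
  shows "subunit (full_sub (PSh C) (broad_wrt C Q)) (bracket_incl C U :: ('o, 'a, ('x, 'o, 'a) elt) nat_trans)"
proof -
  let ?D = "full_sub (PSh C) (broad_wrt C Q) :: ('x, 'o, 'a) psh_cat"
  let ?F = "sieve U :: ('o, 'a, ('x, 'o, 'a) elt) presheaf" and ?I = "representable C (TUnit C) :: ('o, 'a, ('x, 'o, 'a) elt) presheaf"
  let ?n = "bracket_incl C U :: ('o, 'a, ('x, 'o, 'a) elt) nat_trans"
  let ?T = "{subobj C (Id C (TUnit C))}"
  note n = bracket_incl_trans[OF U(1), where 'x = 'x]
  have T: "?T \<subseteq> carrier (ISub C)" using subobj_subunit(1)[OF top_subunit] by simp
  have I: "?I = sieve ?T" by (rule representable_eq_bracket)
  have F: "is_presheaf C ?F" by (simp add: bracket_presheaf U)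
  have sub: "PObj ?F A \<subseteq> PObj ?I A" if "A \<in> Obj C" for A
    using that by (auto simp: bracket_simps(1))
  have "is_mono ?D ?n"
    using mono_PSh_iff[OF n(1), of "broad_wrt C Q"] n(2-4)
    by (simp add: inj_on_def broad_bracket[where Q = Q, OF U] broad_representable[where Q = Q, OF top])
  moreover have "Cod ?D ?n = TUnit ?D" by (simp add: n)
  moreover have "is_iso ?D (?n \<boxtimes>\<^bsub>?D\<^esub> Id ?D (Dom ?D ?n))"
  proof -
    let ?m = "day_map C ?n (nat_id C ?F)"
    note id = nat_id_trans[OF F]
    have m: "is_nat_trans C ?m" "NDom ?m = day C ?F ?F" "NCod ?m = day C ?I ?F"
      using day_map_trans[OF n(1) id] n(2,3) by simp_all
    have "broad_wrt C Q (day C ?F ?F)" by (rule broad_day[where Q = Q, OF U(1) U(1) U]) simp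
    moreover have "broad_wrt C Q (day C ?I ?F)"
      unfolding I by (rule broad_day[where Q = Q, OF T U(1) U]) (use sub I in auto)
    moreover have "bij_betw (NMap ?m A) (PObj (day C ?F ?F) A) (PObj (day C ?I ?F) A)" if A: "A \<in> Obj C" for A
    proof -
      have pre: "day_pre C ?F ?F A \<subseteq> day_pre C ?I ?F A"
        using sub unfolding day_pre_def by blast
      have iff: "day_elt C ?I ?F A z = day_elt C ?I ?F A w \<longleftrightarrow> day_mult C z = day_mult C w"
        if "z \<in> day_pre C ?I ?F A" "w \<in> day_pre C ?I ?F A" for z w
        unfolding day_elt_eq_iff unfolding I
        by (rule day_mult_eq_iff[OF T U(1), symmetric]) (use that in \<open>simp_all only: I\<close>)
      have app: "NMap ?m A (day_elt C ?F ?F A z) = day_elt C ?I ?F A z" if z: "z \<in> day_pre C ?F ?F A" for z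
      proof -
        obtain B B' f x y where [simp]: "z = (B, B', f, x, y)" by (cases z)
        show ?thesis using day_map_elt[OF n(1) id A, of B B' f x y] z n(2-4) by simp
      qed
      have inj: "day_elt C ?F ?F A z = day_elt C ?F ?F A w"
        if "z \<in> day_pre C ?F ?F A" "w \<in> day_pre C ?F ?F A" "day_elt C ?I ?F A z = day_elt C ?I ?F A w" for z w
        using that iff[of z w] pre day_mult_eq_iff[OF U(1) U(1) that(1,2)]
        by (simp add: day_elt_eq_iff subsetD)
      have surj: "day_elt C ?I ?F A w \<in> day_elt C ?I ?F A ` day_pre C ?F ?F A" if w: "w \<in> day_pre C ?I ?F A" for w
      proof -
        have "(ArrE (day_mult C w) :: ('x, 'o, 'a) elt) \<in> (\<lambda>z. ArrE (day_mult C z)) ` day_pre C ?I ?F A"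
          using w by (rule imageI)
        then have "ArrE (day_mult C w) \<in> PObj ?I A \<inter> PObj ?F A"
          unfolding I day_mult_image[OF T U(1) A, where 'x = 'x] .
        then have "ArrE (day_mult C w) \<in> (\<lambda>z. ArrE (day_mult C z)) ` day_pre C ?F ?F A"
          using day_mult_image[OF U(1) U(1) A, where 'x = 'x] by blast
        then obtain z where z: "z \<in> day_pre C ?F ?F A" "day_mult C z = day_mult C w" by auto
        then have "day_elt C ?I ?F A z = day_elt C ?I ?F A w"
          using iff[OF subsetD[OF pre] w] by blast
        with imageI[OF z(1), of "day_elt C ?I ?F A"] show ?thesis by simp
      qed
      show ?thesis
        unfolding day_PObj[OF A] bij_betw_def
      proof
        show "inj_on (NMap ?m A) (day_elt C ?F ?F A ` day_pre C ?F ?F A)"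
        proof (rule inj_onI, elim imageE)
          fix e e' z w
          assume z: "z \<in> day_pre C ?F ?F A" "e = day_elt C ?F ?F A z"
            and w: "w \<in> day_pre C ?F ?F A" "e' = day_elt C ?F ?F A w" and "NMap ?m A e = NMap ?m A e'"
          then show "e = e'" using inj[OF z(1) w(1)] app[OF z(1)] app[OF w(1)] by simp
        qed
        show "NMap ?m A ` day_elt C ?F ?F A ` day_pre C ?F ?F A = day_elt C ?I ?F A ` day_pre C ?I ?F A"
        proof -
          have "NMap ?m A ` day_elt C ?F ?F A ` day_pre C ?F ?F A = day_elt C ?I ?F A ` day_pre C ?F ?F A"
            unfolding image_image by (rule image_cong[OF refl app])
          also have "\<dots> = day_elt C ?I ?F A ` day_pre C ?I ?F A"
            by (rule equalityI[OF image_mono[OF pre]]) (use surj in blast)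
          finally show ?thesis .
        qed
      qed
    qed
    ultimately have "is_iso ?D ?m"
      using iso_PSh_iff[OF m(1), of "broad_wrt C Q"] m(2,3) by simp
    then show ?thesis by (simp add: n(2))
  qed
  ultimately show ?thesis by (simp add: subunit_def)
qed

end

section \<open>Subunits of broad presheaves are sieves of subunits\<close>

text \<open>For \<open>\<psi> : F \<cong> \<langle>U, X\<rangle>\<close>, the element of \<open>F\<close> at \<open>T \<otimes> X\<close> that corresponds to \<open>t \<otimes> X\<close>; it is meaningful
  when \<open>t\<close> represents a member of \<open>U\<close>.\<close>

definition generator :: "('o, 'a, 'm) braided_cat_scheme \<Rightarrow> ('o, 'a, ('x, 'o, 'a) elt) nat_trans
    \<Rightarrow> 'o \<Rightarrow> 'a \<Rightarrow> ('x, 'o, 'a) elt" where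
  "generator C \<psi> X t =
     inv_into (PObj (NDom \<psi>) (Dom C t \<otimes>\<^bsub>C\<^esub> X)) (NMap \<psi> (Dom C t \<otimes>\<^bsub>C\<^esub> X)) (ArrE (act C t X))"

text \<open>The arrow \<open>m : T \<otimes> X \<rightarrow> I\<close> to which \<open>n : F \<rightarrow> C(-, I)\<close> sends the generator.\<close>

definition generator_value :: "('o, 'a, 'm) braided_cat_scheme \<Rightarrow> ('o, 'a, ('x, 'o, 'a) elt) nat_trans
    \<Rightarrow> ('o, 'a, ('x, 'o, 'a) elt) nat_trans \<Rightarrow> 'o \<Rightarrow> 'a \<Rightarrow> 'a" where
  "generator_value C \<psi> n X t = un_arr (NMap n (Dom C t \<otimes>\<^bsub>C\<^esub> X) (generator C \<psi> X t))"

context stiff_category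
begin

lemma restricts_iff:
  assumes p: "p \<in> carrier (ISub C)" "s \<in> p" and f [simp]: "f \<in> Arr C"
  shows "restricts C f p \<longleftrightarrow> sub_le C f (act C s (Cod C f))"
proof -
  note [simp] = ISub_member_typing[OF p]
  have "sub_le C f (act C s (Cod C f))" if t: "t \<in> p" and le: "sub_le C f (act C t (Cod C f))" for t
  proof -
    note [simp] = ISub_member_typing[OF p(1) t]
    obtain k where [simp]: "k \<in> Arr C" "Dom C k = Dom C t" "Cod C k = Dom C s" and k: "s \<cdot> k = t"
      using ISub_equivalent[OF p(1) t p(2)] by (rule sub_leE) simp
    have "act C t (Cod C f) = act C s (Cod C f) \<cdot> (k \<boxtimes> Id C (Cod C f))"
      by (simp add: act_def k)
    then have "sub_le C (act C t (Cod C f)) (act C s (Cod C f))" by (rule sub_leI) simp_all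
    with le show ?thesis by (rule sub_le_trans) simp
  qed
  then show ?thesis using restricts_iff_sub_le[OF p(1) f] p(2) by blast
qed

text \<open>The action \<open>I \<otimes> F \<rightarrow> F\<close> of the unit on a presheaf, on representatives.\<close>

lemma unit_day_invariant:
  assumes F: "is_presheaf C F" and zw: "(z, w) \<in> day_eq C (representable C (TUnit C)) F A"
  shows "(\<lambda>(B, B', f, x, y). PMap F (act C (un_arr x) B' \<cdot> f) y) z
    = (\<lambda>(B, B', f, x, y). PMap F (act C (un_arr x) B' \<cdot> f) y) w" (is "?g z = ?g w")
  using zw
proof (rule day_eq_invariant)
  fix z w assume "(z, w) \<in> day_step C (representable C (TUnit C)) F A"
  then show "?g z = ?g w"
  proof (rule day_stepE)
    fix b b' f x y
    assume [simp]: "b \<in> Arr C" "b' \<in> Arr C" "f \<in> Arr C" "Dom C f = A" "Cod C f = Dom C b \<otimes> Dom C b'"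
      and x: "x \<in> PObj (representable C (TUnit C)) (Cod C b)" and y: "y \<in> PObj F (Cod C b')"
      and z: "z = (Dom C b, Dom C b', f, PMap (representable C (TUnit C)) b x, PMap F b' y)"
      and w: "w = (Cod C b, Cod C b', (b \<boxtimes> b') \<cdot> f, x, y)"
    obtain a where [simp]: "a \<in> Arr C" "Dom C a = Cod C b" "Cod C a = TUnit C" and xa: "x = ArrE a"
      using x by auto
    have "b' \<cdot> act C (a \<cdot> b) (Dom C b') = act C (a \<cdot> b) (Cod C b') \<cdot> (Id C (Dom C b) \<boxtimes> b')"
      using act_natural[of "a \<cdot> b" b'] by simp
    also have "\<dots> = act C a (Cod C b') \<cdot> (b \<boxtimes> b')" by (simp add: act_def)
    finally have eq: "b' \<cdot> act C (a \<cdot> b) (Dom C b') = act C a (Cod C b') \<cdot> (b \<boxtimes> b')" .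
    have "PMap F (act C (a \<cdot> b) (Dom C b') \<cdot> f) (PMap F b' y) = PMap F (b' \<cdot> act C (a \<cdot> b) (Dom C b') \<cdot> f) y"
      by (rule presheafD(3)[OF F, symmetric]) (simp_all add: y)
    also have "b' \<cdot> act C (a \<cdot> b) (Dom C b') \<cdot> f = (b' \<cdot> act C (a \<cdot> b) (Dom C b')) \<cdot> f" by simp
    also have "\<dots> = act C a (Cod C b') \<cdot> (b \<boxtimes> b') \<cdot> f" unfolding eq by simp
    finally show "?g z = ?g w"
      by (simp add: z w xa)
  qed
qed

text \<open>The data extracted from a subunit \<open>n : F \<rightarrow> C(-, I)\<close> of a category of broad presheaves, apart from
  idempotence, which enters below as bijectivity of \<open>n \<otimes> F\<close>.\<close>

context
  fixes U :: "'a set set" and X :: 'o and F :: "('o, 'a, ('x, 'o, 'a) elt) presheaf" and \<psi> n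
  assumes U: "U \<subseteq> carrier (ISub C)" and X [simp]: "X \<in> Obj C"
    and \<psi>: "is_nat_trans C \<psi>" "NDom \<psi> = F" "NCod \<psi> = bracket C U X"
    and \<psi>_bij: "\<And>A. A \<in> Obj C \<Longrightarrow> bij_betw (NMap \<psi> A) (PObj F A) (PObj (bracket C U X) A)"
    and n: "is_nat_trans C n" "NDom n = F" "NCod n = representable C (TUnit C)"
    and n_inj: "\<And>A. A \<in> Obj C \<Longrightarrow> inj_on (NMap n A) (PObj F A)"
begin

abbreviation gen :: "'a \<Rightarrow> ('x, 'o, 'a) elt" where
  "gen t \<equiv> generator C \<psi> X t"

abbreviation gen_value :: "'a \<Rightarrow> 'a" where
  "gen_value t \<equiv> generator_value C \<psi> n X t"

lemma F_presheaf: "is_presheaf C F"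
  using nat_transD(1)[OF \<psi>(1)] \<psi>(2) by simp

lemma \<psi>_eqD: "\<lbrakk>NMap \<psi> A x = NMap \<psi> A y; A \<in> Obj C; x \<in> PObj F A; y \<in> PObj F A\<rbrakk> \<Longrightarrow> x = y"
  using \<psi>_bij by (auto simp: bij_betw_def dest: inj_onD)

lemma member_typing:
  assumes "q \<in> U" "t \<in> q"
  shows "subunit C t" "t \<in> Arr C" "Cod C t = TUnit C"
  using assms U ISub_member(1) subunitD(2,3) by blast+

lemma gen_props:
  assumes q: "q \<in> U" "t \<in> q"
  shows "gen t \<in> PObj F (Dom C t \<otimes> X)" "NMap \<psi> (Dom C t \<otimes> X) (gen t) = ArrE (act C t X)"
proof -
  note [simp] = member_typing(2,3)[OF q]
  have "q \<in> carrier (ISub C)" using q U by auto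
  then have "restricts C (act C t X) q"
    using restricts_iff[of q t "act C t X"] q(2) sub_le_refl by simp
  then have "ArrE (act C t X) \<in> PObj (bracket C U X) (Dom C t \<otimes> X)"
    using q(1) by (auto simp: bracket_simps(1))
  also have "\<dots> = NMap \<psi> (Dom C t \<otimes> X) ` PObj F (Dom C t \<otimes> X)"
    using \<psi>_bij by (simp add: bij_betw_def)
  finally have *: "ArrE (act C t X) \<in> NMap \<psi> (Dom C t \<otimes> X) ` PObj (NDom \<psi>) (Dom C t \<otimes> X)"
    by (simp add: \<psi>(2))
  show "gen t \<in> PObj F (Dom C t \<otimes> X)" "NMap \<psi> (Dom C t \<otimes> X) (gen t) = ArrE (act C t X)"
    using inv_into_into[OF *] f_inv_into_f[OF *] by (simp_all add: generator_def \<psi>(2))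
qed

lemma gen_PMap:
  assumes q: "q \<in> U" "t \<in> q" and g: "g \<in> Arr C" "Cod C g = Dom C t \<otimes> X"
  shows "PMap F g (gen t) \<in> PObj F (Dom C g)"
    and "NMap \<psi> (Dom C g) (PMap F g (gen t)) = ArrE (act C t X \<cdot> g)"
proof -
  note [simp] = member_typing(2,3)[OF q] g
  have "q \<in> carrier (ISub C)" using q U by auto
  then have "restricts C (act C t X) q"
    using restricts_iff[of q t "act C t X"] q(2) sub_le_refl by simp
  then have "PMap (bracket C U X) g (ArrE (act C t X)) = (ArrE (act C t X \<cdot> g) :: ('x, 'o, 'a) elt)"
    by (intro bracket_simps(2)[of g "act C t X" X q U]) (simp_all add: q(1))
  then show "NMap \<psi> (Dom C g) (PMap F g (gen t)) = ArrE (act C t X \<cdot> g)"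
    using nat_transD(4)[OF \<psi>(1) g(1), of "gen t"] gen_props[OF q] \<psi>(2,3) by simp
  show "PMap F g (gen t) \<in> PObj F (Dom C g)"
    using presheafD(1)[OF F_presheaf g(1), of "gen t"] gen_props[OF q] by simp
qed

lemma gen_cover:
  assumes A: "A \<in> Obj C" and x: "x \<in> PObj F A"
  shows "\<exists>q \<in> U. \<forall>t \<in> q. \<exists>g. g \<in> Arr C \<and> Dom C g = A \<and> Cod C g = Dom C t \<otimes> X \<and> x = PMap F g (gen t)"
proof -
  have "NMap \<psi> A x \<in> PObj (bracket C U X) A" using nat_transD(3)[OF \<psi>(1) A] x \<psi>(2,3) by simp
  then obtain f q where [simp]: "f \<in> Arr C" "Dom C f = A" "Cod C f = X" and q: "q \<in> U" "restricts C f q"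
    and xf: "NMap \<psi> A x = ArrE f" using A by (auto simp: bracket_simps(1))
  have "\<exists>g. g \<in> Arr C \<and> Dom C g = A \<and> Cod C g = Dom C t \<otimes> X \<and> x = PMap F g (gen t)" if t: "t \<in> q" for t
  proof -
    note [simp] = member_typing(2,3)[OF q(1) t]
    have "sub_le C f (act C t X)" using restricts_iff[OF subsetD[OF U q(1)] t, of f] q(2) by simp
    then obtain g where g: "g \<in> Arr C" "Dom C g = A" "Cod C g = Dom C t \<otimes> X" and fg: "act C t X \<cdot> g = f"
      by (rule sub_leE) simp_all
    have "x = PMap F g (gen t)"
      by (rule \<psi>_eqD[OF _ A x]) (use xf fg gen_PMap[OF q(1) t g(1,3)] g(2) in simp_all)
    with g show ?thesis by blast
  qed
  with q(1) show ?thesis by blast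
qed

lemma gen_value_props:
  assumes q: "q \<in> U" "t \<in> q"
  shows "gen_value t \<in> Arr C" "Dom C (gen_value t) = Dom C t \<otimes> X" "Cod C (gen_value t) = TUnit C"
    and "NMap n (Dom C t \<otimes> X) (gen t) = ArrE (gen_value t)"
proof -
  note [simp] = member_typing(2,3)[OF q]
  have "NMap n (Dom C t \<otimes> X) (gen t) \<in> PObj (representable C (TUnit C)) (Dom C t \<otimes> X)"
    using nat_transD(3)[OF n(1), of "Dom C t \<otimes> X" "gen t"] gen_props(1)[OF q] n(2,3) by simp
  then show "gen_value t \<in> Arr C" "Dom C (gen_value t) = Dom C t \<otimes> X" "Cod C (gen_value t) = TUnit C"
    "NMap n (Dom C t \<otimes> X) (gen t) = ArrE (gen_value t)"
    by (auto simp: generator_value_def)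
qed

lemma n_gen_PMap:
  assumes q: "q \<in> U" "t \<in> q" and g: "g \<in> Arr C" "Cod C g = Dom C t \<otimes> X"
  shows "NMap n (Dom C g) (PMap F g (gen t)) = ArrE (gen_value t \<cdot> g)"
  using nat_transD(4)[OF n(1) g(1), of "gen t"] gen_props(1)[OF q] gen_value_props[OF q] n(2,3) g
  by simp

text \<open>Injectivity of \<open>n\<close> and \<open>\<psi>\<close> reduces this to \<open>t \<otimes> X\<close> being monic.\<close>

lemma gen_value_mono:
  assumes q: "q \<in> U" "t \<in> q"
  shows "is_mono C (gen_value t)"
proof (rule monoI)
  note [simp] = gen_value_props(1-3)[OF q] member_typing(2,3)[OF q]
  show "gen_value t \<in> Arr C" by simp
  fix g h
  assume gh [simp]: "g \<in> Arr C" "h \<in> Arr C" and c: "Cod C g = Dom C (gen_value t)"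
    "Cod C h = Dom C (gen_value t)" and d: "Dom C g = Dom C h" and eq: "gen_value t \<cdot> g = gen_value t \<cdot> h"
  then have c' [simp]: "Cod C g = Dom C t \<otimes> X" "Cod C h = Dom C t \<otimes> X" by simp_all
  have "PMap F g (gen t) = PMap F h (gen t)"
    by (rule inj_onD[OF n_inj[of "Dom C h"]])
      (use n_gen_PMap[OF q gh(1) c'(1)] n_gen_PMap[OF q gh(2) c'(2)] gen_PMap(1)[OF q gh(1) c'(1)]
        gen_PMap(1)[OF q gh(2) c'(2)] d eq in simp_all)
  then have "act C t X \<cdot> g = act C t X \<cdot> h"
    using gen_PMap(2)[OF q gh(1) c'(1)] gen_PMap(2)[OF q gh(2) c'(2)] d by simp
  then show "g = h"
    by (rule mono_cancel[OF act_mono[OF X member_typing(1)[OF q]]]) (simp_all add: d)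
qed

text \<open>The generators at \<open>s\<close> and \<open>t\<close> agree on the intersection.\<close>

lemma gen_shift:
  assumes p: "p \<in> U" "s \<in> p" and q: "q \<in> U" "t \<in> q"
  shows "PMap F (act C s (Dom C t \<otimes> X)) (gen t) = PMap F (Id C (Dom C s) \<boxtimes> act C t X) (gen s)"
proof -
  note [simp] = member_typing(2,3)[OF p] member_typing(2,3)[OF q]
  have "NMap \<psi> (Dom C s \<otimes> Dom C t \<otimes> X) (PMap F (act C s (Dom C t \<otimes> X)) (gen t))
      = ArrE (act C t X \<cdot> act C s (Dom C t \<otimes> X))"
    using gen_PMap(2)[OF q, of "act C s (Dom C t \<otimes> X)"] by simp
  moreover have "NMap \<psi> (Dom C s \<otimes> Dom C t \<otimes> X) (PMap F (Id C (Dom C s) \<boxtimes> act C t X) (gen s))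
      = ArrE (act C s X \<cdot> (Id C (Dom C s) \<boxtimes> act C t X))"
    using gen_PMap(2)[OF p, of "Id C (Dom C s) \<boxtimes> act C t X"] by simp
  moreover have "act C s X \<cdot> (Id C (Dom C s) \<boxtimes> act C t X) = act C t X \<cdot> act C s (Dom C t \<otimes> X)"
    using act_natural[of s "act C t X"] by simp
  ultimately show ?thesis
    using gen_PMap(1)[OF q, of "act C s (Dom C t \<otimes> X)"]
      gen_PMap(1)[OF p, of "Id C (Dom C s) \<boxtimes> act C t X"]
    by (rule_tac \<psi>_eqD[of "Dom C s \<otimes> Dom C t \<otimes> X"]) simp_all
qed

text \<open>Every element of \<open>F \<otimes> F\<close> at \<open>S \<otimes> X\<close> is a pair of copies of the generator at \<open>s\<close>. At first it is a
  pair of generators at some \<open>t\<close> and \<open>u\<close>, restricted along an arrow out of \<open>S \<otimes> X\<close>; that arrow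
  restricts to \<open>s\<close> in both factors, where the generators at \<open>t\<close> and \<open>u\<close> agree with the one at \<open>s\<close>.\<close>

lemma day_representative:
  assumes p: "p \<in> U" "s \<in> p" and z: "z \<in> day_pre C F F (Dom C s \<otimes> X)"
  obtains r where "r \<in> Arr C" "Dom C r = Dom C s \<otimes> X" "Cod C r = (Dom C s \<otimes> X) \<otimes> (Dom C s \<otimes> X)"
    "(z, (Dom C s \<otimes> X, Dom C s \<otimes> X, r, gen s, gen s)) \<in> day_eq C F F (Dom C s \<otimes> X)"
proof -
  let ?Y = "Dom C s \<otimes> X"
  note [simp] = member_typing(2,3)[OF p]
  obtain B B' f x y where z_eq: "z = (B, B', f, x, y)" and [simp]: "B \<in> Obj C" "B' \<in> Obj C"
      "f \<in> Arr C" "Dom C f = ?Y" "Cod C f = B \<otimes> B'" and x: "x \<in> PObj F B" and y: "y \<in> PObj F B'"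
    using z by (cases z) auto
  obtain q where q: "q \<in> U" "\<forall>t \<in> q. \<exists>g. g \<in> Arr C \<and> Dom C g = B \<and> Cod C g = Dom C t \<otimes> X \<and> x = PMap F g (gen t)"
    using gen_cover[OF \<open>B \<in> Obj C\<close> x] by blast
  obtain q' where q': "q' \<in> U" "\<forall>t \<in> q'. \<exists>g. g \<in> Arr C \<and> Dom C g = B' \<and> Cod C g = Dom C t \<otimes> X \<and> y = PMap F g (gen t)"
    using gen_cover[OF \<open>B' \<in> Obj C\<close> y] by blast
  obtain t u where t: "t \<in> q" and u: "u \<in> q'"
    using ISub_nonempty[OF subsetD[OF U q(1)]] ISub_nonempty[OF subsetD[OF U q'(1)]] by blast
  note [simp] = member_typing(2,3)[OF q(1) t] member_typing(2,3)[OF q'(1) u]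
  obtain g where [simp]: "g \<in> Arr C" "Dom C g = B" "Cod C g = Dom C t \<otimes> X" and xg: "x = PMap F g (gen t)"
    using q(2) t by blast
  obtain g' where [simp]: "g' \<in> Arr C" "Dom C g' = B'" "Cod C g' = Dom C u \<otimes> X" and yg: "y = PMap F g' (gen u)"
    using q'(2) u by blast
  note gens [simp] = gen_props(1)[OF p] gen_props(1)[OF q(1) t] gen_props(1)[OF q'(1) u]
  let ?f = "(g \<boxtimes> g') \<cdot> f" and ?A = "Dom C t \<otimes> X" and ?B = "Dom C u \<otimes> X"
  have "((Dom C g, Dom C g', f, PMap F g (gen t), PMap F g' (gen u)),
      (Cod C g, Cod C g', (g \<boxtimes> g') \<cdot> f, gen t, gen u)) \<in> day_step C F F ?Y"
    by (rule day_stepI) simp_all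
  then have 1: "(z, (?A, ?B, ?f, gen t, gen u)) \<in> day_eq C F F ?Y"
    by (intro day_eq_step) (simp add: z_eq xg yg)
  have "sub_le C ?f (act C s ?A \<boxtimes> act C s ?B)"
    by (rule sub_le_act_tensor[OF member_typing(1)[OF p], of _ X]) simp_all
  then obtain h where [simp]: "h \<in> Arr C" "Dom C h = ?Y" "Cod C h = (Dom C s \<otimes> ?A) \<otimes> (Dom C s \<otimes> ?B)"
    and h: "(act C s ?A \<boxtimes> act C s ?B) \<cdot> h = ?f"
    by (rule sub_leE) simp_all
  let ?k = "Id C (Dom C s) \<boxtimes> act C t X" and ?l = "Id C (Dom C s) \<boxtimes> act C u X"
  have "((Dom C (act C s ?A), Dom C (act C s ?B), h, PMap F (act C s ?A) (gen t), PMap F (act C s ?B) (gen u)),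
      (Cod C (act C s ?A), Cod C (act C s ?B), (act C s ?A \<boxtimes> act C s ?B) \<cdot> h, gen t, gen u)) \<in> day_step C F F ?Y"
    by (rule day_stepI) simp_all
  then have 2: "((Dom C s \<otimes> ?A, Dom C s \<otimes> ?B, h, PMap F ?k (gen s), PMap F ?l (gen s)),
      (?A, ?B, ?f, gen t, gen u)) \<in> day_eq C F F ?Y"
    unfolding h gen_shift[OF p q(1) t] gen_shift[OF p q'(1) u] by (intro day_eq_step) simp
  have "((Dom C ?k, Dom C ?l, h, PMap F ?k (gen s), PMap F ?l (gen s)),
      (Cod C ?k, Cod C ?l, (?k \<boxtimes> ?l) \<cdot> h, gen s, gen s)) \<in> day_step C F F ?Y"
    by (rule day_stepI) simp_all
  then have 3: "((Dom C s \<otimes> ?A, Dom C s \<otimes> ?B, h, PMap F ?k (gen s), PMap F ?l (gen s)),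
      (?Y, ?Y, (?k \<boxtimes> ?l) \<cdot> h, gen s, gen s)) \<in> day_eq C F F ?Y"
    by (intro day_eq_step) simp
  show ?thesis
    by (rule that[OF _ _ _ day_eq_trans[OF 1 day_eq_trans[OF day_eq_sym[OF 2] 3]]]) simp_all
qed

text \<open>The map \<open>F \<otimes> F \<rightarrow> C(-, X \<otimes> X)\<close> induced by \<open>\<psi>\<close>, on representatives.\<close>

lemma pair_day_invariant:
  assumes zw: "(z, w) \<in> day_eq C F F A"
  shows "(\<lambda>(B, B', f, x, y). (un_arr (NMap \<psi> B x) \<boxtimes> un_arr (NMap \<psi> B' y)) \<cdot> f) z
    = (\<lambda>(B, B', f, x, y). (un_arr (NMap \<psi> B x) \<boxtimes> un_arr (NMap \<psi> B' y)) \<cdot> f) w" (is "?g z = ?g w")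
  using zw
proof (rule day_eq_invariant)
  fix z w assume "(z, w) \<in> day_step C F F A"
  then show "?g z = ?g w"
  proof (rule day_stepE)
    fix b b' f x y
    assume b [simp]: "b \<in> Arr C" and b' [simp]: "b' \<in> Arr C"
      and [simp]: "f \<in> Arr C" "Dom C f = A" "Cod C f = Dom C b \<otimes> Dom C b'"
      and x: "x \<in> PObj F (Cod C b)" and y: "y \<in> PObj F (Cod C b')"
      and z: "z = (Dom C b, Dom C b', f, PMap F b x, PMap F b' y)"
      and w: "w = (Cod C b, Cod C b', (b \<boxtimes> b') \<cdot> f, x, y)"
    have \<psi>_step: "\<exists>a. a \<in> Arr C \<and> Dom C a = Cod C c \<and> NMap \<psi> (Cod C c) v = ArrE a
        \<and> NMap \<psi> (Dom C c) (PMap F c v) = ArrE (a \<cdot> c)" if c: "c \<in> Arr C" and v: "v \<in> PObj F (Cod C c)" for c v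
    proof -
      have "NMap \<psi> (Cod C c) v \<in> PObj (bracket C U X) (Cod C c)"
        using nat_transD(3)[OF \<psi>(1) cod_obj[OF c], of v] v \<psi>(2,3) by simp
      then obtain a q where a: "a \<in> Arr C" "Dom C a = Cod C c" "Cod C a = X" "q \<in> U" "restricts C a q"
        and va: "NMap \<psi> (Cod C c) v = ArrE a" using c by (auto simp: bracket_simps(1))
      have "NMap \<psi> (Dom C c) (PMap F c v) = PMap (bracket C U X) c (ArrE a)"
        using nat_transD(4)[OF \<psi>(1) c, of v] v va \<psi>(2,3) by simp
      also have "\<dots> = ArrE (a \<cdot> c)" by (rule bracket_simps(2)[OF c a])
      finally show ?thesis using a va by blast
    qed
    obtain a where [simp]: "a \<in> Arr C" "Dom C a = Cod C b" and
      a: "NMap \<psi> (Cod C b) x = ArrE a" "NMap \<psi> (Dom C b) (PMap F b x) = ArrE (a \<cdot> b)"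
      using \<psi>_step[OF b x] by blast
    obtain a' where [simp]: "a' \<in> Arr C" "Dom C a' = Cod C b'" and
      a': "NMap \<psi> (Cod C b') y = ArrE a'" "NMap \<psi> (Dom C b') (PMap F b' y) = ArrE (a' \<cdot> b')"
      using \<psi>_step[OF b' y] by blast
    show "?g z = ?g w"
      by (simp add: z w a a')
  qed
qed

text \<open>The element of \<open>C(-, I) \<otimes> F\<close> given by the generator itself lifts to \<open>F \<otimes> F\<close>; comparing both
  through the action of the unit on \<open>F\<close> yields the section.\<close>

lemma gen_value_section:
  assumes surj: "\<And>A. A \<in> Obj C \<Longrightarrow> PObj (day C (representable C (TUnit C)) F) A
      \<subseteq> NMap (day_map C n (nat_id C F)) A ` PObj (day C F F) A"
    and p: "p \<in> U" "s \<in> p"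
  obtains r where "r \<in> Arr C" "Dom C r = Dom C s \<otimes> X" "Cod C r = (Dom C s \<otimes> X) \<otimes> (Dom C s \<otimes> X)"
    "act C (gen_value s) (Dom C s \<otimes> X) \<cdot> r = Id C (Dom C s \<otimes> X)"
proof -
  let ?Y = "Dom C s \<otimes> X" and ?R = "representable C (TUnit C) :: ('o, 'a, ('x, 'o, 'a) elt) presheaf"
  let ?m = "gen_value s"
  note [simp] = member_typing(2,3)[OF p] gen_value_props(1-3)[OF p]
  note gen_s [simp] = gen_props(1)[OF p]
  obtain k where [simp]: "k \<in> Arr C" "Dom C k = ?Y" "Cod C k = TUnit C \<otimes> ?Y"
    and k: "Lunit C ?Y \<cdot> k = Id C ?Y"
    using isoE[OF lunit_iso[of ?Y]] by auto
  \<comment> \<open>the generator, viewed in \<open>C(-, I) \<otimes> F\<close> through the inverse \<open>k\<close> of the left unitor\<close>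
  let ?w = "(TUnit C, ?Y, k, ArrE (Id C (TUnit C)), gen s)"
  have "day_elt C ?R F ?Y ?w \<in> PObj (day C ?R F) ?Y"
    by (simp add: day_PObj)
  then have "day_elt C ?R F ?Y ?w \<in> NMap (day_map C n (nat_id C F)) ?Y ` PObj (day C F F) ?Y"
    using surj[of ?Y] by auto
  then obtain z where z: "z \<in> day_pre C F F ?Y"
    and zw: "day_elt C ?R F ?Y ?w = NMap (day_map C n (nat_id C F)) ?Y (day_elt C F F ?Y z)"
    by (auto simp: day_PObj)
  obtain r where [simp]: "r \<in> Arr C" "Dom C r = ?Y" "Cod C r = ?Y \<otimes> ?Y"
    and zr: "(z, (?Y, ?Y, r, gen s, gen s)) \<in> day_eq C F F ?Y"
    using day_representative[OF p z] by blast
  have "day_elt C F F ?Y z = day_elt C F F ?Y (?Y, ?Y, r, gen s, gen s)"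
    using zr by (simp add: day_elt_eq_iff)
  then have "day_elt C ?R F ?Y ?w = day_elt C ?R F ?Y (?Y, ?Y, r, ArrE ?m, gen s)"
    using zw day_map_elt[OF n(1) nat_id_trans[OF F_presheaf], of ?Y ?Y ?Y r "gen s" "gen s"]
      gen_value_props(4)[OF p] n(2,3) by simp
  then have "(?w, (?Y, ?Y, r, ArrE ?m, gen s)) \<in> day_eq C ?R F ?Y"
    by (simp add: day_elt_eq_iff)
  from unit_day_invariant[OF F_presheaf this]
  have "PMap F (act C (Id C (TUnit C)) ?Y \<cdot> k) (gen s) = PMap F (act C ?m ?Y \<cdot> r) (gen s)"
    by simp
  moreover have "act C (Id C (TUnit C)) ?Y \<cdot> k = Id C ?Y" by (simp add: act_def k)
  ultimately have "PMap F (Id C ?Y) (gen s) = PMap F (act C ?m ?Y \<cdot> r) (gen s)" by simp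
  then have "act C s X \<cdot> Id C ?Y = act C s X \<cdot> act C ?m ?Y \<cdot> r"
    using gen_PMap(2)[OF p, of "Id C ?Y"] gen_PMap(2)[OF p, of "act C ?m ?Y \<cdot> r"] by simp
  then have "Id C ?Y = act C ?m ?Y \<cdot> r"
    by (rule mono_cancel[OF act_mono[OF X member_typing(1)[OF p]]]) simp_all
  then show ?thesis by (intro that[of r]) simp_all
qed

text \<open>The arrows \<open>r \<cdot> (m \<otimes> Y)\<close> and the identity of \<open>Y \<otimes> Y\<close> define elements of \<open>F \<otimes> F\<close> with the same image
  under \<open>n \<otimes> F\<close>, and \<open>F \<otimes> F \<rightarrow> C(-, X \<otimes> X)\<close> followed by monicity of \<open>(s \<otimes> X) \<otimes> (s \<otimes> X)\<close> tells such arrows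
  apart.\<close>

lemma gen_value_retraction:
  assumes inj: "\<And>A. A \<in> Obj C \<Longrightarrow> inj_on (NMap (day_map C n (nat_id C F)) A) (PObj (day C F F) A)"
    and p: "p \<in> U" "s \<in> p"
    and r [simp]: "r \<in> Arr C" "Dom C r = Dom C s \<otimes> X" "Cod C r = (Dom C s \<otimes> X) \<otimes> (Dom C s \<otimes> X)"
    and sec: "act C (gen_value s) (Dom C s \<otimes> X) \<cdot> r = Id C (Dom C s \<otimes> X)"
  shows "r \<cdot> act C (gen_value s) (Dom C s \<otimes> X) = Id C ((Dom C s \<otimes> X) \<otimes> (Dom C s \<otimes> X))"
proof -
  let ?Y = "Dom C s \<otimes> X" and ?R = "representable C (TUnit C) :: ('o, 'a, ('x, 'o, 'a) elt) presheaf"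
  let ?m = "gen_value s" and ?Z = "(Dom C s \<otimes> X) \<otimes> (Dom C s \<otimes> X)"
  let ?n = "NMap (day_map C n (nat_id C F)) ?Z" and ?I = "TUnit C"
  note [simp] = member_typing(2,3)[OF p] gen_value_props(1-3)[OF p]
  note gen_s [simp] = gen_props(1)[OF p]
  \<comment> \<open>the image under \<open>n \<otimes> F\<close>, with \<open>m\<close> moved across the coend from the element of \<open>C(-, I)\<close> to the arrow\<close>
  have app: "?n (day_elt C F F ?Z (?Y, ?Y, g, gen s, gen s))
      = day_elt C ?R F ?Z (?I, ?Y, (?m \<boxtimes> Id C ?Y) \<cdot> g, ArrE (Id C ?I), gen s)"
    if g [simp]: "g \<in> Arr C" "Dom C g = ?Z" "Cod C g = ?Z" for g
  proof -
    have "((Dom C ?m, Dom C (Id C ?Y), g, PMap ?R ?m (ArrE (Id C ?I)), PMap F (Id C ?Y) (gen s)),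
        (Cod C ?m, Cod C (Id C ?Y), (?m \<boxtimes> Id C ?Y) \<cdot> g, ArrE (Id C ?I), gen s)) \<in> day_step C ?R F ?Z"
      by (rule day_stepI) simp_all
    then have "((?Y, ?Y, g, ArrE ?m, gen s), (?I, ?Y, (?m \<boxtimes> Id C ?Y) \<cdot> g, ArrE (Id C ?I), gen s))
        \<in> day_eq C ?R F ?Z"
      by (intro day_eq_step) (simp add: presheafD(2)[OF F_presheaf])
    then show ?thesis
      using day_map_elt[OF n(1) nat_id_trans[OF F_presheaf], of ?Z ?Y ?Y g "gen s" "gen s"]
        gen_value_props(4)[OF p] n(2,3) by (simp add: day_elt_eq_iff)
  qed
  let ?e = "r \<cdot> act C ?m ?Y"
  have "Lunit C ?Y \<cdot> (?m \<boxtimes> Id C ?Y) \<cdot> ?e = (act C ?m ?Y \<cdot> r) \<cdot> act C ?m ?Y"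
    by (simp add: act_def)
  also have "\<dots> = Lunit C ?Y \<cdot> (?m \<boxtimes> Id C ?Y)" by (simp only: sec) (simp add: act_def)
  finally have eq: "Lunit C ?Y \<cdot> (?m \<boxtimes> Id C ?Y) \<cdot> ?e = Lunit C ?Y \<cdot> (?m \<boxtimes> Id C ?Y)" .
  have "is_mono C (Lunit C ?Y)" by (simp add: iso_mono lunit_iso)
  from this eq have "(?m \<boxtimes> Id C ?Y) \<cdot> ?e = ?m \<boxtimes> Id C ?Y"
    by (rule mono_cancel) simp_all
  then have "?n (day_elt C F F ?Z (?Y, ?Y, ?e, gen s, gen s)) = ?n (day_elt C F F ?Z (?Y, ?Y, Id C ?Z, gen s, gen s))"
    using app[of ?e] app[of "Id C ?Z"] by simp
  then have "day_elt C F F ?Z (?Y, ?Y, ?e, gen s, gen s) = day_elt C F F ?Z (?Y, ?Y, Id C ?Z, gen s, gen s)"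
    by (rule inj_onD[OF inj[of ?Z, simplified]]) (simp_all add: day_PObj)
  then have "((?Y, ?Y, ?e, gen s, gen s), (?Y, ?Y, Id C ?Z, gen s, gen s)) \<in> day_eq C F F ?Z"
    by (simp add: day_elt_eq_iff)
  from pair_day_invariant[OF this]
  have "(act C s X \<boxtimes> act C s X) \<cdot> ?e = (act C s X \<boxtimes> act C s X) \<cdot> Id C ?Z"
    by (simp add: gen_props(2)[OF p])
  then show ?thesis
    by (rule mono_cancel[OF act_tensor_mono[OF member_typing(1)[OF p] X X]]) simp_all
qed

lemma gen_value_subunit:
  assumes bij: "\<And>A. A \<in> Obj C \<Longrightarrow> bij_betw (NMap (day_map C n (nat_id C F)) A)
      (PObj (day C F F) A) (PObj (day C (representable C (TUnit C)) F) A)"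
    and p: "p \<in> U" "s \<in> p"
  shows "subunit C (gen_value s)"
proof -
  let ?Y = "Dom C s \<otimes> X" and ?m = "gen_value s"
  note [simp] = member_typing(2,3)[OF p] gen_value_props(1-3)[OF p]
  have surj: "PObj (day C (representable C (TUnit C)) F) A
      \<subseteq> NMap (day_map C n (nat_id C F)) A ` PObj (day C F F) A"
    and inj: "inj_on (NMap (day_map C n (nat_id C F)) A) (PObj (day C F F) A)" if "A \<in> Obj C" for A
    using bij[OF that] by (simp_all add: bij_betw_def)
  obtain r where r: "r \<in> Arr C" "Dom C r = ?Y" "Cod C r = ?Y \<otimes> ?Y" "act C ?m ?Y \<cdot> r = Id C ?Y"
    using gen_value_section[OF surj p] by blast
  have "is_iso C (act C ?m ?Y)"
    by (rule isoI[of _ r]) (use r gen_value_retraction[OF inj p r] in simp_all)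
  moreover have "is_iso C (?m \<boxtimes> Id C ?Y) \<longleftrightarrow> is_iso C (act C ?m ?Y)"
    by (rule iso_conjugate[of "Id C (?Y \<otimes> ?Y)" "Lunit C ?Y"]) (simp_all add: id_iso lunit_iso act_def)
  ultimately show ?thesis
    using gen_value_mono[OF p] by (simp add: subunit_def)
qed

lemma gen_value_sub_le:
  assumes p: "p \<in> U" "s \<in> p" and q: "q \<in> U" "t \<in> q" and le: "sub_le C s t"
  shows "sub_le C (gen_value s) (gen_value t)"
proof -
  note [simp] = member_typing(2,3)[OF p] member_typing(2,3)[OF q] gen_value_props(1-3)[OF p]
    gen_value_props(1-3)[OF q]
  obtain k where [simp]: "k \<in> Arr C" "Dom C k = Dom C s" "Cod C k = Dom C t" and k: "t \<cdot> k = s"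
    using le by (rule sub_leE) simp_all
  let ?k = "k \<boxtimes> Id C X"
  have "gen s = PMap F ?k (gen t)"
    by (rule \<psi>_eqD[of "Dom C s \<otimes> X"])
      (use gen_PMap[OF q, of ?k] gen_props[OF p] in \<open>simp_all add: act_def k\<close>)
  then have "ArrE (gen_value s) = (ArrE (gen_value t \<cdot> ?k) :: ('x, 'o, 'a) elt)"
    using n_gen_PMap[OF q, of ?k] gen_value_props(4)[OF p] by simp
  then have "gen_value s = gen_value t \<cdot> ?k" by simp
  then show ?thesis by (rule sub_leI) simp_all
qed

text \<open>The generators at all \<open>s\<close> in \<open>U\<close> generate \<open>F\<close>, so their values generate the image of \<open>n\<close>.\<close>

lemma image_eq_sieve:
  assumes sub: "\<And>p s. \<lbrakk>p \<in> U; s \<in> p\<rbrakk> \<Longrightarrow> subunit C (gen_value s)" and A: "A \<in> Obj C"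
  shows "NMap n A ` PObj F A = PObj (sieve ((\<lambda>p. subobj C (gen_value (SOME s. s \<in> p))) ` U)) A"
proof -
  have rep: "(SOME s. s \<in> p) \<in> p" if "p \<in> U" for p
    by (rule someI_ex[OF ISub_nonempty[OF subsetD[OF U that]]])
  have restr: "restricts C f (subobj C (gen_value s)) \<longleftrightarrow> sub_le C f (gen_value s)"
    if "p \<in> U" "s \<in> p" "f \<in> Arr C" "Cod C f = TUnit C" for p s f
    using restricts_unit_iff[OF subobj_subunit[OF sub[OF that(1,2)]] that(3,4)] .
  show ?thesis
  proof (intro equalityI subsetI)
    fix e :: "('x, 'o, 'a) elt" assume "e \<in> NMap n A ` PObj F A"
    then obtain x where x: "x \<in> PObj F A" and e: "e = NMap n A x" by blast
    obtain q where q: "q \<in> U" "\<forall>t \<in> q. \<exists>g. g \<in> Arr C \<and> Dom C g = A \<and> Cod C g = Dom C t \<otimes> X \<and> x = PMap F g (gen t)"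
      using gen_cover[OF A x] by blast
    let ?t = "SOME s. s \<in> q"
    obtain g where g: "g \<in> Arr C" "Dom C g = A" "Cod C g = Dom C ?t \<otimes> X" and xg: "x = PMap F g (gen ?t)"
      using q(2) rep[OF q(1)] by blast
    note [simp] = gen_value_props(1-3)[OF q(1) rep[OF q(1)]]
    have "e = ArrE (gen_value ?t \<cdot> g)"
      using n_gen_PMap[OF q(1) rep[OF q(1)] g(1,3)] g(2) by (simp add: e xg)
    moreover have "restricts C (gen_value ?t \<cdot> g) (subobj C (gen_value ?t))"
      using restr[OF q(1) rep[OF q(1)], of "gen_value ?t \<cdot> g"] sub_le_precomp[of g "gen_value ?t"] g by simp
    ultimately show "e \<in> PObj (sieve ((\<lambda>p. subobj C (gen_value (SOME s. s \<in> p))) ` U)) A"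
      using g q(1) A unfolding bracket_simps(1)[OF A] by auto
  next
    fix e :: "('x, 'o, 'a) elt" assume "e \<in> PObj (sieve ((\<lambda>p. subobj C (gen_value (SOME s. s \<in> p))) ` U)) A"
    then obtain f p where f: "f \<in> Arr C" "Dom C f = A" "Cod C f = TUnit C" and e: "e = ArrE f"
      and p: "p \<in> U" and r: "restricts C f (subobj C (gen_value (SOME s. s \<in> p)))"
      unfolding bracket_simps(1)[OF A] by auto
    let ?t = "SOME s. s \<in> p"
    note [simp] = gen_value_props(1-3)[OF p rep[OF p]]
    have "sub_le C f (gen_value ?t)" using restr[OF p rep[OF p] f(1,3)] r by simp
    then obtain g where g: "g \<in> Arr C" "Dom C g = A" "Cod C g = Dom C ?t \<otimes> X" and fg: "gen_value ?t \<cdot> g = f"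
      by (rule sub_leE) (simp_all add: f)
    have "e = NMap n A (PMap F g (gen ?t))"
      using n_gen_PMap[OF p rep[OF p] g(1,3)] g(2) fg by (simp add: e)
    moreover have "PMap F g (gen ?t) \<in> PObj F A"
      using gen_PMap(1)[OF p rep[OF p] g(1,3)] g(2) by simp
    ultimately show "e \<in> NMap n A ` PObj F A" by blast
  qed
qed

end

text \<open>The map \<open>\<nu>\<close> is kept in the conclusion, as its monotonicity is what carries the kind of \<open>U\<close> over to
  the family \<open>\<nu> ` U\<close> of subunits generating the image.\<close>

lemma subunit_PSh_image:
  fixes n :: "('o, 'a, ('x, 'o, 'a) elt) nat_trans"
  assumes sub: "subunit (full_sub (PSh C) (broad_wrt C Q)) n" and top: "Q {subobj C (Id C (TUnit C))}"
  obtains U \<nu> where "U \<subseteq> carrier (ISub C)" "Q U" "\<nu> ` U \<subseteq> carrier (ISub C)"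
    "\<And>p q. \<lbrakk>p \<in> U; q \<in> U; p \<sqsubseteq>\<^bsub>ISub C\<^esub> q\<rbrakk> \<Longrightarrow> \<nu> p \<sqsubseteq>\<^bsub>ISub C\<^esub> \<nu> q"
    "\<And>A. A \<in> Obj C \<Longrightarrow> NMap n A ` PObj (NDom n) A = PObj (sieve (\<nu> ` U)) A"
proof -
  let ?D = "full_sub (PSh C) (broad_wrt C Q) :: ('x, 'o, 'a) psh_cat"
  let ?F = "NDom n" and ?R = "representable C (TUnit C) :: ('o, 'a, ('x, 'o, 'a) elt) presheaf"
  have mono: "is_mono ?D n" and cod: "NCod n = ?R" and iso: "is_iso ?D (day_map C n (nat_id C ?F))"
    using sub by (simp_all add: subunit_def)
  have n: "is_nat_trans C n" "broad_wrt C Q ?F" "broad_wrt C Q (NCod n)"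
    using mono by (simp_all add: is_mono_def)
  have n_inj: "inj_on (NMap n A) (PObj ?F A)" if "A \<in> Obj C" for A
    using mono_PSh_iff[OF n(1), of "broad_wrt C Q"] n(2,3) broad_representable[where Q = Q, OF top] mono that
    by blast
  let ?t = "day_map C n (nat_id C ?F)"
  have t: "is_nat_trans C ?t" "NDom ?t = day C ?F ?F" "NCod ?t = day C ?R ?F"
    using day_map_trans[OF n(1) nat_id_trans[OF nat_transD(1)[OF n(1)]]] cod by simp_all
  have "broad_wrt C Q (NDom ?t)" "broad_wrt C Q (NCod ?t)"
    using iso by (simp_all add: is_iso_def)
  then have bij: "bij_betw (NMap ?t A) (PObj (day C ?F ?F) A) (PObj (day C ?R ?F) A)" if "A \<in> Obj C" for A
    using iso_PSh_iff[OF t(1), of "broad_wrt C Q"] iso that t(2,3) by simp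
  obtain U X where U: "U \<subseteq> carrier (ISub C)" "Q U" and X: "X \<in> Obj C"
    and isom: "isomorphic (PSh C) ?F (bracket C U X)"
    using n(2) unfolding broad_wrt_def by blast
  obtain \<psi> where \<psi>: "is_nat_trans C \<psi>" "NDom \<psi> = ?F" "NCod \<psi> = bracket C U X" and \<psi>_iso: "is_iso (PSh C) \<psi>"
    using isom by (auto simp: isomorphic_def Hom_def)
  have \<psi>_bij: "bij_betw (NMap \<psi> A) (PObj ?F A) (PObj (bracket C U X) A)" if "A \<in> Obj C" for A
    using iso_PSh_iff[OF \<psi>(1), of "\<lambda>_. True"] \<psi>_iso \<psi>(2,3) that by (simp add: full_sub_True)
  note ctxt = U(1) X \<psi> \<psi>_bij n(1) refl cod n_inj
  let ?m = "generator_value C \<psi> n X" and ?rep = "\<lambda>p. SOME s. s \<in> p"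
  let ?\<nu> = "\<lambda>p. subobj C (?m (?rep p))"
  have m: "subunit C (?m s)" if "p \<in> U" "s \<in> p" for p s
    by (rule gen_value_subunit[OF ctxt bij that])
  have rep: "?rep p \<in> p" if "p \<in> U" for p
    by (rule someI_ex[OF ISub_nonempty[OF subsetD[OF U(1) that]]])
  show ?thesis
  proof (rule that[OF U])
    show "?\<nu> ` U \<subseteq> carrier (ISub C)" using subobj_subunit(1)[OF m] rep by blast
    show "NMap n A ` PObj ?F A = PObj (sieve (?\<nu> ` U)) A" if A: "A \<in> Obj C" for A
      by (rule image_eq_sieve[OF ctxt m A])
    fix p q assume p: "p \<in> U" and q: "q \<in> U" and "p \<sqsubseteq>\<^bsub>ISub C\<^esub> q"
    then have "sub_le C (?rep p) (?rep q)"
      using ISub_le_iff[OF subsetD[OF U(1) p] subsetD[OF U(1) q] rep[OF p] rep[OF q]] by blast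
    then have "sub_le C (?m (?rep p)) (?m (?rep q))"
      using gen_value_sub_le[OF ctxt p rep[OF p] q rep[OF q]] by blast
    then show "?\<nu> p \<sqsubseteq>\<^bsub>ISub C\<^esub> ?\<nu> q"
      using ISub_le_iff[OF subobj_subunit(1)[OF m[OF p rep[OF p]]] subobj_subunit(1)[OF m[OF q rep[OF q]]]
        subobj_subunit(2)[OF m[OF p rep[OF p]]] subobj_subunit(2)[OF m[OF q rep[OF q]]]] by blast
  qed
qed

end

section \<open>Completion of semilattices by lower sets\<close>

text \<open>The predicate \<open>J\<close> selects the subsets whose suprema are required. Finitely bounded, directed and
  arbitrary subsets give distributive lattices, preframes and frames, which allows the three
  completions to be treated at once.\<close>

definition sup_distributive :: "'l gorder \<Rightarrow> ('l set \<Rightarrow> bool) \<Rightarrow> bool" where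
  "sup_distributive L J \<longleftrightarrow> meet_semilattice L \<and>
     (\<forall>U. U \<subseteq> carrier L \<and> J U \<longrightarrow> (\<exists>s. least L s (Upper L U) \<and>
       (\<forall>x \<in> carrier L. least L (x \<sqinter>\<^bsub>L\<^esub> s) (Upper L ((\<lambda>u. x \<sqinter>\<^bsub>L\<^esub> u) ` U)))))"

definition sup_hom :: "'k gorder \<Rightarrow> ('k set \<Rightarrow> bool) \<Rightarrow> 'l gorder \<Rightarrow> ('k \<Rightarrow> 'l) set" where
  "sup_hom K J L = {h \<in> semilattice_hom K L.
     \<forall>U. U \<subseteq> carrier K \<and> J U \<longrightarrow> h (\<Squnion>\<^bsub>K\<^esub>U) = \<Squnion>\<^bsub>L\<^esub>(h ` U)}"

lemma least_Upper_iff: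
  assumes "U \<subseteq> carrier L"
  shows "least L s (Upper L U) \<longleftrightarrow> s \<in> carrier L \<and> (\<forall>u \<in> U. u \<sqsubseteq>\<^bsub>L\<^esub> s)
    \<and> (\<forall>y \<in> carrier L. (\<forall>u \<in> U. u \<sqsubseteq>\<^bsub>L\<^esub> y) \<longrightarrow> s \<sqsubseteq>\<^bsub>L\<^esub> y)"
proof -
  have "Upper L U = {y \<in> carrier L. \<forall>u \<in> U. u \<sqsubseteq>\<^bsub>L\<^esub> y}" using assms by (auto simp: Upper_def)
  then show ?thesis by (auto simp: least_def)
qed

lemma greatest_Lower_iff:
  assumes "U \<subseteq> carrier L"
  shows "greatest L s (Lower L U) \<longleftrightarrow> s \<in> carrier L \<and> (\<forall>u \<in> U. s \<sqsubseteq>\<^bsub>L\<^esub> u)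
    \<and> (\<forall>y \<in> carrier L. (\<forall>u \<in> U. y \<sqsubseteq>\<^bsub>L\<^esub> u) \<longrightarrow> y \<sqsubseteq>\<^bsub>L\<^esub> s)"
proof -
  have "Lower L U = {y \<in> carrier L. \<forall>u \<in> U. y \<sqsubseteq>\<^bsub>L\<^esub> u}" using assms by (auto simp: Lower_def)
  then show ?thesis by (auto simp: greatest_def)
qed

context meet_semilattice
begin

lemma meet_props:
  assumes "x \<in> carrier L" "y \<in> carrier L"
  shows "x \<sqinter> y \<in> carrier L" "x \<sqinter> y \<sqsubseteq> x" "x \<sqinter> y \<sqsubseteq> y"
    "\<lbrakk>z \<in> carrier L; z \<sqsubseteq> x; z \<sqsubseteq> y\<rbrakk> \<Longrightarrow> z \<sqsubseteq> x \<sqinter> y"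
proof -
  obtain m where m: "greatest L m (Lower L {x, y})" using inf_of_two_exists assms by blast
  then have "x \<sqinter> y = m" by (simp add: meet_def inf_eqI)
  with m assms show "x \<sqinter> y \<in> carrier L" "x \<sqinter> y \<sqsubseteq> x" "x \<sqinter> y \<sqsubseteq> y"
    "\<lbrakk>z \<in> carrier L; z \<sqsubseteq> x; z \<sqsubseteq> y\<rbrakk> \<Longrightarrow> z \<sqsubseteq> x \<sqinter> y"
    by (simp_all add: greatest_Lower_iff)
qed

lemma meet_eqI:
  assumes "x \<in> carrier L" "y \<in> carrier L" "m \<in> carrier L" "m \<sqsubseteq> x" "m \<sqsubseteq> y"
    and "\<And>z. \<lbrakk>z \<in> carrier L; z \<sqsubseteq> x; z \<sqsubseteq> y\<rbrakk> \<Longrightarrow> z \<sqsubseteq> m"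
  shows "x \<sqinter> y = m"
  unfolding meet_def by (rule inf_eqI) (use assms in \<open>simp add: greatest_Lower_iff\<close>)

lemma le_meet_iff:
  assumes "x \<in> carrier L" "y \<in> carrier L" "z \<in> carrier L"
  shows "z \<sqsubseteq> x \<sqinter> y \<longleftrightarrow> z \<sqsubseteq> x \<and> z \<sqsubseteq> y"
proof
  note m = meet_props(1-3)[OF assms(1,2)]
  assume "z \<sqsubseteq> x \<sqinter> y"
  then show "z \<sqsubseteq> x \<and> z \<sqsubseteq> y"
    using le_trans[OF _ m(2) assms(3) m(1) assms(1)] le_trans[OF _ m(3) assms(3) m(1) assms(2)]
    by simp
next
  assume "z \<sqsubseteq> x \<and> z \<sqsubseteq> y"
  then show "z \<sqsubseteq> x \<sqinter> y" using meet_props(4)[OF assms(1,2,3)] by simp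
qed

lemma le_iff_meet_eq:
  assumes "x \<in> carrier L" "y \<in> carrier L"
  shows "x \<sqsubseteq> y \<longleftrightarrow> x \<sqinter> y = x"
proof
  assume "x \<sqsubseteq> y"
  then show "x \<sqinter> y = x" by (rule_tac meet_eqI) (simp_all add: assms)
next
  assume "x \<sqinter> y = x"
  then show "x \<sqsubseteq> y" using meet_props(3)[OF assms] by simp
qed

lemma top_props: "\<top> \<in> carrier L" "x \<in> carrier L \<Longrightarrow> x \<sqsubseteq> \<top>"
  using top_exists top_eqI by (auto simp: greatest_def)

end

lemma semilattice_hom_mono:
  assumes K: "meet_semilattice K" and L: "meet_semilattice L" and f: "f \<in> semilattice_hom K L"
    and x: "x \<in> carrier K" and y: "y \<in> carrier K" and le: "x \<sqsubseteq>\<^bsub>K\<^esub> y"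
  shows "f x \<sqsubseteq>\<^bsub>L\<^esub> f y"
proof -
  interpret K: meet_semilattice K by fact
  interpret L: meet_semilattice L by fact
  have "f x \<in> carrier L" "f y \<in> carrier L" "f (x \<sqinter>\<^bsub>K\<^esub> y) = f x \<sqinter>\<^bsub>L\<^esub> f y"
    using f x y by (auto simp: semilattice_hom_def)
  then show ?thesis using K.le_iff_meet_eq[OF x y] le L.le_iff_meet_eq by simp
qed

lemma sup_distributiveD:
  assumes "sup_distributive L J" and U: "U \<subseteq> carrier L" "J U"
  shows "least L (\<Squnion>\<^bsub>L\<^esub>U) (Upper L U)"
    and "x \<in> carrier L \<Longrightarrow> least L (x \<sqinter>\<^bsub>L\<^esub> \<Squnion>\<^bsub>L\<^esub>U) (Upper L ((\<lambda>u. x \<sqinter>\<^bsub>L\<^esub> u) ` U))"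
proof -
  interpret L: meet_semilattice L using assms by (simp add: sup_distributive_def)
  obtain s where s: "least L s (Upper L U)"
    and d: "\<forall>x \<in> carrier L. least L (x \<sqinter>\<^bsub>L\<^esub> s) (Upper L ((\<lambda>u. x \<sqinter>\<^bsub>L\<^esub> u) ` U))"
    using assms unfolding sup_distributive_def by blast
  have "\<Squnion>\<^bsub>L\<^esub>U = s" using s by (rule L.sup_eqI)
  with s d show "least L (\<Squnion>\<^bsub>L\<^esub>U) (Upper L U)"
    "x \<in> carrier L \<Longrightarrow> least L (x \<sqinter>\<^bsub>L\<^esub> \<Squnion>\<^bsub>L\<^esub>U) (Upper L ((\<lambda>u. x \<sqinter>\<^bsub>L\<^esub> u) ` U))" by simp_all
qed

definition down :: "'s gorder \<Rightarrow> 's set \<Rightarrow> 's set" where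
  "down S V = {a \<in> carrier S. \<exists>b \<in> V. a \<sqsubseteq>\<^bsub>S\<^esub> b}"

definition lower_sets :: "'s gorder \<Rightarrow> ('s set \<Rightarrow> bool) \<Rightarrow> 's set set" where
  "lower_sets S J = {W. W \<subseteq> carrier S \<and> down S W \<subseteq> W \<and> J W}"

text \<open>The order \<open>Q\<close> is presented by a bijection \<open>\<Psi>\<close> from the lower sets rather than being that set itself,
  since the elements of the \<open>Q\<close> in question are classes of subunits of presheaves.\<close>

locale lower_set_order =
  fixes S :: "'s gorder" and Q :: "'q gorder" and JS :: "'s set \<Rightarrow> bool" and \<Psi> :: "'s set \<Rightarrow> 'q"
  assumes semilattice: "meet_semilattice S"
    and eq_Q: "eq Q = (=)"
    and carrier_Q: "carrier Q = \<Psi> ` lower_sets S JS"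
    and le_Q: "\<lbrakk>V \<in> lower_sets S JS; W \<in> lower_sets S JS\<rbrakk> \<Longrightarrow> \<Psi> V \<sqsubseteq>\<^bsub>Q\<^esub> \<Psi> W \<longleftrightarrow> V \<subseteq> W"
begin

sublocale S: meet_semilattice S by (rule semilattice)

abbreviation Low :: "'s set set" where "Low \<equiv> lower_sets S JS"

abbreviation \<eta> :: "'s \<Rightarrow> 'q" where "\<eta> a \<equiv> \<Psi> (down S {a})"

lemma LowD:
  assumes "W \<in> Low"
  shows "W \<subseteq> carrier S" "JS W" "\<lbrakk>a \<in> W; b \<in> carrier S; b \<sqsubseteq>\<^bsub>S\<^esub> a\<rbrakk> \<Longrightarrow> b \<in> W"
  using assms by (auto simp: lower_sets_def down_def)

lemma LowI:
  assumes "W \<subseteq> carrier S" "JS W" "\<And>a b. \<lbrakk>a \<in> W; b \<in> carrier S; b \<sqsubseteq>\<^bsub>S\<^esub> a\<rbrakk> \<Longrightarrow> b \<in> W"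
  shows "W \<in> Low"
  using assms by (auto simp: lower_sets_def down_def)

lemma Q_partial_order: "partial_order Q"
proof (rule partial_orderI[OF eq_Q])
  show "x \<sqsubseteq>\<^bsub>Q\<^esub> x" if "x \<in> carrier Q" for x using that carrier_Q le_Q by auto
  show "x = y" if "x \<sqsubseteq>\<^bsub>Q\<^esub> y" "y \<sqsubseteq>\<^bsub>Q\<^esub> x" "x \<in> carrier Q" "y \<in> carrier Q" for x y
    using that carrier_Q le_Q by auto
  show "x \<sqsubseteq>\<^bsub>Q\<^esub> z"
    if "x \<sqsubseteq>\<^bsub>Q\<^esub> y" "y \<sqsubseteq>\<^bsub>Q\<^esub> z" "x \<in> carrier Q" "y \<in> carrier Q" "z \<in> carrier Q" for x y z
    using that carrier_Q le_Q by auto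
qed

sublocale Q: partial_order Q by (rule Q_partial_order)

lemma \<Psi>_carrier: "W \<in> Low \<Longrightarrow> \<Psi> W \<in> carrier Q"
  by (simp add: carrier_Q)

lemma \<Psi>_inj: "inj_on \<Psi> Low"
proof (rule inj_onI)
  fix V W assume V: "V \<in> Low" and W: "W \<in> Low" and eq: "\<Psi> V = \<Psi> W"
  have "\<Psi> V \<sqsubseteq>\<^bsub>Q\<^esub> \<Psi> W" "\<Psi> W \<sqsubseteq>\<^bsub>Q\<^esub> \<Psi> V" using Q.le_refl[OF \<Psi>_carrier[OF W]] eq by simp_all
  then show "V = W" using le_Q[OF V W] le_Q[OF W V] by blast
qed

end

text \<open>The closure conditions under which the lower sets selected by \<open>JS\<close> have finite meets, computed as
  intersections, and suprema of the kind \<open>JQ\<close>, computed as unions, and are themselves such suprema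
  of principal lower sets.\<close>

locale lower_set_completion = lower_set_order +
  fixes JQ :: "'b set \<Rightarrow> bool"
  assumes JS_principal: "a \<in> carrier S \<Longrightarrow> JS (down S {a})"
    and JS_inter: "\<lbrakk>V \<in> lower_sets S JS; W \<in> lower_sets S JS\<rbrakk> \<Longrightarrow> JS (V \<inter> W)"
    and JS_union: "\<lbrakk>\<V> \<subseteq> lower_sets S JS; JQ (\<Psi> ` \<V>)\<rbrakk> \<Longrightarrow> JS (\<Union>\<V>)"
    and JQ_principal: "W \<in> lower_sets S JS \<Longrightarrow> JQ ((\<lambda>a. \<Psi> (down S {a})) ` W)"
begin

lemma inter_Low:
  assumes V: "V \<in> Low" and W: "W \<in> Low"
  shows "V \<inter> W \<in> Low"
proof (rule LowI)
  show "V \<inter> W \<subseteq> carrier S" using LowD(1)[OF V] by blast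
  show "JS (V \<inter> W)" by (rule JS_inter[OF V W])
  fix a b assume "a \<in> V \<inter> W" and b: "b \<in> carrier S" "b \<sqsubseteq>\<^bsub>S\<^esub> a"
  then show "b \<in> V \<inter> W" using LowD(3)[OF V _ b] LowD(3)[OF W _ b] by simp
qed

lemma union_Low:
  assumes V: "\<V> \<subseteq> Low" and J: "JQ (\<Psi> ` \<V>)"
  shows "\<Union>\<V> \<in> Low"
proof (rule LowI)
  show "\<Union>\<V> \<subseteq> carrier S" using LowD(1) V by blast
  show "JS (\<Union>\<V>)" by (rule JS_union[OF V J])
  fix a b assume "a \<in> \<Union>\<V>" and b: "b \<in> carrier S" "b \<sqsubseteq>\<^bsub>S\<^esub> a"
  then obtain W where W: "W \<in> \<V>" "a \<in> W" by blast
  have "b \<in> W" by (rule LowD(3)[OF subsetD[OF V W(1)] W(2) b])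
  with W(1) show "b \<in> \<Union>\<V>" by blast
qed

lemma principal_Low: "a \<in> carrier S \<Longrightarrow> down S {a} \<in> Low"
  by (rule LowI) (use JS_principal S.le_trans in \<open>auto simp: down_def\<close>)

lemma mem_principal: "a \<in> carrier S \<Longrightarrow> a \<in> down S {a}"
  by (simp add: down_def)

lemma principal_top: "down S {\<top>\<^bsub>S\<^esub>} = carrier S"
  using S.top_props by (auto simp: down_def)

lemma principal_subset_iff:
  assumes a: "a \<in> carrier S" and W: "W \<in> Low"
  shows "down S {a} \<subseteq> W \<longleftrightarrow> a \<in> W"
proof
  show "down S {a} \<subseteq> W \<Longrightarrow> a \<in> W" using mem_principal[OF a] by blast
  assume "a \<in> W"
  from LowD(3)[OF W this] show "down S {a} \<subseteq> W" by (auto simp: down_def)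
qed

lemma Q_inf: "\<lbrakk>V \<in> Low; W \<in> Low\<rbrakk> \<Longrightarrow> greatest Q (\<Psi> (V \<inter> W)) (Lower Q {\<Psi> V, \<Psi> W})"
  by (subst greatest_Lower_iff) (auto simp: carrier_Q le_Q inter_Low)

lemma Q_top: "greatest Q (\<Psi> (carrier S)) (carrier Q)"
  using principal_Low[OF S.top_props(1)] LowD(1)
  by (auto simp: principal_top greatest_def carrier_Q le_Q)

lemma Q_meet_semilattice: "meet_semilattice Q"
proof unfold_locales
  show "\<exists>s. greatest Q s (Lower Q {x, y})" if "x \<in> carrier Q" "y \<in> carrier Q" for x y
    using that Q_inf by (auto simp: carrier_Q)
  show "\<exists>x. greatest Q x (carrier Q)" using Q_top by blast
qed

sublocale Q: meet_semilattice Q by (rule Q_meet_semilattice)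

lemma \<Psi>_meet: "\<lbrakk>V \<in> Low; W \<in> Low\<rbrakk> \<Longrightarrow> \<Psi> V \<sqinter>\<^bsub>Q\<^esub> \<Psi> W = \<Psi> (V \<inter> W)"
  unfolding meet_def by (rule Q.inf_eqI[OF Q_inf])

lemma \<Psi>_sup:
  assumes "\<V> \<subseteq> Low" "\<Union>\<V> \<in> Low"
  shows "least Q (\<Psi> (\<Union>\<V>)) (Upper Q (\<Psi> ` \<V>))"
proof -
  have "\<Psi> ` \<V> \<subseteq> carrier Q" using assms by (auto simp: carrier_Q)
  moreover have "\<Psi> V \<sqsubseteq>\<^bsub>Q\<^esub> \<Psi> (\<Union>\<V>)" if "V \<in> \<V>" for V
    using le_Q[OF subsetD[OF assms(1) that] assms(2)] Union_upper[OF that] by simp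
  moreover have "\<Psi> (\<Union>\<V>) \<sqsubseteq>\<^bsub>Q\<^esub> \<Psi> W" if W: "W \<in> Low" "\<forall>V \<in> \<V>. \<Psi> V \<sqsubseteq>\<^bsub>Q\<^esub> \<Psi> W" for W
  proof -
    have "V \<subseteq> W" if "V \<in> \<V>" for V using le_Q[OF subsetD[OF assms(1) that] W(1)] W(2) that by simp
    then show ?thesis using le_Q[OF assms(2) W(1)] by blast
  qed
  ultimately show ?thesis
    using assms(2) by (subst least_Upper_iff) (auto simp: carrier_Q)
qed

lemma Q_sup_distributive: "sup_distributive Q JQ"
  unfolding sup_distributive_def
proof (intro conjI allI impI, rule Q_meet_semilattice, elim conjE)
  fix \<A> assume "\<A> \<subseteq> carrier Q" and J: "JQ \<A>"
  then obtain \<V> where V: "\<V> \<subseteq> Low" and A: "\<A> = \<Psi> ` \<V>" by (auto simp: carrier_Q subset_image_iff)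
  have U: "\<Union>\<V> \<in> Low" using union_Low V J A by simp
  have "least Q (x \<sqinter>\<^bsub>Q\<^esub> \<Psi> (\<Union>\<V>)) (Upper Q ((\<lambda>u. x \<sqinter>\<^bsub>Q\<^esub> u) ` \<A>))" if xc: "x \<in> carrier Q" for x
  proof -
    obtain W where W: "W \<in> Low" and x: "x = \<Psi> W" using xc by (auto simp: carrier_Q)
    have "(\<lambda>u. x \<sqinter>\<^bsub>Q\<^esub> u) ` \<A> = \<Psi> ` ((\<lambda>V. W \<inter> V) ` \<V>)"
      unfolding A image_image using V W by (intro image_cong refl) (auto simp: x \<Psi>_meet)
    moreover have WU: "W \<inter> \<Union>\<V> = \<Union>((\<lambda>V. W \<inter> V) ` \<V>)" by blast
    moreover have "x \<sqinter>\<^bsub>Q\<^esub> \<Psi> (\<Union>\<V>) = \<Psi> (\<Union>((\<lambda>V. W \<inter> V) ` \<V>))"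
      unfolding x \<Psi>_meet[OF W U] WU ..
    moreover have "(\<lambda>V. W \<inter> V) ` \<V> \<subseteq> Low" using inter_Low W V by auto
    moreover have "\<Union>((\<lambda>V. W \<inter> V) ` \<V>) \<in> Low" using inter_Low[OF W U] by (simp only: WU)
    ultimately show ?thesis using \<Psi>_sup[of "(\<lambda>V. W \<inter> V) ` \<V>"] by (simp only:)
  qed
  moreover have "least Q (\<Psi> (\<Union>\<V>)) (Upper Q \<A>)" using \<Psi>_sup[OF V U] by (simp only: A)
  ultimately show "\<exists>s. least Q s (Upper Q \<A>) \<and>
      (\<forall>x \<in> carrier Q. least Q (x \<sqinter>\<^bsub>Q\<^esub> s) (Upper Q ((\<lambda>u. x \<sqinter>\<^bsub>Q\<^esub> u) ` \<A>)))"
    by blast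
qed

lemma \<eta>_hom: "\<eta> \<in> semilattice_hom S Q"
proof -
  have "down S {a} \<inter> down S {b} = down S {a \<sqinter>\<^bsub>S\<^esub> b}" if "a \<in> carrier S" "b \<in> carrier S" for a b
    using S.le_meet_iff[OF that] by (auto simp: down_def)
  then have "\<eta> (a \<sqinter>\<^bsub>S\<^esub> b) = \<eta> a \<sqinter>\<^bsub>Q\<^esub> \<eta> b" if "a \<in> carrier S" "b \<in> carrier S" for a b
    using that by (simp add: \<Psi>_meet principal_Low)
  moreover have "\<eta> \<top>\<^bsub>S\<^esub> = \<top>\<^bsub>Q\<^esub>"
    using Q.top_eqI[OF Q_top] by (simp add: principal_top)
  ultimately show ?thesis by (simp add: semilattice_hom_def \<Psi>_carrier principal_Low)
qed

text \<open>Every lower set is the union of the principal ones below its elements, so a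
  sup-preserving extension of \<open>f\<close> can only be \<open>W \<mapsto> \<Squnion> f[W]\<close>; distributivity makes this map
  preserve meets.\<close>

lemma extension_unique:
  assumes h: "h \<in> sup_hom Q JQ L" "\<forall>a \<in> carrier S. h (\<eta> a) = f a" and W: "W \<in> Low"
  shows "h (\<Psi> W) = \<Squnion>\<^bsub>L\<^esub>(f ` W)"
proof -
  let ?\<V> = "(\<lambda>a. down S {a}) ` W"
  have WS: "W \<subseteq> carrier S" using LowD(1)[OF W] .
  have V: "?\<V> \<subseteq> Low" using principal_Low WS by auto
  have "down S {a} \<subseteq> W" if "a \<in> W" for a
    using principal_subset_iff[OF subsetD[OF WS that] W] that by simp
  moreover have "a \<in> down S {a}" if "a \<in> W" for a
    by (rule mem_principal[OF subsetD[OF WS that]])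
  ultimately have U: "\<Union>?\<V> = W" by blast
  have im: "\<Psi> ` ?\<V> = \<eta> ` W" by (simp add: image_image)
  have "\<Squnion>\<^bsub>Q\<^esub>(\<Psi> ` ?\<V>) = \<Psi> (\<Union>?\<V>)"
    by (rule Q.sup_eqI[OF \<Psi>_sup[OF V]]) (simp only: U W)
  then have "\<Squnion>\<^bsub>Q\<^esub>(\<eta> ` W) = \<Psi> W" unfolding U im .
  moreover have "\<eta> ` W \<subseteq> carrier Q"
    by (rule image_subsetI, rule \<Psi>_carrier[OF principal_Low[OF subsetD[OF WS]]])
  then have "h (\<Squnion>\<^bsub>Q\<^esub>(\<eta> ` W)) = \<Squnion>\<^bsub>L\<^esub>(h ` \<eta> ` W)"
    using h(1) JQ_principal[OF W] unfolding sup_hom_def by blast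
  ultimately have "h (\<Psi> W) = \<Squnion>\<^bsub>L\<^esub>(h ` \<eta> ` W)" by simp
  also have "h ` \<eta> ` W = f ` W" unfolding image_image
    by (rule image_cong[OF refl bspec[OF h(2) subsetD[OF WS]]])
  finally show ?thesis .
qed

lemma extension_exists:
  assumes L: "sup_distributive L JL" and f: "f \<in> semilattice_hom S L"
    and JL: "\<And>W. W \<in> Low \<Longrightarrow> JL (f ` W)"
  shows "\<exists>h. h \<in> sup_hom Q JQ L \<and> h \<in> extensional (carrier Q) \<and> (\<forall>a \<in> carrier S. h (\<eta> a) = f a)"
proof -
  interpret L: meet_semilattice L using L unfolding sup_distributive_def by blast
  define g where "g W = \<Squnion>\<^bsub>L\<^esub>(f ` W)" for W
  define h where "h = (\<lambda>x \<in> carrier Q. g (the_inv_into Low \<Psi> x))"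
  have h: "h (\<Psi> W) = g W" if "W \<in> Low" for W
    using that by (simp add: h_def \<Psi>_carrier the_inv_into_f_f[OF \<Psi>_inj])
  have fc: "f a \<in> carrier L" if "a \<in> carrier S" for a using f that by (auto simp: semilattice_hom_def)
  have fW: "f ` W \<subseteq> carrier L" if "W \<in> Low" for W using fc LowD(1)[OF that] by auto
  note f_mono = semilattice_hom_mono[OF semilattice L.meet_semilattice_axioms f]
  have lub: "least L (g W) (Upper L (f ` W))" if "W \<in> Low" for W
    unfolding g_def by (rule sup_distributiveD(1)[OF L fW[OF that] JL[OF that]])
  have gc: "g W \<in> carrier L" and g_upper: "\<And>a. a \<in> W \<Longrightarrow> f a \<sqsubseteq>\<^bsub>L\<^esub> g W"
    and g_least: "\<And>y. \<lbrakk>y \<in> carrier L; \<And>a. a \<in> W \<Longrightarrow> f a \<sqsubseteq>\<^bsub>L\<^esub> y\<rbrakk> \<Longrightarrow> g W \<sqsubseteq>\<^bsub>L\<^esub> y" if "W \<in> Low" for W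
    using lub[OF that] unfolding least_Upper_iff[OF fW[OF that]] by auto
  have g_mono: "g V \<sqsubseteq>\<^bsub>L\<^esub> g W" if "V \<in> Low" "W \<in> Low" "V \<subseteq> W" for V W
    by (rule g_least[OF that(1) gc[OF that(2)]]) (use g_upper[OF that(2)] that(3) in blast)
  have g_principal: "g (down S {a}) = f a" if a: "a \<in> carrier S" for a
    by (rule L.le_antisym[OF g_least[OF principal_Low[OF a] fc[OF a]]
          g_upper[OF principal_Low[OF a] mem_principal[OF a]] gc[OF principal_Low[OF a]] fc[OF a]])
      (use f_mono a in \<open>auto simp: down_def\<close>)
  have g_meet: "g (V \<inter> W) = g V \<sqinter>\<^bsub>L\<^esub> g W" if V: "V \<in> Low" and W: "W \<in> Low" for V W
  proof (rule L.meet_eqI[symmetric])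
    show "g V \<in> carrier L" "g W \<in> carrier L" "g (V \<inter> W) \<in> carrier L"
      using gc V W inter_Low by blast+
    show "g (V \<inter> W) \<sqsubseteq>\<^bsub>L\<^esub> g V" "g (V \<inter> W) \<sqsubseteq>\<^bsub>L\<^esub> g W"
      using g_mono[OF inter_Low[OF V W]] V W by blast+
    \<comment> \<open>distributivity as a test for upper bounds, used below for one argument after the other\<close>
    have step: "x \<sqinter>\<^bsub>L\<^esub> g Z \<sqsubseteq>\<^bsub>L\<^esub> y"
      if Z: "Z \<in> Low" and x: "x \<in> carrier L" and y: "y \<in> carrier L"
        and le: "\<And>b. b \<in> Z \<Longrightarrow> x \<sqinter>\<^bsub>L\<^esub> f b \<sqsubseteq>\<^bsub>L\<^esub> y" for x y Z
    proof -
      have "least L (x \<sqinter>\<^bsub>L\<^esub> g Z) (Upper L ((\<lambda>u. x \<sqinter>\<^bsub>L\<^esub> u) ` f ` Z))"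
        unfolding g_def by (rule sup_distributiveD(2)[OF L fW[OF Z] JL[OF Z] x])
      moreover have "(\<lambda>u. x \<sqinter>\<^bsub>L\<^esub> u) ` f ` Z \<subseteq> carrier L" using fW[OF Z] L.meet_props(1)[OF x] by auto
      ultimately show ?thesis using y le by (auto simp: least_Upper_iff)
    qed
    fix z assume z: "z \<in> carrier L" "z \<sqsubseteq>\<^bsub>L\<^esub> g V" "z \<sqsubseteq>\<^bsub>L\<^esub> g W"
    have "g V \<sqinter>\<^bsub>L\<^esub> g W \<sqsubseteq>\<^bsub>L\<^esub> g (V \<inter> W)"
    proof (rule step[OF W gc[OF V] gc[OF inter_Low[OF V W]]])
      fix b assume b: "b \<in> W"
      then have bS: "b \<in> carrier S" using LowD(1)[OF W] by auto
      have "f b \<sqinter>\<^bsub>L\<^esub> g V \<sqsubseteq>\<^bsub>L\<^esub> g (V \<inter> W)"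
      proof (rule step[OF V fc[OF bS] gc[OF inter_Low[OF V W]]])
        fix a assume a: "a \<in> V"
        then have aS: "a \<in> carrier S" using LowD(1)[OF V] by auto
        have "b \<sqinter>\<^bsub>S\<^esub> a \<in> V \<inter> W"
          using LowD(3)[OF V a] LowD(3)[OF W b] S.meet_props[OF bS aS] by blast
        then have "f (b \<sqinter>\<^bsub>S\<^esub> a) \<sqsubseteq>\<^bsub>L\<^esub> g (V \<inter> W)" by (rule g_upper[OF inter_Low[OF V W]])
        then show "f b \<sqinter>\<^bsub>L\<^esub> f a \<sqsubseteq>\<^bsub>L\<^esub> g (V \<inter> W)" using f aS bS by (simp add: semilattice_hom_def)
      qed
      moreover have "f b \<sqinter>\<^bsub>L\<^esub> g V = g V \<sqinter>\<^bsub>L\<^esub> f b" by (simp add: meet_def insert_commute)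
      ultimately show "g V \<sqinter>\<^bsub>L\<^esub> f b \<sqsubseteq>\<^bsub>L\<^esub> g (V \<inter> W)" by simp
    qed
    moreover have "z \<sqsubseteq>\<^bsub>L\<^esub> g V \<sqinter>\<^bsub>L\<^esub> g W" by (rule L.meet_props(4)[OF gc[OF V] gc[OF W] z])
    ultimately show "z \<sqsubseteq>\<^bsub>L\<^esub> g (V \<inter> W)"
      using L.le_trans z(1) gc[OF inter_Low[OF V W]] L.meet_props(1)[OF gc[OF V] gc[OF W]] by blast
  qed
  have "h \<in> semilattice_hom Q L"
  proof -
    have "h \<top>\<^bsub>Q\<^esub> = \<top>\<^bsub>L\<^esub>"
    proof -
      have "h (\<eta> \<top>\<^bsub>S\<^esub>) = f \<top>\<^bsub>S\<^esub>" using h principal_Low g_principal S.top_props by simp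
      then show ?thesis using f Q.top_eqI[OF Q_top] by (simp add: semilattice_hom_def principal_top)
    qed
    then show ?thesis
      using gc h g_meet inter_Low by (auto simp: semilattice_hom_def carrier_Q \<Psi>_meet)
  qed
  moreover have "h (\<Squnion>\<^bsub>Q\<^esub>\<A>) = \<Squnion>\<^bsub>L\<^esub>(h ` \<A>)" if A: "\<A> \<subseteq> carrier Q" "JQ \<A>" for \<A>
  proof -
    obtain \<V> where V: "\<V> \<subseteq> Low" and A': "\<A> = \<Psi> ` \<V>"
      using A(1) by (auto simp: carrier_Q subset_image_iff)
    have U: "\<Union>\<V> \<in> Low" using union_Low V A A' by simp
    have hA: "h ` \<A> = g ` \<V>" unfolding A' image_image using V h by (intro image_cong refl) auto
    have "least L (g (\<Union>\<V>)) (Upper L (g ` \<V>))"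
    proof (subst least_Upper_iff)
      show "g ` \<V> \<subseteq> carrier L" using gc V by auto
      have "g V' \<sqsubseteq>\<^bsub>L\<^esub> g (\<Union>\<V>)" if "V' \<in> \<V>" for V'
        by (rule g_mono[OF subsetD[OF V that] U Union_upper[OF that]])
      moreover have "g (\<Union>\<V>) \<sqsubseteq>\<^bsub>L\<^esub> y" if y: "y \<in> carrier L" "\<forall>u \<in> g ` \<V>. u \<sqsubseteq>\<^bsub>L\<^esub> y" for y
      proof (rule g_least[OF U y(1)])
        fix a assume "a \<in> \<Union>\<V>"
        then obtain V' where V': "V' \<in> \<V>" "a \<in> V'" by blast
        have V'L: "V' \<in> Low" using V V' by blast
        have aS: "a \<in> carrier S" using LowD(1)[OF V'L] V' by blast
        show "f a \<sqsubseteq>\<^bsub>L\<^esub> y"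
          by (rule L.le_trans[OF g_upper[OF V'L V'(2)] bspec[OF y(2) imageI[OF V'(1)]]
                fc[OF aS] gc[OF V'L] y(1)])
      qed
      ultimately show "g (\<Union>\<V>) \<in> carrier L \<and> (\<forall>u \<in> g ` \<V>. u \<sqsubseteq>\<^bsub>L\<^esub> g (\<Union>\<V>)) \<and>
          (\<forall>y \<in> carrier L. (\<forall>u \<in> g ` \<V>. u \<sqsubseteq>\<^bsub>L\<^esub> y) \<longrightarrow> g (\<Union>\<V>) \<sqsubseteq>\<^bsub>L\<^esub> y)"
        using gc[OF U] by blast
    qed
    then have "\<Squnion>\<^bsub>L\<^esub>(h ` \<A>) = g (\<Union>\<V>)" unfolding hA by (rule L.sup_eqI)
    moreover have "\<Squnion>\<^bsub>Q\<^esub>\<A> = \<Psi> (\<Union>\<V>)" unfolding A' by (rule Q.sup_eqI[OF \<Psi>_sup[OF V U]])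
    ultimately show ?thesis using h[OF U] by simp
  qed
  ultimately have "h \<in> sup_hom Q JQ L" by (simp add: sup_hom_def)
  moreover have "h \<in> extensional (carrier Q)" by (simp add: h_def)
  moreover have "\<forall>a \<in> carrier S. h (\<eta> a) = f a" using h principal_Low g_principal by simp
  ultimately show ?thesis by blast
qed

lemma free_completion:
  assumes TQ: "T Q"
    and TL: "\<And>L. T' L \<Longrightarrow> sup_distributive L (JL L)"
    and JL: "\<And>L W f. \<lbrakk>T' L; W \<in> Low; f \<in> semilattice_hom S L\<rbrakk> \<Longrightarrow> JL L (f ` W)"
    and hom: "\<And>L. T' L \<Longrightarrow> hom Q L = sup_hom Q JQ L"
    and e: "\<And>a. a \<in> carrier S \<Longrightarrow> e a = \<eta> a"
  shows "free_completion T T' hom S Q e"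
  unfolding free_completion_def
proof (intro conjI allI impI ballI)
  show "meet_semilattice S" by (rule semilattice)
  show "T Q" by fact
  have "\<top>\<^bsub>S\<^esub> \<in> carrier S" "\<And>a b. \<lbrakk>a \<in> carrier S; b \<in> carrier S\<rbrakk> \<Longrightarrow> a \<sqinter>\<^bsub>S\<^esub> b \<in> carrier S"
    using S.top_props S.meet_props by blast+
  then show "e \<in> semilattice_hom S Q" using \<eta>_hom e by (auto simp: semilattice_hom_def)
  fix L f assume L: "T' L" and f: "f \<in> semilattice_hom S L"
  show "\<exists>!h. h \<in> hom Q L \<and> h \<in> extensional (carrier Q) \<and> (\<forall>a \<in> carrier S. h (e a) = f a)"
  proof (rule ex_ex1I)
    show "\<exists>h. h \<in> hom Q L \<and> h \<in> extensional (carrier Q) \<and> (\<forall>a \<in> carrier S. h (e a) = f a)"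
      using extension_exists[OF TL[OF L] f JL[OF L _ f]] e hom[OF L] by auto
    fix h k
    assume h: "h \<in> hom Q L \<and> h \<in> extensional (carrier Q) \<and> (\<forall>a \<in> carrier S. h (e a) = f a)"
      and k: "k \<in> hom Q L \<and> k \<in> extensional (carrier Q) \<and> (\<forall>a \<in> carrier S. k (e a) = f a)"
    show "h = k"
    proof (rule extensionalityI[where A = "carrier Q"])
      fix x assume "x \<in> carrier Q"
      then obtain W where W: "W \<in> Low" "x = \<Psi> W" by (auto simp: carrier_Q)
      then show "h x = k x"
        using extension_unique[of h L f W] extension_unique[of k L f W] h k e hom[OF L] by simp
    qed (use h k in auto)
  qed
qed

end

section \<open>Finite, directed and arbitrary suprema\<close>

lemma directed_image:
  assumes "directed K U" "f ` U \<subseteq> carrier L"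
    and "\<And>a b. \<lbrakk>a \<in> U; b \<in> U; a \<sqsubseteq>\<^bsub>K\<^esub> b\<rbrakk> \<Longrightarrow> f a \<sqsubseteq>\<^bsub>L\<^esub> f b"
  shows "directed L (f ` U)"
  unfolding directed_def
proof (intro conjI ballI)
  fix x y assume "x \<in> f ` U" "y \<in> f ` U"
  then obtain a b where ab: "a \<in> U" "b \<in> U" "x = f a" "y = f b" by blast
  obtain c where c: "c \<in> U" "a \<sqsubseteq>\<^bsub>K\<^esub> c" "b \<sqsubseteq>\<^bsub>K\<^esub> c"
    using assms(1) ab(1,2) unfolding directed_def by blast
  then show "\<exists>z \<in> f ` U. x \<sqsubseteq>\<^bsub>L\<^esub> z \<and> y \<sqsubseteq>\<^bsub>L\<^esub> z"
    using assms(3)[OF ab(1) c(1,2)] assms(3)[OF ab(2) c(1,3)] by (intro bexI[of _ "f c"]) (simp_all add: ab)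
qed (rule assms(2))

lemma (in partial_order) below_maximal:
  assumes "finite F" "F \<subseteq> carrier L" "x \<in> F"
  shows "\<exists>m \<in> F. x \<sqsubseteq> m \<and> (\<forall>y \<in> F. m \<sqsubseteq> y \<longrightarrow> y = m)"
  using assms(3)
proof (induction "card {y \<in> F. x \<sqsubseteq> y}" arbitrary: x rule: less_induct)
  case less
  have xc: "x \<in> carrier L" using less.prems assms(2) by blast
  show ?case
  proof (cases "\<forall>y \<in> F. x \<sqsubseteq> y \<longrightarrow> y = x")
    case True
    then show ?thesis using less.prems le_refl[OF xc] by blast
  next
    case False
    then obtain y where y: "y \<in> F" "x \<sqsubseteq> y" "y \<noteq> x" by blast
    have yc: "y \<in> carrier L" using y assms(2) by blast
    have "{z \<in> F. y \<sqsubseteq> z} \<subseteq> {z \<in> F. x \<sqsubseteq> z}" using le_trans[OF y(2) _ xc yc] assms(2) by blast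
    moreover have "x \<notin> {z \<in> F. y \<sqsubseteq> z}" using le_antisym[OF y(2) _ xc yc] y(3) by blast
    moreover have "x \<in> {z \<in> F. x \<sqsubseteq> z}" using less.prems le_refl[OF xc] by blast
    ultimately have "{z \<in> F. y \<sqsubseteq> z} \<subset> {z \<in> F. x \<sqsubseteq> z}" by blast
    then have "card {z \<in> F. y \<sqsubseteq> z} < card {z \<in> F. x \<sqsubseteq> z}"
      by (rule psubset_card_mono[rotated]) (simp add: assms(1))
    then obtain m where m: "m \<in> F" "y \<sqsubseteq> m" "\<forall>z \<in> F. m \<sqsubseteq> z \<longrightarrow> z = m"
      using less.hyps[OF _ y(1)] by blast
    have "x \<sqsubseteq> m" using le_trans[OF y(2) m(2) xc yc] m(1) assms(2) by blast
    then show ?thesis using m by blast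
  qed
qed

text \<open>The bounding elements need not be maximal: in a finite set every element lies below a maximal
  one, and maximality within the bounding set implies maximality in \<open>U\<close>. In this form being finitely
  bounded is visibly stable under monotone images and finite unions.\<close>

lemma finitely_bounded_iff:
  fixes L :: "'l gorder" (structure)
  assumes "partial_order L"
  shows "finitely_bounded L U \<longleftrightarrow> U \<subseteq> carrier L \<and> (\<exists>F. finite F \<and> F \<subseteq> U \<and> (\<forall>u \<in> U. \<exists>m \<in> F. u \<sqsubseteq> m))"
proof
  interpret partial_order L by fact
  show "finitely_bounded L U \<Longrightarrow> U \<subseteq> carrier L \<and> (\<exists>F. finite F \<and> F \<subseteq> U \<and> (\<forall>u \<in> U. \<exists>m \<in> F. u \<sqsubseteq> m))"
  proof -
    assume "finitely_bounded L U"
    then obtain M where "U \<subseteq> carrier L" "finite M" "M \<subseteq> {m \<in> U. \<forall>u \<in> U. m \<sqsubseteq> u \<longrightarrow> u = m}"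
      "\<forall>u \<in> U. \<exists>m \<in> M. u \<sqsubseteq> m"
      unfolding finitely_bounded_def by (elim conjE exE) (rule that)
    moreover from this(3) have "M \<subseteq> U" by auto
    ultimately show ?thesis by (intro conjI exI[of _ M]) simp_all
  qed
next
  interpret partial_order L by fact
  assume "U \<subseteq> carrier L \<and> (\<exists>F. finite F \<and> F \<subseteq> U \<and> (\<forall>u \<in> U. \<exists>m \<in> F. u \<sqsubseteq> m))"
  then obtain F where U: "U \<subseteq> carrier L" and F: "finite F" "F \<subseteq> U" "\<forall>u \<in> U. \<exists>m \<in> F. u \<sqsubseteq> m"
    by blast
  have Fc: "F \<subseteq> carrier L" using F(2) U by blast
  let ?M = "{m \<in> F. \<forall>y \<in> F. m \<sqsubseteq> y \<longrightarrow> y = m}"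
  have "u = m" if m: "m \<in> ?M" and u: "u \<in> U" "m \<sqsubseteq> u" for m u
  proof -
    obtain k where k: "k \<in> F" "u \<sqsubseteq> k" using F(3) u(1) by blast
    have c: "m \<in> carrier L" "u \<in> carrier L" "k \<in> carrier L" using m u k Fc U by blast+
    have "m \<sqsubseteq> k" by (rule le_trans[OF u(2) k(2) c])
    then have "k = m" using m k(1) by blast
    then show ?thesis using le_antisym[OF _ u(2) c(2,1)] k(2) by blast
  qed
  then have "?M \<subseteq> {m \<in> U. \<forall>u \<in> U. m \<sqsubseteq> u \<longrightarrow> u = m}" using F(2) by blast
  moreover have "\<exists>m \<in> ?M. u \<sqsubseteq> m" if u: "u \<in> U" for u
  proof -
    obtain k where k: "k \<in> F" "u \<sqsubseteq> k" using F(3) u by blast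
    obtain m where m: "m \<in> ?M" "k \<sqsubseteq> m" using below_maximal[OF F(1) Fc k(1)] by blast
    have c: "u \<in> carrier L" "k \<in> carrier L" "m \<in> carrier L" using m u k Fc U by blast+
    show ?thesis using le_trans[OF k(2) m(2) c] m(1) by blast
  qed
  ultimately show "finitely_bounded L U"
    unfolding finitely_bounded_def using F(1) U by (intro conjI exI[of _ ?M]) simp_all
qed

lemma finitely_bounded_finite:
  assumes "partial_order L" "finite F" "F \<subseteq> carrier L"
  shows "finitely_bounded L F"
proof -
  interpret L: partial_order L by fact
  have "\<forall>u \<in> F. \<exists>m \<in> F. u \<sqsubseteq>\<^bsub>L\<^esub> m" using L.le_refl assms(3) by (intro ballI) (rule bexI, auto)
  with assms(2,3) show ?thesis
    unfolding finitely_bounded_iff[OF assms(1)] by (intro conjI exI[of _ F]) simp_all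
qed

lemma finitely_bounded_image:
  assumes "partial_order L" "finitely_bounded K U" "f ` U \<subseteq> carrier L"
    and "\<And>a b. \<lbrakk>a \<in> U; b \<in> U; a \<sqsubseteq>\<^bsub>K\<^esub> b\<rbrakk> \<Longrightarrow> f a \<sqsubseteq>\<^bsub>L\<^esub> f b"
  shows "finitely_bounded L (f ` U)"
proof -
  interpret L: partial_order L by fact
  obtain M where M: "finite M" "M \<subseteq> U" "\<forall>u \<in> U. \<exists>m \<in> M. u \<sqsubseteq>\<^bsub>K\<^esub> m"
  proof -
    obtain M where M: "finite M" "M \<subseteq> {m \<in> U. \<forall>u \<in> U. m \<sqsubseteq>\<^bsub>K\<^esub> u \<longrightarrow> u = m}" "\<forall>u \<in> U. \<exists>m \<in> M. u \<sqsubseteq>\<^bsub>K\<^esub> m"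
      using assms(2) unfolding finitely_bounded_def by (elim conjE exE) (rule that)
    moreover from M(2) have "M \<subseteq> U" by auto
    ultimately show thesis by (intro that)
  qed
  have "\<forall>v \<in> f ` U. \<exists>m \<in> f ` M. v \<sqsubseteq>\<^bsub>L\<^esub> m"
  proof
    fix v assume "v \<in> f ` U"
    then obtain u where u: "u \<in> U" "v = f u" by blast
    obtain m where m: "m \<in> M" "u \<sqsubseteq>\<^bsub>K\<^esub> m" using M(3) u(1) by blast
    then show "\<exists>m \<in> f ` M. v \<sqsubseteq>\<^bsub>L\<^esub> m" using assms(4)[of u m] u M(2) by blast
  qed
  then show ?thesis
    unfolding finitely_bounded_iff[OF L.partial_order_axioms] using assms(3) M(1,2) by (intro conjI exI[of _ "f ` M"]) auto
qed

lemma finitely_bounded_down: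
  assumes "partial_order S" "finitely_bounded S V"
  shows "finitely_bounded S (down S V)"
proof -
  interpret S: partial_order S by fact
  obtain F where V: "V \<subseteq> carrier S" and F: "finite F" "F \<subseteq> V" "\<forall>u \<in> V. \<exists>m \<in> F. u \<sqsubseteq>\<^bsub>S\<^esub> m"
    using assms(2) unfolding finitely_bounded_iff[OF S.partial_order_axioms] by blast
  have "F \<subseteq> down S V" using F(2) V S.le_refl unfolding down_def by blast
  moreover have "\<exists>m \<in> F. u \<sqsubseteq>\<^bsub>S\<^esub> m" if u: "u \<in> down S V" for u
  proof -
    obtain b where b: "b \<in> V" "u \<sqsubseteq>\<^bsub>S\<^esub> b" "u \<in> carrier S" using u unfolding down_def by blast
    obtain m where m: "m \<in> F" "b \<sqsubseteq>\<^bsub>S\<^esub> m" using F(3) b(1) by blast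
    have c: "b \<in> carrier S" "m \<in> carrier S" using b m F(2) V by blast+
    show ?thesis using S.le_trans[OF b(2) m(2) b(3) c] m(1) by blast
  qed
  ultimately show ?thesis
    unfolding finitely_bounded_iff[OF S.partial_order_axioms] using F(1) by (auto simp: down_def)
qed

lemma directed_down:
  assumes "partial_order S" "directed S V"
  shows "directed S (down S V)"
  unfolding directed_def
proof (intro conjI ballI)
  interpret S: partial_order S by fact
  have V: "V \<subseteq> carrier S" using assms(2) by (simp add: directed_def)
  show "down S V \<subseteq> carrier S" by (auto simp: down_def)
  fix a b assume "a \<in> down S V" "b \<in> down S V"
  then obtain a' b' where a: "a \<in> carrier S" "a' \<in> V" "a \<sqsubseteq>\<^bsub>S\<^esub> a'" and b: "b \<in> carrier S" "b' \<in> V" "b \<sqsubseteq>\<^bsub>S\<^esub> b'"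
    unfolding down_def by blast
  obtain c where c: "c \<in> V" "a' \<sqsubseteq>\<^bsub>S\<^esub> c" "b' \<sqsubseteq>\<^bsub>S\<^esub> c" using assms(2) a(2) b(2) unfolding directed_def by blast
  have car: "a' \<in> carrier S" "b' \<in> carrier S" "c \<in> carrier S" using a b c V by blast+
  have "a \<sqsubseteq>\<^bsub>S\<^esub> c" "b \<sqsubseteq>\<^bsub>S\<^esub> c"
    using S.le_trans[OF a(3) c(2) a(1) car(1,3)] S.le_trans[OF b(3) c(3) b(1) car(2,3)] by simp_all
  moreover have "c \<in> down S V" using c(1) car(3) S.le_refl unfolding down_def by blast
  ultimately show "\<exists>c \<in> down S V. a \<sqsubseteq>\<^bsub>S\<^esub> c \<and> b \<sqsubseteq>\<^bsub>S\<^esub> c" by blast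
qed

context lower_set_order
begin

lemma principal_image:
  assumes J: "\<And>a. a \<in> carrier S \<Longrightarrow> JS (down S {a})" and W: "W \<in> Low"
  shows "\<eta> ` W \<subseteq> carrier Q" and "\<lbrakk>a \<in> W; b \<in> W; a \<sqsubseteq>\<^bsub>S\<^esub> b\<rbrakk> \<Longrightarrow> \<eta> a \<sqsubseteq>\<^bsub>Q\<^esub> \<eta> b"
proof -
  have WS: "W \<subseteq> carrier S" by (rule LowD(1)[OF W])
  have L: "down S {a} \<in> Low" if "a \<in> W" for a
  proof -
    have a: "a \<in> carrier S" using WS that by blast
    show ?thesis by (rule LowI[OF _ J[OF a]]) (use S.le_trans a in \<open>auto simp: down_def\<close>)
  qed
  show "\<eta> ` W \<subseteq> carrier Q" by (rule image_subsetI, rule \<Psi>_carrier, erule L)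
  assume ab: "a \<in> W" "b \<in> W" "a \<sqsubseteq>\<^bsub>S\<^esub> b"
  then have "a \<in> carrier S" "b \<in> carrier S" using WS by blast+
  then have "down S {a} \<subseteq> down S {b}" using S.le_trans[of _ a b] ab(3) by (auto simp: down_def)
  then show "\<eta> a \<sqsubseteq>\<^bsub>Q\<^esub> \<eta> b" using le_Q[OF L[OF ab(1)] L[OF ab(2)]] by simp
qed

lemma hom_image:
  assumes L: "meet_semilattice L" and f: "f \<in> semilattice_hom S L" and W: "W \<in> Low"
  shows "f ` W \<subseteq> carrier L" and "\<lbrakk>a \<in> W; b \<in> W; a \<sqsubseteq>\<^bsub>S\<^esub> b\<rbrakk> \<Longrightarrow> f a \<sqsubseteq>\<^bsub>L\<^esub> f b"
proof -
  have WS: "W \<subseteq> carrier S" by (rule LowD(1)[OF W])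
  then show "f ` W \<subseteq> carrier L" using f by (auto simp: semilattice_hom_def)
  assume "a \<in> W" "b \<in> W" "a \<sqsubseteq>\<^bsub>S\<^esub> b"
  then show "f a \<sqsubseteq>\<^bsub>L\<^esub> f b" using WS by (intro semilattice_hom_mono[OF semilattice L f]) blast+
qed

end

lemma lower_set_completion_all:
  assumes "lower_set_order S Q (\<lambda>_. True) \<Psi>"
  shows "lower_set_completion S Q (\<lambda>_. True) \<Psi> (\<lambda>_. True)"
  using assms by (simp add: lower_set_completion_def lower_set_completion_axioms_def)

text \<open>Upper bounds in the intersection of two directed lower sets are meets of upper bounds in each.\<close>

lemma lower_set_completion_directed:
  assumes "lower_set_order S Q (directed S) \<Psi>"
  shows "lower_set_completion S Q (directed S) \<Psi> (directed Q)"
proof -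
  interpret lower_set_order S Q "directed S" \<Psi> by fact
  have principal: "directed S (down S {a})" if a: "a \<in> carrier S" for a
    by (rule directed_down[OF S.partial_order_axioms]) (use a in \<open>simp add: directed_def\<close>)
  show ?thesis
  proof unfold_locales
    fix V W assume V: "V \<in> Low" and W: "W \<in> Low"
    show "directed S (V \<inter> W)"
      unfolding directed_def
    proof (intro conjI ballI)
      show "V \<inter> W \<subseteq> carrier S" using LowD(1)[OF V] by blast
      fix a b assume a: "a \<in> V \<inter> W" and b: "b \<in> V \<inter> W"
      obtain c where c: "c \<in> V" "a \<sqsubseteq>\<^bsub>S\<^esub> c" "b \<sqsubseteq>\<^bsub>S\<^esub> c" using LowD(2)[OF V] a b unfolding directed_def by blast
      obtain d where d: "d \<in> W" "a \<sqsubseteq>\<^bsub>S\<^esub> d" "b \<sqsubseteq>\<^bsub>S\<^esub> d" using LowD(2)[OF W] a b unfolding directed_def by blast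
      have car: "a \<in> carrier S" "b \<in> carrier S" "c \<in> carrier S" "d \<in> carrier S"
        using LowD(1)[OF V] LowD(1)[OF W] a b c d by blast+
      note m = S.meet_props(1-3)[OF car(3,4)]
      have "c \<sqinter>\<^bsub>S\<^esub> d \<in> V \<inter> W" using LowD(3)[OF V c(1) m(1,2)] LowD(3)[OF W d(1) m(1,3)] by simp
      moreover have "a \<sqsubseteq>\<^bsub>S\<^esub> c \<sqinter>\<^bsub>S\<^esub> d" "b \<sqsubseteq>\<^bsub>S\<^esub> c \<sqinter>\<^bsub>S\<^esub> d"
        using S.le_meet_iff[OF car(3,4,1)] S.le_meet_iff[OF car(3,4,2)] c d by simp_all
      ultimately show "\<exists>c \<in> V \<inter> W. a \<sqsubseteq>\<^bsub>S\<^esub> c \<and> b \<sqsubseteq>\<^bsub>S\<^esub> c" by blast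
    qed
  next
    fix \<V> assume V: "\<V> \<subseteq> Low" and dir: "directed Q (\<Psi> ` \<V>)"
    show "directed S (\<Union>\<V>)"
      unfolding directed_def
    proof (intro conjI ballI)
      show "\<Union>\<V> \<subseteq> carrier S" using LowD(1) V by blast
      fix a b assume "a \<in> \<Union>\<V>" "b \<in> \<Union>\<V>"
      then obtain A B where AB: "A \<in> \<V>" "a \<in> A" "B \<in> \<V>" "b \<in> B" by blast
      obtain D where D: "D \<in> \<V>" "\<Psi> A \<sqsubseteq>\<^bsub>Q\<^esub> \<Psi> D" "\<Psi> B \<sqsubseteq>\<^bsub>Q\<^esub> \<Psi> D"
        using dir AB(1,3) unfolding directed_def by blast
      have L: "A \<in> Low" "B \<in> Low" "D \<in> Low" using V AB D by blast+
      have "a \<in> D" "b \<in> D" using D(2,3) le_Q[OF L(1,3)] le_Q[OF L(2,3)] AB by blast+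
      then obtain c where "c \<in> D" "a \<sqsubseteq>\<^bsub>S\<^esub> c" "b \<sqsubseteq>\<^bsub>S\<^esub> c" using LowD(2)[OF L(3)] unfolding directed_def by blast
      then show "\<exists>c \<in> \<Union>\<V>. a \<sqsubseteq>\<^bsub>S\<^esub> c \<and> b \<sqsubseteq>\<^bsub>S\<^esub> c" using D(1) by blast
    qed
  next
    fix W assume W: "W \<in> Low"
    show "directed Q ((\<lambda>a. \<Psi> (down S {a})) ` W)"
      by (rule directed_image[OF LowD(2)[OF W] principal_image[OF principal W]])
  qed (rule principal)
qed

text \<open>The intersection of two finitely generated lower sets is generated by the meets of generators.\<close>

lemma lower_set_completion_finite:
  assumes "lower_set_order S Q (finitely_bounded S) \<Psi>"
  shows "lower_set_completion S Q (finitely_bounded S) \<Psi> (finitely_bounded Q)"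
proof -
  interpret lower_set_order S Q "finitely_bounded S" \<Psi> by fact
  have principal: "finitely_bounded S (down S {a})" if a: "a \<in> carrier S" for a
    by (rule finitely_bounded_down[OF S.partial_order_axioms finitely_bounded_finite[OF S.partial_order_axioms]]) (use a in simp_all)
  show ?thesis
  proof unfold_locales
    fix V W assume V: "V \<in> Low" and W: "W \<in> Low"
    obtain F where F: "finite F" "F \<subseteq> V" "\<forall>u \<in> V. \<exists>m \<in> F. u \<sqsubseteq>\<^bsub>S\<^esub> m"
      using LowD(2)[OF V] unfolding finitely_bounded_iff[OF S.partial_order_axioms] by blast
    obtain G where G: "finite G" "G \<subseteq> W" "\<forall>u \<in> W. \<exists>m \<in> G. u \<sqsubseteq>\<^bsub>S\<^esub> m"
      using LowD(2)[OF W] unfolding finitely_bounded_iff[OF S.partial_order_axioms] by blast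
    note VS = LowD(1)[OF V] and WS = LowD(1)[OF W]
    let ?H = "(\<lambda>(a, b). a \<sqinter>\<^bsub>S\<^esub> b) ` (F \<times> G)"
    have "a \<sqinter>\<^bsub>S\<^esub> b \<in> V \<inter> W" if "a \<in> F" "b \<in> G" for a b
    proof -
      have ab: "a \<in> V" "b \<in> W" "a \<in> carrier S" "b \<in> carrier S" using that F(2) G(2) VS WS by blast+
      note m = S.meet_props(1-3)[OF ab(3,4)]
      show ?thesis using LowD(3)[OF V ab(1) m(1,2)] LowD(3)[OF W ab(2) m(1,3)] by simp
    qed
    then have "?H \<subseteq> V \<inter> W" by auto
    moreover have "\<exists>m \<in> ?H. u \<sqsubseteq>\<^bsub>S\<^esub> m" if u: "u \<in> V \<inter> W" for u
    proof -
      obtain a where a: "a \<in> F" "u \<sqsubseteq>\<^bsub>S\<^esub> a" using F(3) u by blast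
      obtain b where b: "b \<in> G" "u \<sqsubseteq>\<^bsub>S\<^esub> b" using G(3) u by blast
      have car: "a \<in> carrier S" "b \<in> carrier S" "u \<in> carrier S" using a b u F(2) G(2) VS WS by blast+
      have "u \<sqsubseteq>\<^bsub>S\<^esub> a \<sqinter>\<^bsub>S\<^esub> b" using S.le_meet_iff[OF car] a b by simp
      then show ?thesis using a(1) b(1) by (intro bexI[of _ "a \<sqinter>\<^bsub>S\<^esub> b"]) auto
    qed
    moreover have "finite ?H" using F(1) G(1) by simp
    ultimately show "finitely_bounded S (V \<inter> W)"
      unfolding finitely_bounded_iff[OF S.partial_order_axioms] using VS by (intro conjI exI[of _ ?H]) auto
  next
    fix \<V> assume V: "\<V> \<subseteq> Low" and fin: "finitely_bounded Q (\<Psi> ` \<V>)"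
    obtain F where F: "finite F" "F \<subseteq> \<Psi> ` \<V>" "\<forall>u \<in> \<Psi> ` \<V>. \<exists>m \<in> F. u \<sqsubseteq>\<^bsub>Q\<^esub> m"
      using fin unfolding finitely_bounded_iff[OF Q.partial_order_axioms] by blast
    obtain \<F> where G: "\<F> \<subseteq> \<V>" "finite \<F>" "F = \<Psi> ` \<F>" using finite_subset_image[OF F(1,2)] by blast
    have cover: "\<exists>B \<in> \<F>. A \<subseteq> B" if A: "A \<in> \<V>" for A
    proof -
      obtain B where B: "B \<in> \<F>" "\<Psi> A \<sqsubseteq>\<^bsub>Q\<^esub> \<Psi> B" using F(3) A G(3) by blast
      have L: "A \<in> Low" "B \<in> Low" using A B(1) G(1) V by blast+
      show ?thesis using le_Q[OF L] B by blast
    qed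
    have "\<exists>H. finite H \<and> H \<subseteq> B \<and> (\<forall>u \<in> B. \<exists>m \<in> H. u \<sqsubseteq>\<^bsub>S\<^esub> m)" if B: "B \<in> \<F>" for B
    proof -
      have "B \<in> Low" using B G(1) V by blast
      from LowD(2)[OF this] show ?thesis unfolding finitely_bounded_iff[OF S.partial_order_axioms] by blast
    qed
    then obtain H where H: "\<And>B. B \<in> \<F> \<Longrightarrow> finite (H B) \<and> H B \<subseteq> B \<and> (\<forall>u \<in> B. \<exists>m \<in> H B. u \<sqsubseteq>\<^bsub>S\<^esub> m)"
      by metis
    let ?H = "\<Union>B \<in> \<F>. H B"
    have "?H \<subseteq> \<Union>\<V>" using H G(1) by blast
    moreover have "finite ?H" using G(2) H by simp
    moreover have "\<exists>m \<in> ?H. u \<sqsubseteq>\<^bsub>S\<^esub> m" if "u \<in> \<Union>\<V>" for u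
    proof -
      obtain A where "A \<in> \<V>" "u \<in> A" using \<open>u \<in> \<Union>\<V>\<close> by blast
      then obtain B where B: "B \<in> \<F>" "u \<in> B" using cover by blast
      then obtain m where "m \<in> H B" "u \<sqsubseteq>\<^bsub>S\<^esub> m" using H[OF B(1)] by blast
      then show ?thesis using B(1) by blast
    qed
    moreover have "\<Union>\<V> \<subseteq> carrier S" using LowD(1) V by blast
    ultimately show "finitely_bounded S (\<Union>\<V>)"
      unfolding finitely_bounded_iff[OF S.partial_order_axioms] by (intro conjI exI[of _ ?H]) auto
  next
    fix W assume W: "W \<in> Low"
    show "finitely_bounded Q ((\<lambda>a. \<Psi> (down S {a})) ` W)"
      by (rule finitely_bounded_image[OF Q_partial_order LowD(2)[OF W] principal_image[OF principal W]])
  qed (rule principal)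
qed

lemma Upper_eqI:
  assumes "U \<subseteq> carrier L" "V \<subseteq> carrier L"
    and "\<And>y. y \<in> carrier L \<Longrightarrow> (\<forall>u \<in> U. u \<sqsubseteq>\<^bsub>L\<^esub> y) \<longleftrightarrow> (\<forall>u \<in> V. u \<sqsubseteq>\<^bsub>L\<^esub> y)"
  shows "Upper L U = Upper L V"
proof -
  have "Upper L W = {y \<in> carrier L. \<forall>u \<in> W. u \<sqsubseteq>\<^bsub>L\<^esub> y}" if "W \<subseteq> carrier L" for W
    using that by (auto simp: Upper_def)
  then show ?thesis using assms by (simp cong: conj_cong)
qed

lemma least_Upper_cofinal:
  assumes "partial_order L" and U: "U \<subseteq> carrier L" "F \<subseteq> U" "\<forall>u \<in> U. \<exists>m \<in> F. u \<sqsubseteq>\<^bsub>L\<^esub> m"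
  shows "least L s (Upper L U) \<longleftrightarrow> least L s (Upper L F)"
proof -
  interpret L: partial_order L by fact
  have "(\<forall>u \<in> U. u \<sqsubseteq>\<^bsub>L\<^esub> y) \<longleftrightarrow> (\<forall>u \<in> F. u \<sqsubseteq>\<^bsub>L\<^esub> y)" if y: "y \<in> carrier L" for y
  proof
    assume F: "\<forall>u \<in> F. u \<sqsubseteq>\<^bsub>L\<^esub> y"
    show "\<forall>u \<in> U. u \<sqsubseteq>\<^bsub>L\<^esub> y"
    proof
      fix u assume u: "u \<in> U"
      then obtain m where m: "m \<in> F" "u \<sqsubseteq>\<^bsub>L\<^esub> m" using U(3) by blast
      have c: "u \<in> carrier L" "m \<in> carrier L" using u m U by blast+
      show "u \<sqsubseteq>\<^bsub>L\<^esub> y" using L.le_trans[OF m(2) _ c y] F m(1) by blast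
    qed
  qed (use U(2) in blast)
  moreover have "F \<subseteq> carrier L" using U by blast
  ultimately have "Upper L U = Upper L F" using U(1) by (rule_tac Upper_eqI)
  then show ?thesis by simp
qed

lemma (in meet_semilattice) meet_mono:
  assumes "x \<in> carrier L" "a \<in> carrier L" "b \<in> carrier L" "a \<sqsubseteq> b"
  shows "x \<sqinter> a \<sqsubseteq> x \<sqinter> b"
proof -
  note m = meet_props(1-3)[OF assms(1,2)]
  have "x \<sqinter> a \<sqsubseteq> b" by (rule le_trans[OF m(3) assms(4) m(1) assms(2,3)])
  then show ?thesis using le_meet_iff[OF assms(1,3) m(1)] m(2) by simp
qed

lemma sup_distributiveI:
  assumes "meet_semilattice L"
    and "\<And>U. \<lbrakk>U \<subseteq> carrier L; J U\<rbrakk> \<Longrightarrow> \<exists>s. least L s (Upper L U) \<and>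
      (\<forall>x \<in> carrier L. least L (x \<sqinter>\<^bsub>L\<^esub> s) (Upper L ((\<lambda>u. x \<sqinter>\<^bsub>L\<^esub> u) ` U)))"
  shows "sup_distributive L J"
  using assms by (simp add: sup_distributive_def)

text \<open>In a frame all suprema are given; conversely infima arise as suprema of sets of lower bounds.\<close>

lemma frame_iff: "frame L \<longleftrightarrow> sup_distributive L (\<lambda>_. True)"
proof
  assume "frame L"
  then interpret L: frame L .
  have M: "meet_semilattice L" by unfold_locales
  interpret M: meet_semilattice L by (rule M)
  have dist: "least L (x \<sqinter>\<^bsub>L\<^esub> \<Squnion>\<^bsub>L\<^esub>U) (Upper L ((\<lambda>u. x \<sqinter>\<^bsub>L\<^esub> u) ` U))"
    if "U \<subseteq> carrier L" "x \<in> carrier L" for U x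
    unfolding L.meet_sup_distrib[OF that(2,1)]
    by (rule L.sup_lub) (use that M.meet_props(1) in auto)
  show "sup_distributive L (\<lambda>_. True)"
    by (rule sup_distributiveI[OF M], rule exI, rule conjI, erule L.sup_lub, rule ballI, erule dist)
next
  assume sd: "sup_distributive L (\<lambda>_. True)"
  interpret M: meet_semilattice L using sd unfolding sup_distributive_def by blast
  note lub = sup_distributiveD[OF sd _ TrueI]
  show "frame L"
  proof unfold_locales
    fix A assume A: "A \<subseteq> carrier L"
    show "\<exists>s. least L s (Upper L A)" using lub(1)[OF A] by blast
    have low: "Lower L A \<subseteq> carrier L" by simp
    have s: "\<Squnion>\<^bsub>L\<^esub>Lower L A \<in> carrier L" "\<And>u. u \<in> Lower L A \<Longrightarrow> u \<sqsubseteq>\<^bsub>L\<^esub> \<Squnion>\<^bsub>L\<^esub>Lower L A"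
      "\<And>y. \<lbrakk>y \<in> carrier L; \<And>u. u \<in> Lower L A \<Longrightarrow> u \<sqsubseteq>\<^bsub>L\<^esub> y\<rbrakk> \<Longrightarrow> \<Squnion>\<^bsub>L\<^esub>Lower L A \<sqsubseteq>\<^bsub>L\<^esub> y"
      using lub(1)[OF low] unfolding least_Upper_iff[OF low] by simp_all
    have "\<Squnion>\<^bsub>L\<^esub>Lower L A \<sqsubseteq>\<^bsub>L\<^esub> a" if a: "a \<in> A" for a
      by (rule s(3)) (use a A in \<open>auto simp: Lower_def\<close>)
    moreover have "y \<sqsubseteq>\<^bsub>L\<^esub> \<Squnion>\<^bsub>L\<^esub>Lower L A" if "y \<in> carrier L" "\<forall>u \<in> A. y \<sqsubseteq>\<^bsub>L\<^esub> u" for y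
      by (rule s(2)) (use that in \<open>auto simp: Lower_def\<close>)
    ultimately show "\<exists>i. greatest L i (Lower L A)"
      using s(1) by (intro exI[of _ "\<Squnion>\<^bsub>L\<^esub>Lower L A"]) (simp add: greatest_Lower_iff[OF A])
  next
    fix x U assume x: "x \<in> carrier L" and U: "U \<subseteq> carrier L"
    show "x \<sqinter>\<^bsub>L\<^esub> \<Squnion>\<^bsub>L\<^esub>U = \<Squnion>\<^bsub>L\<^esub>((\<lambda>u. x \<sqinter>\<^bsub>L\<^esub> u) ` U)"
      by (rule M.sup_eqI[OF lub(2)[OF U x], symmetric])
  qed
qed

lemma preframe_iff: "preframe L \<longleftrightarrow> sup_distributive L (directed L)"
proof
  assume "preframe L"
  then interpret L: preframe L .
  have lub: "least L (\<Squnion>\<^bsub>L\<^esub>U) (Upper L U)" if U: "directed L U" for U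
  proof -
    obtain s where "least L s (Upper L U)" using L.directed_sup_exists[OF U] by blast
    then show ?thesis by (simp add: L.sup_eqI)
  qed
  have dist: "least L (x \<sqinter>\<^bsub>L\<^esub> \<Squnion>\<^bsub>L\<^esub>U) (Upper L ((\<lambda>u. x \<sqinter>\<^bsub>L\<^esub> u) ` U))"
    if U: "directed L U" and x: "x \<in> carrier L" for U x
    unfolding L.meet_directed_sup_distrib[OF x U]
  proof (rule lub[OF directed_image[OF U]])
    have UL: "U \<subseteq> carrier L" using U by (simp add: directed_def)
    then show "(\<lambda>u. x \<sqinter>\<^bsub>L\<^esub> u) ` U \<subseteq> carrier L" using L.meet_props(1)[OF x] by auto
    fix a b assume "a \<in> U" "b \<in> U" "a \<sqsubseteq>\<^bsub>L\<^esub> b"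
    then show "x \<sqinter>\<^bsub>L\<^esub> a \<sqsubseteq>\<^bsub>L\<^esub> x \<sqinter>\<^bsub>L\<^esub> b" using UL by (intro L.meet_mono[OF x]) blast+
  qed
  show "sup_distributive L (directed L)"
    by (rule sup_distributiveI[OF L.meet_semilattice_axioms], rule exI, rule conjI, erule lub, rule ballI,
        erule dist)
next
  assume sd: "sup_distributive L (directed L)"
  interpret M: meet_semilattice L using sd unfolding sup_distributive_def by blast
  show "preframe L"
  proof unfold_locales
    fix U assume U: "directed L U"
    then have UL: "U \<subseteq> carrier L" by (simp add: directed_def)
    show "\<exists>s. least L s (Upper L U)" using sup_distributiveD(1)[OF sd UL U] by blast
    fix x assume x: "x \<in> carrier L"
    show "x \<sqinter>\<^bsub>L\<^esub> \<Squnion>\<^bsub>L\<^esub>U = \<Squnion>\<^bsub>L\<^esub>((\<lambda>u. x \<sqinter>\<^bsub>L\<^esub> u) ` U)"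
      by (rule M.sup_eqI[OF sup_distributiveD(2)[OF sd UL U x], symmetric])
  qed
qed

lemma (in partial_order) least_Upper_insert:
  assumes F: "F \<subseteq> carrier L" "least L t (Upper L F)" and a: "a \<in> carrier L"
  shows "least L s (Upper L (insert a F)) \<longleftrightarrow> least L s (Upper L {a, t})"
proof -
  have t: "t \<in> carrier L" "\<forall>u \<in> F. u \<sqsubseteq> t" "\<forall>y \<in> carrier L. (\<forall>u \<in> F. u \<sqsubseteq> y) \<longrightarrow> t \<sqsubseteq> y"
    using F(2) unfolding least_Upper_iff[OF F(1)] by blast+
  have "(\<forall>u \<in> insert a F. u \<sqsubseteq> y) \<longleftrightarrow> (\<forall>u \<in> {a, t}. u \<sqsubseteq> y)" if y: "y \<in> carrier L" for y
  proof -
    have "u \<sqsubseteq> y" if "t \<sqsubseteq> y" "u \<in> F" for u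
    proof (rule le_trans[OF _ that(1) _ t(1) y])
      show "u \<sqsubseteq> t" using t(2) that(2) by blast
      show "u \<in> carrier L" using F(1) that(2) by blast
    qed
    then have "(\<forall>u \<in> F. u \<sqsubseteq> y) \<longleftrightarrow> t \<sqsubseteq> y" using bspec[OF t(3) y] by blast
    then show ?thesis by simp
  qed
  moreover have "insert a F \<subseteq> carrier L" "{a, t} \<subseteq> carrier L" using F(1) a t(1) by blast+
  ultimately have "Upper L (insert a F) = Upper L {a, t}" by (rule_tac Upper_eqI)
  then show ?thesis by simp
qed

text \<open>A finitely bounded set has the same supremum as any finite set bounding it, and for finite sets
  the claim follows by induction from binary joins and the bottom element.\<close>

lemma distributive_lattice_iff: "distributive_lattice L \<longleftrightarrow> sup_distributive L (finitely_bounded L)"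
proof
  assume "distributive_lattice L"
  then interpret L: distributive_lattice L .
  have M: "meet_semilattice L" by unfold_locales
  interpret M: meet_semilattice L by (rule M)
  have bot: "least L \<bottom>\<^bsub>L\<^esub> (Upper L {})"
    using L.bottom_exists L.bottom_eqI by auto
  have join: "least L (y \<squnion>\<^bsub>L\<^esub> z) (Upper L {y, z})" if "y \<in> carrier L" "z \<in> carrier L" for y z
    unfolding join_def by (rule L.sup_of_two_least[OF that])
  have fin: "\<exists>s. least L s (Upper L F) \<and> (\<forall>x \<in> carrier L. least L (x \<sqinter>\<^bsub>L\<^esub> s) (Upper L ((\<lambda>u. x \<sqinter>\<^bsub>L\<^esub> u) ` F)))"
    if "finite F" "F \<subseteq> carrier L" for F
    using that
  proof (induction F rule: finite_induct)
    case empty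
    have b: "\<bottom>\<^bsub>L\<^esub> \<in> carrier L" "\<And>y. y \<in> carrier L \<Longrightarrow> \<bottom>\<^bsub>L\<^esub> \<sqsubseteq>\<^bsub>L\<^esub> y"
      using bot by (auto simp: least_Upper_iff)
    have "x \<sqinter>\<^bsub>L\<^esub> \<bottom>\<^bsub>L\<^esub> = \<bottom>\<^bsub>L\<^esub>" if x: "x \<in> carrier L" for x
      by (rule M.meet_eqI[OF x b(1) b(1) b(2)[OF x] b(2)[OF b(1)]])
    then have "\<forall>x \<in> carrier L. least L (x \<sqinter>\<^bsub>L\<^esub> \<bottom>\<^bsub>L\<^esub>) (Upper L ((\<lambda>u. x \<sqinter>\<^bsub>L\<^esub> u) ` {}))"
      using bot by simp
    then show ?case using bot by blast
  next
    case (insert a F)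
    have a: "a \<in> carrier L" and F: "F \<subseteq> carrier L" using insert.prems by auto
    obtain t where t: "least L t (Upper L F)"
      and d: "\<forall>x \<in> carrier L. least L (x \<sqinter>\<^bsub>L\<^esub> t) (Upper L ((\<lambda>u. x \<sqinter>\<^bsub>L\<^esub> u) ` F))"
      using insert.IH[OF F] by blast
    have tc: "t \<in> carrier L" using t unfolding least_Upper_iff[OF F] by blast
    have "least L (a \<squnion>\<^bsub>L\<^esub> t) (Upper L (insert a F))"
      unfolding L.least_Upper_insert[OF F t a] by (rule join[OF a tc])
    moreover have "least L (x \<sqinter>\<^bsub>L\<^esub> (a \<squnion>\<^bsub>L\<^esub> t)) (Upper L ((\<lambda>u. x \<sqinter>\<^bsub>L\<^esub> u) ` insert a F))"
      if x: "x \<in> carrier L" for x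
    proof -
      have F': "(\<lambda>u. x \<sqinter>\<^bsub>L\<^esub> u) ` F \<subseteq> carrier L" using M.meet_props(1)[OF x] F by auto
      show ?thesis
        unfolding image_insert L.least_Upper_insert[OF F' bspec[OF d x] M.meet_props(1)[OF x a]]
          L.meet_join_distrib[OF x a tc]
        by (rule join[OF M.meet_props(1)[OF x a] M.meet_props(1)[OF x tc]])
    qed
    ultimately show ?case by blast
  qed
  have "\<exists>s. least L s (Upper L U) \<and> (\<forall>x \<in> carrier L. least L (x \<sqinter>\<^bsub>L\<^esub> s) (Upper L ((\<lambda>u. x \<sqinter>\<^bsub>L\<^esub> u) ` U)))"
    if fb: "finitely_bounded L U" for U
  proof -
    obtain F where U: "U \<subseteq> carrier L" and F: "finite F" "F \<subseteq> U" "\<forall>u \<in> U. \<exists>m \<in> F. u \<sqsubseteq>\<^bsub>L\<^esub> m"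
      using fb unfolding finitely_bounded_iff[OF L.partial_order_axioms] by blast
    obtain s where s: "least L s (Upper L F)"
      and d: "\<forall>x \<in> carrier L. least L (x \<sqinter>\<^bsub>L\<^esub> s) (Upper L ((\<lambda>u. x \<sqinter>\<^bsub>L\<^esub> u) ` F))"
      using fin[OF F(1) subset_trans[OF F(2) U]] by blast
    have "least L (x \<sqinter>\<^bsub>L\<^esub> s) (Upper L ((\<lambda>u. x \<sqinter>\<^bsub>L\<^esub> u) ` U))" if x: "x \<in> carrier L" for x
    proof -
      have 1: "(\<lambda>u. x \<sqinter>\<^bsub>L\<^esub> u) ` U \<subseteq> carrier L" using M.meet_props(1)[OF x] U by auto
      have 2: "(\<lambda>u. x \<sqinter>\<^bsub>L\<^esub> u) ` F \<subseteq> (\<lambda>u. x \<sqinter>\<^bsub>L\<^esub> u) ` U" by (rule image_mono[OF F(2)])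
      have 3: "\<forall>v \<in> (\<lambda>u. x \<sqinter>\<^bsub>L\<^esub> u) ` U. \<exists>m \<in> (\<lambda>u. x \<sqinter>\<^bsub>L\<^esub> u) ` F. v \<sqsubseteq>\<^bsub>L\<^esub> m"
      proof
        fix v assume "v \<in> (\<lambda>u. x \<sqinter>\<^bsub>L\<^esub> u) ` U"
        then obtain u where u: "u \<in> U" "v = x \<sqinter>\<^bsub>L\<^esub> u" by blast
        obtain m where m: "m \<in> F" "u \<sqsubseteq>\<^bsub>L\<^esub> m" using F(3) u(1) by blast
        have c: "u \<in> carrier L" "m \<in> carrier L" using u m F(2) U by blast+
        show "\<exists>m \<in> (\<lambda>u. x \<sqinter>\<^bsub>L\<^esub> u) ` F. v \<sqsubseteq>\<^bsub>L\<^esub> m"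
          unfolding u(2) by (intro bexI[of _ "x \<sqinter>\<^bsub>L\<^esub> m"] M.meet_mono[OF x c m(2)] imageI m(1))
      qed
      show ?thesis
        unfolding least_Upper_cofinal[OF L.partial_order_axioms 1 2 3] using d x by blast
    qed
    moreover have "least L s (Upper L U)"
      unfolding least_Upper_cofinal[OF L.partial_order_axioms U F(2,3)] by (rule s)
    ultimately show ?thesis by blast
  qed
  then show "sup_distributive L (finitely_bounded L)"
    by (intro sup_distributiveI[OF M])
next
  assume sd: "sup_distributive L (finitely_bounded L)"
  interpret M: meet_semilattice L using sd unfolding sup_distributive_def by blast
  note fin = finitely_bounded_finite[OF M.partial_order_axioms]
  show "distributive_lattice L"
  proof unfold_locales
    show "\<exists>s. least L s (Upper L {x, y})" if "x \<in> carrier L" "y \<in> carrier L" for x y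
      using sup_distributiveD(1)[OF sd _ fin, of "{x, y}"] that by auto
    show "\<exists>x. least L x (carrier L)"
      using sup_distributiveD(1)[OF sd _ fin, of "{}"] by auto
    show "x \<sqinter>\<^bsub>L\<^esub> (y \<squnion>\<^bsub>L\<^esub> z) = x \<sqinter>\<^bsub>L\<^esub> y \<squnion>\<^bsub>L\<^esub> (x \<sqinter>\<^bsub>L\<^esub> z)"
      if x: "x \<in> carrier L" and yz: "y \<in> carrier L" "z \<in> carrier L" for x y z
    proof -
      have "{y, z} \<subseteq> carrier L" using yz by simp
      from sup_distributiveD(2)[OF sd this fin[OF _ this] x] show ?thesis
        unfolding join_def by (intro M.sup_eqI[symmetric]) simp
    qed
  qed
qed

lemma frame_hom_eq: "frame_hom K L = sup_hom K (\<lambda>_. True) L"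
  by (simp add: frame_hom_def sup_hom_def)

lemma preframe_hom_eq: "preframe_hom K L = sup_hom K (directed K) L"
  by (auto simp: preframe_hom_def sup_hom_def directed_def)

text \<open>Binary joins and the bottom element are suprema of finite sets; conversely, the supremum of a
  finitely bounded set is an iterated join of bounding elements, and these still bound its image
  under a monotone map.\<close>

lemma lattice_hom_eq:
  assumes "distributive_lattice K" "distributive_lattice L"
  shows "lattice_hom K L = sup_hom K (finitely_bounded K) L"
proof (intro equalityI subsetI)
  interpret K: distributive_lattice K by fact
  interpret L: distributive_lattice L by fact
  note fin = finitely_bounded_finite[OF K.partial_order_axioms]
  fix h assume h: "h \<in> sup_hom K (finitely_bounded K) L"
  then have pres: "h (\<Squnion>\<^bsub>K\<^esub>F) = \<Squnion>\<^bsub>L\<^esub>(h ` F)" if "finite F" "F \<subseteq> carrier K" for F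
    using fin[OF that] that(2) unfolding sup_hom_def by blast
  have "\<bottom>\<^bsub>K\<^esub> = \<Squnion>\<^bsub>K\<^esub>{}" "\<bottom>\<^bsub>L\<^esub> = \<Squnion>\<^bsub>L\<^esub>{}" by (simp_all add: sup_def bottom_def)
  then have "h \<bottom>\<^bsub>K\<^esub> = \<bottom>\<^bsub>L\<^esub>" using pres[of "{}"] by simp
  moreover have "h (x \<squnion>\<^bsub>K\<^esub> y) = h x \<squnion>\<^bsub>L\<^esub> h y" if "x \<in> carrier K" "y \<in> carrier K" for x y
    using pres[of "{x, y}"] that by (simp add: join_def)
  ultimately show "h \<in> lattice_hom K L" using h by (simp add: lattice_hom_def sup_hom_def)
next
  interpret K: distributive_lattice K by fact
  interpret L: distributive_lattice L by fact
  have KM: "meet_semilattice K" by unfold_locales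
  have LM: "meet_semilattice L" by unfold_locales
  fix h assume h: "h \<in> lattice_hom K L"
  then have sh: "h \<in> semilattice_hom K L" and hbot: "h \<bottom>\<^bsub>K\<^esub> = \<bottom>\<^bsub>L\<^esub>"
    and hjoin: "\<And>x y. \<lbrakk>x \<in> carrier K; y \<in> carrier K\<rbrakk> \<Longrightarrow> h (x \<squnion>\<^bsub>K\<^esub> y) = h x \<squnion>\<^bsub>L\<^esub> h y"
    and hc: "\<And>x. x \<in> carrier K \<Longrightarrow> h x \<in> carrier L"
    by (auto simp: lattice_hom_def semilattice_hom_def)
  have fin: "\<exists>s. least K s (Upper K F) \<and> least L (h s) (Upper L (h ` F))" if "finite F" "F \<subseteq> carrier K" for F
    using that
  proof (induction F rule: finite_induct)
    case empty
    have "least K \<bottom>\<^bsub>K\<^esub> (Upper K {})" "least L \<bottom>\<^bsub>L\<^esub> (Upper L {})"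
      using K.bottom_exists K.bottom_eqI L.bottom_exists L.bottom_eqI by auto
    then show ?case using hbot by (intro exI[of _ "\<bottom>\<^bsub>K\<^esub>"]) simp
  next
    case (insert a F)
    have a: "a \<in> carrier K" and F: "F \<subseteq> carrier K" using insert.prems by auto
    have hF: "h ` F \<subseteq> carrier L" using F hc by auto
    obtain t where t: "least K t (Upper K F)" "least L (h t) (Upper L (h ` F))"
      using insert.IH[OF F] by blast
    have tc: "t \<in> carrier K" using t(1) unfolding least_Upper_iff[OF F] by blast
    have "least K (a \<squnion>\<^bsub>K\<^esub> t) (Upper K (insert a F))"
      unfolding K.least_Upper_insert[OF F t(1) a] join_def by (rule K.sup_of_two_least[OF a tc])
    moreover have "least L (h (a \<squnion>\<^bsub>K\<^esub> t)) (Upper L (h ` insert a F))"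
      unfolding image_insert L.least_Upper_insert[OF hF t(2) hc[OF a]] hjoin[OF a tc]
      unfolding join_def
      by (rule L.sup_of_two_least[OF hc[OF a] hc[OF tc]])
    ultimately show ?case by blast
  qed
  have "h (\<Squnion>\<^bsub>K\<^esub>U) = \<Squnion>\<^bsub>L\<^esub>(h ` U)" if fb: "finitely_bounded K U" for U
  proof -
    obtain F where U: "U \<subseteq> carrier K" and F: "finite F" "F \<subseteq> U" "\<forall>u \<in> U. \<exists>m \<in> F. u \<sqsubseteq>\<^bsub>K\<^esub> m"
      using fb unfolding finitely_bounded_iff[OF K.partial_order_axioms] by blast
    obtain s where s: "least K s (Upper K F)" "least L (h s) (Upper L (h ` F))"
      using fin[OF F(1) subset_trans[OF F(2) U]] by blast
    have "\<forall>v \<in> h ` U. \<exists>m \<in> h ` F. v \<sqsubseteq>\<^bsub>L\<^esub> m"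
    proof
      fix v assume "v \<in> h ` U"
      then obtain u where u: "u \<in> U" "v = h u" by blast
      obtain m where m: "m \<in> F" "u \<sqsubseteq>\<^bsub>K\<^esub> m" using F(3) u(1) by blast
      have c: "u \<in> carrier K" "m \<in> carrier K" using u m F(2) U by blast+
      show "\<exists>m \<in> h ` F. v \<sqsubseteq>\<^bsub>L\<^esub> m"
        unfolding u(2) by (intro bexI[of _ "h m"] semilattice_hom_mono[OF KM LM sh c m(2)] imageI m(1))
    qed
    moreover have "h ` U \<subseteq> carrier L" using U hc by auto
    ultimately have "least L (h s) (Upper L (h ` U))"
      using s(2) least_Upper_cofinal[OF L.partial_order_axioms _ image_mono[OF F(2)]] by blast
    moreover have "least K s (Upper K U)"
      unfolding least_Upper_cofinal[OF K.partial_order_axioms U F(2,3)] by (rule s(1))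
    ultimately show ?thesis using K.sup_eqI L.sup_eqI by simp
  qed
  then show "h \<in> sup_hom K (finitely_bounded K) L" using sh by (simp add: sup_hom_def)
qed

section \<open>The order on subunits of broad presheaves\<close>

context stiff_category
begin

lemma restricts_mono:
  assumes p: "p \<in> carrier (ISub C)" and q: "q \<in> carrier (ISub C)" and le: "p \<sqsubseteq>\<^bsub>ISub C\<^esub> q"
    and f: "f \<in> Arr C" "Cod C f = TUnit C" and r: "restricts C f p"
  shows "restricts C f q"
proof -
  obtain s t where s: "s \<in> p" and t: "t \<in> q" using p q ISub_nonempty by blast
  have "sub_le C f s" using restricts_unit_iff[OF p s f] r by simp
  moreover have "sub_le C s t" using ISub_le_iff[OF p q s t] le by simp
  ultimately have "sub_le C f t" by (rule sub_le_trans) (rule ISub_member_typing(1)[OF q t])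
  then show ?thesis using restricts_unit_iff[OF q t f] by simp
qed

lemma down_subset_carrier: "down (ISub C) V \<subseteq> carrier (ISub C)"
  by (auto simp: down_def)

lemma sieve_down:
  assumes V: "V \<subseteq> carrier (ISub C)" and A: "A \<in> Obj C"
  shows "PObj (sieve (down (ISub C) V)) A = PObj (sieve V) A"
proof -
  interpret P: partial_order "ISub C" by (rule ISub_partial_order)
  have "(\<exists>p \<in> down (ISub C) V. restricts C f p) \<longleftrightarrow> (\<exists>p \<in> V. restricts C f p)"
    if f: "f \<in> Arr C" "Cod C f = TUnit C" for f
  proof
    assume "\<exists>p \<in> down (ISub C) V. restricts C f p"
    then obtain p q where p: "p \<in> carrier (ISub C)" "restricts C f p" and q: "q \<in> V" "p \<sqsubseteq>\<^bsub>ISub C\<^esub> q"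
      unfolding down_def by blast
    then show "\<exists>p \<in> V. restricts C f p" using restricts_mono[OF p(1) subsetD[OF V q(1)] q(2) f p(2)] by blast
  next
    assume "\<exists>p \<in> V. restricts C f p"
    then show "\<exists>p \<in> down (ISub C) V. restricts C f p" using V P.le_refl unfolding down_def by blast
  qed
  then show ?thesis unfolding bracket_simps(1)[OF A] by (intro arg_cong[where f = "(`) ArrE"] Collect_cong) blast
qed

text \<open>A lower set is recovered from its sieve: \<open>p\<close> belongs to it if and only if a representative of \<open>p\<close>,
  as an arrow into \<open>I\<close>, belongs to the sieve.\<close>

lemma sieve_subset_iff:
  assumes V: "V \<subseteq> carrier (ISub C)" and W: "W \<subseteq> carrier (ISub C)" "down (ISub C) W \<subseteq> W"
  shows "(\<forall>A \<in> Obj C. PObj (sieve V) A \<subseteq> (PObj (sieve W) A :: ('x, 'o, 'a) elt set)) \<longleftrightarrow> V \<subseteq> W"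
proof
  assume "V \<subseteq> W"
  then show "\<forall>A \<in> Obj C. PObj (sieve V) A \<subseteq> (PObj (sieve W) A :: ('x, 'o, 'a) elt set)"
    by (auto simp: bracket_simps(1))
next
  assume sub: "\<forall>A \<in> Obj C. PObj (sieve V) A \<subseteq> (PObj (sieve W) A :: ('x, 'o, 'a) elt set)"
  show "V \<subseteq> W"
  proof
    fix p assume p: "p \<in> V"
    have pc: "p \<in> carrier (ISub C)" using p V by blast
    obtain s where s: "s \<in> p" using ISub_nonempty[OF pc] by blast
    note st = ISub_member_typing[OF pc s]
    have "restricts C s p" using restricts_unit_iff[OF pc s st] sub_le_refl[OF st(1)] by simp
    then have "(ArrE s :: ('x, 'o, 'a) elt) \<in> PObj (sieve V) (Dom C s)"
      unfolding bracket_simps(1)[OF dom_obj[OF st(1)]] using st p by blast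
    then have "(ArrE s :: ('x, 'o, 'a) elt) \<in> PObj (sieve W) (Dom C s)"
      using bspec[OF sub dom_obj[OF st(1)]] by blast
    then obtain q where q: "q \<in> W" "restricts C s q"
      unfolding bracket_simps(1)[OF dom_obj[OF st(1)]] by blast
    have qc: "q \<in> carrier (ISub C)" using q(1) W(1) by blast
    obtain t where t: "t \<in> q" using ISub_nonempty[OF qc] by blast
    have "sub_le C s t" using restricts_unit_iff[OF qc t st] q(2) by simp
    then have "p \<sqsubseteq>\<^bsub>ISub C\<^esub> q" using ISub_le_iff[OF pc qc s t] by simp
    then have "p \<in> down (ISub C) W" using pc q(1) unfolding down_def by blast
    then show "p \<in> W" using W(2) by blast
  qed
qed

text \<open>The three categories of broad presheaves differ in the admissible families \<open>U\<close> only; all that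
  matters is that singletons are admissible and that admissibility passes to monotone images and to
  generated lower sets.\<close>

context
  fixes Q :: "'a set set \<Rightarrow> bool" and D :: "('x, 'o, 'a) psh_cat"
  assumes Q_single: "\<And>p. p \<in> carrier (ISub C) \<Longrightarrow> Q {p}"
    and Q_image: "\<And>U \<nu>. \<lbrakk>U \<subseteq> carrier (ISub C); Q U; \<nu> ` U \<subseteq> carrier (ISub C);
      \<And>p q. \<lbrakk>p \<in> U; q \<in> U; p \<sqsubseteq>\<^bsub>ISub C\<^esub> q\<rbrakk> \<Longrightarrow> \<nu> p \<sqsubseteq>\<^bsub>ISub C\<^esub> \<nu> q\<rbrakk> \<Longrightarrow> Q (\<nu> ` U)"
    and Q_down: "\<And>V. \<lbrakk>V \<subseteq> carrier (ISub C); Q V\<rbrakk> \<Longrightarrow> Q (down (ISub C) V)"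
  defines "D \<equiv> full_sub (PSh C) (broad_wrt C Q)"
begin

abbreviation img :: "('o, 'a, ('x, 'o, 'a) elt) nat_trans \<Rightarrow> 'o \<Rightarrow> ('x, 'o, 'a) elt set" where
  "img n A \<equiv> NMap n A ` PObj (NDom n) A"

lemma Q_top: "Q {subobj C (Id C (TUnit C))}"
  by (rule Q_single[OF subobj_subunit(1)[OF top_subunit]])

lemma mono_D:
  assumes "is_mono D n"
  shows "is_nat_trans C n" "broad_wrt C Q (NDom n)" "broad_wrt C Q (NCod n)"
    and "A \<in> Obj C \<Longrightarrow> inj_on (NMap n A) (PObj (NDom n) A)"
proof -
  show n: "is_nat_trans C n" "broad_wrt C Q (NDom n)" "broad_wrt C Q (NCod n)"
    using assms by (simp_all add: D_def is_mono_def)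
  show "A \<in> Obj C \<Longrightarrow> inj_on (NMap n A) (PObj (NDom n) A)"
    using mono_PSh_iff[OF n(1), of "broad_wrt C Q"] n(2,3) broad_representable[where Q = Q, OF Q_top] assms
    unfolding D_def by blast
qed

lemma sub_le_D_iff:
  assumes n: "is_mono D n" and m: "is_mono D m"
  shows "sub_le D n m \<longleftrightarrow> NCod n = NCod m \<and> (\<forall>A \<in> Obj C. img n A \<subseteq> img m A)"
proof -
  have "sub_le D n m \<Longrightarrow> NCod n = NCod m" by (simp add: sub_le_def D_def)
  moreover have "sub_le D n m \<longleftrightarrow> (\<forall>A \<in> Obj C. img n A \<subseteq> img m A)" if "NCod n = NCod m"
    unfolding D_def by (rule sub_le_PSh_iff[OF mono_D(1)[OF n] mono_D(1)[OF m] that mono_D(2)[OF n]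
      mono_D(2)[OF m] mono_D(4)[OF m]])
  ultimately show ?thesis by blast
qed

lemma mem_subobj_iff:
  assumes n: "is_mono D n"
  shows "m \<in> subobj D n \<longleftrightarrow> is_mono D m \<and> NCod m = NCod n \<and> (\<forall>A \<in> Obj C. img m A = img n A)"
proof (cases "is_mono D m")
  case True
  have eq: "(\<forall>A \<in> Obj C. img m A = img n A) \<longleftrightarrow>
      (\<forall>A \<in> Obj C. img m A \<subseteq> img n A) \<and> (\<forall>A \<in> Obj C. img n A \<subseteq> img m A)"
    by (simp only: set_eq_subset ball_conj_distrib)
  show ?thesis
    unfolding subobj_def mem_Collect_eq eq sub_le_D_iff[OF n True] sub_le_D_iff[OF True n]
    by (rule iffI; elim conjE; intro conjI True; (assumption | erule sym))
qed (simp add: subobj_def)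

lemma subobj_D_eqI:
  assumes n: "is_mono D n" and m: "is_mono D m" and "NCod n = NCod m"
    and "\<And>A. A \<in> Obj C \<Longrightarrow> img n A = img m A"
  shows "subobj D n = subobj D m"
  using mem_subobj_iff[OF n] mem_subobj_iff[OF m] assms(3,4) by auto

lemma incl_subunit:
  assumes "U \<subseteq> carrier (ISub C)" "Q U"
  shows "subunit D (bracket_incl C U)" "is_mono D (bracket_incl C U)"
    "NCod (bracket_incl C U :: ('o, 'a, ('x, 'o, 'a) elt) nat_trans) = representable C (TUnit C)"
    and "A \<in> Obj C \<Longrightarrow> img (bracket_incl C U) A = PObj (sieve U) A"
proof -
  show s: "subunit D (bracket_incl C U)"
    unfolding D_def by (rule bracket_incl_subunit[where Q = Q, OF assms Q_top])
  then show "is_mono D (bracket_incl C U)" by (simp add: subunit_def)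
  show "NCod (bracket_incl C U :: ('o, 'a, ('x, 'o, 'a) elt) nat_trans) = representable C (TUnit C)"
    by (rule bracket_incl_trans(3)[OF assms(1)])
  assume A: "A \<in> Obj C"
  have "img (bracket_incl C U) A = (\<lambda>x. x) ` PObj (sieve U) A"
    unfolding bracket_incl_trans(2)[OF assms(1)]
    by (rule image_cong[OF refl bracket_incl_trans(4)[OF assms(1) A]])
  then show "img (bracket_incl C U) A = PObj (sieve U) A" by simp
qed

text \<open>Subunits with the same image in \<open>C(-, I)\<close> represent the same subobject, and the image of a subunit
  is a sieve by \<open>subunit_PSh_image\<close>.\<close>

lemma subunit_D_eq_incl:
  assumes n: "subunit D n"
  shows "\<exists>W \<in> lower_sets (ISub C) Q. subobj D n = subobj D (bracket_incl C W)"
proof -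
  interpret P: partial_order "ISub C" by (rule ISub_partial_order)
  obtain U \<nu> where U: "U \<subseteq> carrier (ISub C)" "Q U" and \<nu>: "\<nu> ` U \<subseteq> carrier (ISub C)"
    "\<And>p q. \<lbrakk>p \<in> U; q \<in> U; p \<sqsubseteq>\<^bsub>ISub C\<^esub> q\<rbrakk> \<Longrightarrow> \<nu> p \<sqsubseteq>\<^bsub>ISub C\<^esub> \<nu> q"
    and im: "\<And>A. A \<in> Obj C \<Longrightarrow> img n A = PObj (sieve (\<nu> ` U)) A"
    using subunit_PSh_image[of Q n, OF n[unfolded D_def] Q_top] by blast
  let ?W = "down (ISub C) (\<nu> ` U)"
  have Q: "Q ?W" by (rule Q_down[OF \<nu>(1) Q_image[OF U \<nu>]])
  have "down (ISub C) ?W \<subseteq> ?W"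
  proof
    fix p assume "p \<in> down (ISub C) ?W"
    then obtain q r where pqr: "p \<in> carrier (ISub C)" "q \<in> carrier (ISub C)" "r \<in> \<nu> ` U"
      "p \<sqsubseteq>\<^bsub>ISub C\<^esub> q" "q \<sqsubseteq>\<^bsub>ISub C\<^esub> r" unfolding down_def by blast
    have "p \<sqsubseteq>\<^bsub>ISub C\<^esub> r" by (rule P.le_trans[OF pqr(4,5,1,2) subsetD[OF \<nu>(1) pqr(3)]])
    then show "p \<in> ?W" using pqr unfolding down_def by blast
  qed
  then have W: "?W \<in> lower_sets (ISub C) Q"
    using Q down_subset_carrier by (simp add: lower_sets_def)
  have "is_mono D n" "NCod n = representable C (TUnit C)" using n by (simp_all add: subunit_def D_def)
  then have "subobj D n = subobj D (bracket_incl C ?W)"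
    using incl_subunit[OF down_subset_carrier Q] im
    by (intro subobj_D_eqI) (simp_all add: sieve_down[OF \<nu>(1)])
  with W show ?thesis by blast
qed

lemma ISub_D_lower_set_order:
  "lower_set_order (ISub C) (ISub D) Q (\<lambda>W. subobj D (bracket_incl C W))"
proof (rule lower_set_order.intro)
  show "meet_semilattice (ISub C)" by (rule ISub_meet_semilattice)
  show "eq (ISub D) = (=)" by (simp add: ISub_def)
  show "carrier (ISub D) = (\<lambda>W. subobj D (bracket_incl C W)) ` lower_sets (ISub C) Q"
  proof (intro equalityI subsetI)
    fix x assume "x \<in> carrier (ISub D)"
    then obtain n where "subunit D n" "x = subobj D n" by (auto simp: ISub_def)
    then show "x \<in> (\<lambda>W. subobj D (bracket_incl C W)) ` lower_sets (ISub C) Q"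
      using subunit_D_eq_incl by blast
  next
    fix x assume "x \<in> (\<lambda>W. subobj D (bracket_incl C W)) ` lower_sets (ISub C) Q"
    then obtain W where "W \<subseteq> carrier (ISub C)" "Q W" "x = subobj D (bracket_incl C W)"
      by (auto simp: lower_sets_def)
    then show "x \<in> carrier (ISub D)" using incl_subunit(1) by (auto simp: ISub_def)
  qed
  fix V W assume "V \<in> lower_sets (ISub C) Q" "W \<in> lower_sets (ISub C) Q"
  then have V: "V \<subseteq> carrier (ISub C)" "Q V" and W: "W \<subseteq> carrier (ISub C)" "Q W" "down (ISub C) W \<subseteq> W"
    by (auto simp: lower_sets_def)
  note nV = incl_subunit[OF V] and nW = incl_subunit[OF W(1,2)]
  have "subobj D (bracket_incl C V) \<sqsubseteq>\<^bsub>ISub D\<^esub> subobj D (bracket_incl C W)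
      \<longleftrightarrow> (\<exists>n \<in> subobj D (bracket_incl C V). \<exists>m \<in> subobj D (bracket_incl C W). sub_le D n m)"
    by (simp add: ISub_def)
  also have "\<dots> \<longleftrightarrow> (\<forall>A \<in> Obj C. PObj (sieve V) A \<subseteq> (PObj (sieve W) A :: ('x, 'o, 'a) elt set))"
  proof
    assume "\<exists>n \<in> subobj D (bracket_incl C V). \<exists>m \<in> subobj D (bracket_incl C W). sub_le D n m"
    then obtain n m where n: "n \<in> subobj D (bracket_incl C V)" and m: "m \<in> subobj D (bracket_incl C W)"
      and le: "sub_le D n m" by blast
    have n': "is_mono D n" "\<forall>A \<in> Obj C. img n A = img (bracket_incl C V) A"
      using n unfolding mem_subobj_iff[OF nV(2)] by blast+
    have m': "is_mono D m" "\<forall>A \<in> Obj C. img m A = img (bracket_incl C W) A"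
      using m unfolding mem_subobj_iff[OF nW(2)] by blast+
    show "\<forall>A \<in> Obj C. PObj (sieve V) A \<subseteq> (PObj (sieve W) A :: ('x, 'o, 'a) elt set)"
      using le n'(2) m'(2) nV(4) nW(4) unfolding sub_le_D_iff[OF n'(1) m'(1)] by simp
  next
    assume sub: "\<forall>A \<in> Obj C. PObj (sieve V) A \<subseteq> (PObj (sieve W) A :: ('x, 'o, 'a) elt set)"
    have "bracket_incl C V \<in> subobj D (bracket_incl C V)" "bracket_incl C W \<in> subobj D (bracket_incl C W)"
      using mem_subobj_iff[OF nV(2)] mem_subobj_iff[OF nW(2)] nV(2) nW(2) by simp_all
    moreover have "sub_le D (bracket_incl C V) (bracket_incl C W)"
      unfolding sub_le_D_iff[OF nV(2) nW(2)] using nV(3,4) nW(3,4) sub by simp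
    ultimately show "\<exists>n \<in> subobj D (bracket_incl C V). \<exists>m \<in> subobj D (bracket_incl C W). sub_le D n m"
      by blast
  qed
  also have "\<dots> \<longleftrightarrow> V \<subseteq> W" by (rule sieve_subset_iff[OF V(1) W(1,3)])
  finally show "subobj D (bracket_incl C V) \<sqsubseteq>\<^bsub>ISub D\<^esub> subobj D (bracket_incl C W) \<longleftrightarrow> V \<subseteq> W" .
qed

lemma subunit_embedding_eq:
  assumes p: "p \<in> carrier (ISub C)"
  shows "subunit_embedding C D p = subobj D (bracket_incl C (down (ISub C) {p}))"
  unfolding subunit_embedding_def
proof (rule subobj_D_eqI)
  have P: "{p} \<subseteq> carrier (ISub C)" "Q {p}" using p Q_single by simp_all
  note s = incl_subunit[OF P] and d = incl_subunit[OF down_subset_carrier Q_down[OF P]]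
  show "is_mono D (bracket_incl C {p})" "is_mono D (bracket_incl C (down (ISub C) {p}))"
    by (rule s(2), rule d(2))
  show "NCod (bracket_incl C {p} :: ('o, 'a, ('x, 'o, 'a) elt) nat_trans) = NCod (bracket_incl C (down (ISub C) {p}))"
    unfolding s(3) d(3) ..
  show "img (bracket_incl C {p}) A = img (bracket_incl C (down (ISub C) {p})) A" if "A \<in> Obj C" for A
    unfolding s(4)[OF that] d(4)[OF that] sieve_down[OF P(1) that] ..
qed

end

end

theorem corollary9p7:
  fixes C :: "('o, 'a, 'm) braided_cat_scheme"
  assumes "stiff_category C"
  shows "free_completion distributive_lattice (distributive_lattice :: 'l gorder \<Rightarrow> bool) lattice_hom
           (ISub C) (ISub (PSh_fin C :: ('x, 'o, 'a) psh_cat)) (subunit_embedding C (PSh_fin C)) \<and>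
         free_completion preframe (preframe :: 'l gorder \<Rightarrow> bool) preframe_hom
           (ISub C) (ISub (PSh_dir C :: ('x, 'o, 'a) psh_cat)) (subunit_embedding C (PSh_dir C)) \<and>
         free_completion frame (frame :: 'l gorder \<Rightarrow> bool) frame_hom
           (ISub C) (ISub (PSh_brd C :: ('x, 'o, 'a) psh_cat)) (subunit_embedding C (PSh_brd C))"
proof (intro conjI)
  interpret stiff_category C by fact
  note S = ISub_meet_semilattice
  interpret S: meet_semilattice "ISub C" by (rule S)
  note po = S.partial_order_axioms
  have LM: "meet_semilattice L" if "sup_distributive L J" for L :: "'l gorder" and J
    using that by (simp add: sup_distributive_def)
  show "free_completion distributive_lattice (distributive_lattice :: 'l gorder \<Rightarrow> bool) lattice_hom
      (ISub C) (ISub (PSh_fin C :: ('x, 'o, 'a) psh_cat)) (subunit_embedding C (PSh_fin C))"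
  proof -
    let ?Q = "ISub (PSh_fin C :: ('x, 'o, 'a) psh_cat)" and ?J = "finitely_bounded (ISub C)"
    have Q: "?J {p}" if "p \<in> carrier (ISub C)" for p
      by (rule finitely_bounded_finite[OF po]) (use that in simp_all)
    note kind = Q finitely_bounded_image[OF po] finitely_bounded_down[OF po]
    interpret lower_set_completion "ISub C" ?Q ?J "\<lambda>W. subobj (PSh_fin C) (bracket_incl C W)" "finitely_bounded ?Q"
      unfolding PSh_fin_def
      by (rule lower_set_completion_finite[OF ISub_D_lower_set_order]) (rule kind; assumption)+
    have dl: "distributive_lattice ?Q" unfolding distributive_lattice_iff by (rule Q_sup_distributive)
    show ?thesis
    proof (rule free_completion[where JL = finitely_bounded])
      show "sup_distributive L (finitely_bounded L)" if "distributive_lattice L" for L :: "'l gorder"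
        using that by (simp only: distributive_lattice_iff)
      show "lattice_hom ?Q L = sup_hom ?Q (finitely_bounded ?Q) L" if "distributive_lattice L" for L :: "'l gorder"
        by (rule lattice_hom_eq[OF dl that])
      show "finitely_bounded L (f ` W)"
        if L: "distributive_lattice L" and W: "W \<in> Low" and f: "f \<in> semilattice_hom (ISub C) L" for L :: "'l gorder" and W f
      proof -
        interpret L: meet_semilattice L using L LM unfolding distributive_lattice_iff by blast
        show ?thesis
          by (rule finitely_bounded_image[OF L.partial_order_axioms LowD(2)[OF W]
                hom_image[OF L.meet_semilattice_axioms f W]])
      qed
      show "subunit_embedding C (PSh_fin C) a = subobj (PSh_fin C :: ('x, 'o, 'a) psh_cat) (bracket_incl C (down (ISub C) {a}))"
        if "a \<in> carrier (ISub C)" for a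
        unfolding PSh_fin_def by (rule subunit_embedding_eq[OF _ _ _ that]) (rule kind; assumption)+
    qed (rule dl)
  qed
  show "free_completion preframe (preframe :: 'l gorder \<Rightarrow> bool) preframe_hom
      (ISub C) (ISub (PSh_dir C :: ('x, 'o, 'a) psh_cat)) (subunit_embedding C (PSh_dir C))"
  proof -
    let ?Q = "ISub (PSh_dir C :: ('x, 'o, 'a) psh_cat)" and ?J = "directed (ISub C)"
    have Q: "?J {p}" if "p \<in> carrier (ISub C)" for p
      using that by (simp add: directed_def)
    note kind = Q directed_image directed_down[OF po]
    interpret lower_set_completion "ISub C" ?Q ?J "\<lambda>W. subobj (PSh_dir C) (bracket_incl C W)" "directed ?Q"
      unfolding PSh_dir_def
      by (rule lower_set_completion_directed[OF ISub_D_lower_set_order]) (rule kind; assumption)+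
    show ?thesis
    proof (rule free_completion[where JL = directed])
      show "preframe ?Q" unfolding preframe_iff by (rule Q_sup_distributive)
      show "sup_distributive L (directed L)" if "preframe L" for L :: "'l gorder"
        using that by (simp only: preframe_iff)
      show "preframe_hom ?Q L = sup_hom ?Q (directed ?Q) L" for L :: "'l gorder"
        by (rule preframe_hom_eq)
      show "directed L (f ` W)"
        if L: "preframe L" and W: "W \<in> Low" and f: "f \<in> semilattice_hom (ISub C) L" for L :: "'l gorder" and W f
      proof -
        have M: "meet_semilattice L" using L LM unfolding preframe_iff by blast
        show ?thesis by (rule directed_image[OF LowD(2)[OF W] hom_image[OF M f W]])
      qed
      show "subunit_embedding C (PSh_dir C) a = subobj (PSh_dir C :: ('x, 'o, 'a) psh_cat) (bracket_incl C (down (ISub C) {a}))"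
        if "a \<in> carrier (ISub C)" for a
        unfolding PSh_dir_def by (rule subunit_embedding_eq[OF _ _ _ that]) (rule kind; assumption)+
    qed
  qed
  show "free_completion frame (frame :: 'l gorder \<Rightarrow> bool) frame_hom
      (ISub C) (ISub (PSh_brd C :: ('x, 'o, 'a) psh_cat)) (subunit_embedding C (PSh_brd C))"
  proof -
    let ?Q = "ISub (PSh_brd C :: ('x, 'o, 'a) psh_cat)"
    interpret lower_set_completion "ISub C" ?Q "\<lambda>_. True" "\<lambda>W. subobj (PSh_brd C) (bracket_incl C W)" "\<lambda>_. True"
      unfolding PSh_brd_def
      by (rule lower_set_completion_all[OF ISub_D_lower_set_order]) simp_all
    show ?thesis
    proof (rule free_completion[where JL = "\<lambda>_ _. True"])
      show "frame ?Q" unfolding frame_iff by (rule Q_sup_distributive)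
      show "sup_distributive L (\<lambda>_. True)" if "frame L" for L :: "'l gorder"
        using that by (simp only: frame_iff)
      show "frame_hom ?Q L = sup_hom ?Q (\<lambda>_. True) L" for L :: "'l gorder"
        by (rule frame_hom_eq)
      show "subunit_embedding C (PSh_brd C) a = subobj (PSh_brd C :: ('x, 'o, 'a) psh_cat) (bracket_incl C (down (ISub C) {a}))"
        if "a \<in> carrier (ISub C)" for a
        unfolding PSh_brd_def by (rule subunit_embedding_eq[OF _ _ _ that]) simp_all
    qed simp
  qed
qed

end
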